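(* Let $0 \leq \gamma < 1$, and let $\alpha, \beta > 0$ be such that $\alpha + \beta = 1 - \gamma$. Let $T_{\alpha,\beta}$ be the operator given by $$(T_{\alpha, \beta} \, b)(j) = \sum_{i \in \mathbb{Z},\, i \neq \pm j} \frac{b(i)}{|i-j|^{\alpha} |i+j|^{\beta}}, \qquad j \in \mathbb{Z}.$$ If $0 < p \leq 1$ and $\frac{1}{q} = \frac{1}{p} - \gamma$, then for every $b \in H^{p}(\mathbb{Z})$ $$\| T_{\alpha, \beta} \, b \|_{\ell^{q}(\mathbb{Z})} \leq C \| b \|_{H^{p}(\mathbb{Z})},$$ where $C$ depends only on $\alpha$, $\beta$, $p$ and $q$.
   Context: Sequences $b = \{b(i)\}_{i \in \mathbb{Z}}$ are complex-valued. For $0 < p < \infty$, $\|b\|_{\ell^p(\mathbb{Z})} = \left( \sum_{i \in \mathbb{Z}} |b(i)|^p \right)^{1/p}$, and $b \in \ell^p(\mathbb{Z})$ means $\|b\|_{\ell^p(\mathbb{Z})} < +\infty$. The discrete Hilbert transform $H$ of a sequence $b$ is $$(Hb)(j) = \frac{1}{\pi} \sum_{i=-\infty}^{\infty} \frac{b(i)}{j+i+\frac{1}{2}}, \qquad j \in \mathbb{Z}.$$ The discrete Hardy space $H^{p}(\mathbb{Z})$, $0 < p < \infty$, consists of all sequences $b \in \ell^{p}(\mathbb{Z})$ with $Hb \in \ell^{p}(\mathbb{Z})$, and its "norm" is $\| b \|_{H^{p}(\mathbb{Z})} = \| b \|_{\ell^{p}(\mathbb{Z})} + \| Hb \|_{\ell^{p}(\mathbb{Z})}$.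 *)

theory Defs
  imports "HOL-Analysis.Analysis"
begin

text \<open>Membership in \<open>\<ell>\<^sup>p(\<int>)\<close> says that the defining series is summable; the real-valued
  \<open>lp_norm\<close> carries its intended meaning only on \<open>lp_space\<close>, where the \<open>\<ell>\<^sup>p\<close> norm is finite.\<close>

definition lp_space :: "real \<Rightarrow> (int \<Rightarrow> complex) set" where
  "lp_space p = {b. (\<lambda>i. norm (b i) powr p) summable_on UNIV}"

definition lp_norm :: "real \<Rightarrow> (int \<Rightarrow> complex) \<Rightarrow> real" where
  "lp_norm p b = (\<Sum>\<^sub>\<infinity>i. norm (b i) powr p) powr (1 / p)"

text \<open>For \<open>b \<in> lp_space p\<close> with \<open>0 < p < \<infinity>\<close> the following series converges absolutely
  (for \<open>p > 1\<close> by Hoelder's inequality), so the default value of \<open>infsum\<close> plays no role.\<close>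

definition discrete_hilbert :: "(int \<Rightarrow> complex) \<Rightarrow> int \<Rightarrow> complex" where
  "discrete_hilbert b j =
     complex_of_real (1 / pi) * (\<Sum>\<^sub>\<infinity>i. b i / (of_int j + of_int i + 1 / 2))"

definition hardy_space :: "real \<Rightarrow> (int \<Rightarrow> complex) set" where
  "hardy_space p = {b \<in> lp_space p. discrete_hilbert b \<in> lp_space p}"

definition hardy_norm :: "real \<Rightarrow> (int \<Rightarrow> complex) \<Rightarrow> real" where
  "hardy_norm p b = lp_norm p b + lp_norm p (discrete_hilbert b)"

text \<open>For \<open>\<alpha>, \<beta> > 0\<close> the kernel is bounded by 1 on the index set, so this series converges
  absolutely for every \<open>b \<in> lp_space p\<close> with \<open>0 < p \<le> 1\<close>.\<close>

definition T_op :: "real \<Rightarrow> real \<Rightarrow> (int \<Rightarrow> complex) \<Rightarrow> int \<Rightarrow> complex" where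
  "T_op \<alpha> \<beta> b j =
     (\<Sum>\<^sub>\<infinity>i\<in>{i. i \<noteq> j \<and> i \<noteq> - j}.
        b i / complex_of_real (\<bar>real_of_int (i - j)\<bar> powr \<alpha> * \<bar>real_of_int (i + j)\<bar> powr \<beta>))"

end

theory Submission
  imports Defs "HOL-Complex_Analysis.Complex_Analysis" "HOL-Real_Asymp.Real_Asymp"
begin

text \<open>The proof avoids atomic decompositions. Let \<open>C(z) = \<Sum> b(i) / (z - i)\<close> be the Cauchy transform
  of \<open>b\<close>. On each of the three intervals cut out of the real line by \<open>\<plusminus>j\<close> the kernel of \<open>T b (j)\<close> is the
  restriction of a holomorphic branch \<open>K\<close>, so Cauchy's formula turns \<open>T b (j)\<close> into integrals of \<open>C K\<close>
  over the vertical lines \<open>Re z = \<plusminus>j \<plusminus> 1/2\<close>, where no cancellation is needed any more.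

  The size of \<open>C\<close> on these lines is governed by \<open>b\<close> and \<open>H b\<close>: the entire function \<open>S(z) = sin(\<pi> z) C(z)\<close>
  has exponential type \<open>\<pi>\<close>, up to signs and factors \<open>\<pi>\<close> its values on \<open>\<int>\<close> and \<open>\<int> + 1/2\<close> are \<open>b\<close> and
  \<open>H b\<close>, and oversampled interpolation bounds \<open>|S|^r\<close>, \<open>r = p/2\<close>, on the real line by a discrete Poisson
  sum of \<open>f = |b|^r + |C(\<sqdot> + 1/2)|^r\<close>. The maximum principle for \<open>|F|^r\<close> minus a positive harmonic
  function, with \<open>F(z) = exp(i \<pi> z) S(z)\<close>, carries the bound to the upper half-plane. As \<open>f\<close> lies in
  \<open>\<ell>\<^sup>2\<close>, a Hedberg type interpolation and a weighted Schur test for Poisson sums give the claim.\<close>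

subsection \<open>Dyadic sums of discrete Poisson integrals\<close>

text \<open>Size estimates of the kernel alone cannot suffice: for the unit mass at 0 the value of
  \<open>T_op\<close> at j \<noteq> 0 is |j|^(-(1-\<gamma>)), and for p = 1 its q-th power is 1/|j|,
  which is not summable. The cancellation of b has to be used, and it is accessible only through Hb.
  Truncating b does not keep Hb under control: a finite sequence with nonzero sum has Hb of size
  1/|j|, which is not in l^p for p \<le> 1. So Hardy norms of truncations never occur. The data f
  always belong to the full sequence, the estimates for finite sums allow an error e outside a
  finite set M, and e tends to 0 only when the sums over j and k are finite. The vertical lines run
  through half-integers since these stay at distance 1/2 from all poles of C and from the branch
  points, and since |sin(\<pi> z)| equals cosh(\<pi> Im z) there, so that dividing it out is
  harmless.\<close>

definition poisson :: "real \<Rightarrow> real \<Rightarrow> real" where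
  "poisson N u = N / (N\<^sup>2 + u\<^sup>2)"

lemma poisson_nonneg [simp]: "N \<ge> 0 \<Longrightarrow> poisson N u \<ge> 0"
  by (simp add: poisson_def)

lemma poisson_minus: "poisson N (- u) = poisson N u"
  by (simp add: poisson_def)

lemma poisson_le: "N > 0 \<Longrightarrow> poisson N u \<le> 1 / N"
proof -
  assume "N > 0"
  then have "poisson N u \<le> N / N\<^sup>2"
    unfolding poisson_def by (intro divide_left_mono) (auto intro!: add_pos_nonneg mult_pos_pos)
  then show ?thesis using \<open>N > 0\<close> by (simp add: power2_eq_square)
qed

lemma sum_int_le_of_sum_nat_le:
  fixes g :: "nat \<Rightarrow> real"
  assumes nonneg: "\<And>n. g n \<ge> 0" and le: "\<And>L. (\<Sum>n<L. g n) \<le> c" and "finite F"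
  shows "(\<Sum>j\<in>F. g (nat \<bar>j\<bar>)) \<le> 2 * c"
proof -
  define L where "L = Suc (Max (insert 0 ((\<lambda>j. nat \<bar>j\<bar>) ` F)))"
  have L: "nat \<bar>j\<bar> < L" if "j \<in> F" for j
    unfolding L_def less_Suc_eq_le using that \<open>finite F\<close> by (intro Max_ge) auto
  have "F \<subseteq> int ` {..<L} \<union> (\<lambda>n. - int n) ` {..<L}"
  proof
    fix j assume "j \<in> F"
    show "j \<in> int ` {..<L} \<union> (\<lambda>n. - int n) ` {..<L}"
    proof (cases "j \<ge> 0")
      case True
      then have "j = int (nat \<bar>j\<bar>)" by simp
      then show ?thesis using L[OF \<open>j \<in> F\<close>] by blast
    next
      case False
      then have "j = - int (nat \<bar>j\<bar>)" by simp
      then show ?thesis using L[OF \<open>j \<in> F\<close>] by blast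
    qed
  qed
  then have "(\<Sum>j\<in>F. g (nat \<bar>j\<bar>)) \<le> (\<Sum>j\<in>int ` {..<L} \<union> (\<lambda>n. - int n) ` {..<L}. g (nat \<bar>j\<bar>))"
    by (intro sum_mono2) (auto intro: nonneg)
  also have "\<dots> \<le> (\<Sum>j\<in>int ` {..<L}. g (nat \<bar>j\<bar>)) + (\<Sum>j\<in>(\<lambda>n. - int n) ` {..<L}. g (nat \<bar>j\<bar>))"
    by (subst sum.union_inter [symmetric]) (auto intro!: sum_nonneg nonneg simp: add_increasing2)
  also have "\<dots> = (\<Sum>n<L. g n) + (\<Sum>n<L. g n)"
    by (subst (1 2) sum.reindex) (auto simp: inj_on_def)
  finally show ?thesis using le[of L] by simp
qed

lemma sum_poisson_nat_le:
  assumes "N \<ge> 1"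
  shows "(\<Sum>n<L. poisson N (real n)) \<le> 4"
proof -
  \<comment> \<open>The subtracted term makes the induction close: its increment 4N/((N+L)(N+L+1))
    dominates the Poisson term because (N+L)^2 \<le> 2(N^2+L^2).\<close>
  have "(\<Sum>n<L. poisson N (real n)) \<le> 4 - 4 * N / (N + real L)"
  proof (induction L)
    case 0
    then show ?case using assms by simp
  next
    case (Suc L)
    have "poisson N (real L) \<le> 2 * N / (N + real L)\<^sup>2"
    proof -
      have "(N + real L)\<^sup>2 \<le> 2 * (N\<^sup>2 + (real L)\<^sup>2)"
        using sum_squares_bound[of N "real L"] by (simp add: power2_sum)
      moreover have "N\<^sup>2 + (real L)\<^sup>2 > 0" using assms by (simp add: add_pos_nonneg)
      ultimately show ?thesis using assms unfolding poisson_def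
        by (simp add: divide_simps add_nonneg_eq_0_iff)
    qed
    also have "\<dots> \<le> 4 * N / (N + real L) - 4 * N / (N + real L + 1)"
    proof -
      have eq: "4 * N / (N + real L) - 4 * N / (N + real L + 1) = 4 * N / ((N + real L) * (N + real L + 1))"
        using assms by (simp add: divide_simps add_nonneg_eq_0_iff) (simp add: algebra_simps)
      have "(N + real L) * (N + real L + 1) \<le> 2 * (N + real L)\<^sup>2"
      proof -
        have "(N + real L) * (N + real L + 1) \<le> (N + real L) * (2 * (N + real L))"
          using assms by (intro mult_left_mono) auto
        then show ?thesis by (simp add: power2_eq_square algebra_simps)
      qed
      moreover have "(N + real L) * (N + real L + 1) > 0" using assms by simp
      ultimately have "4 * N / (2 * (N + real L)\<^sup>2) \<le> 4 * N / ((N + real L) * (N + real L + 1))"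
        using assms by (intro divide_left_mono) auto
      then show ?thesis unfolding eq by simp
    qed
    finally show ?case using Suc by (simp add: algebra_simps)
  qed
  also have "\<dots> \<le> 4" using assms by simp
  finally show ?thesis .
qed

lemma sum_poisson_le:
  assumes "N \<ge> 1" "finite F"
  shows "(\<Sum>j\<in>F. poisson N (of_int (j - m))) \<le> 8"
proof -
  have "(\<Sum>j\<in>F. poisson N (of_int (j - m))) = (\<Sum>j\<in>(\<lambda>j. j - m) ` F. poisson N (of_int j))"
    by (subst sum.reindex) (auto simp: inj_on_def)
  also have "\<dots> = (\<Sum>j\<in>(\<lambda>j. j - m) ` F. poisson N (real (nat \<bar>j\<bar>)))"
    by (intro sum.cong) (auto simp: poisson_def)
  also have "\<dots> \<le> 2 * 4"
    using assms by (intro sum_int_le_of_sum_nat_le sum_poisson_nat_le) auto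
  finally show ?thesis by simp
qed

lemma sum_inverse_sqrt_le: "(\<Sum>n<L. (1 + real n) powr (-1/2)) \<le> 2 * sqrt (real L)"
proof (induction L)
  case (Suc L)
  have "(1 + real L) powr (-1/2) = 1 / sqrt (1 + real L)"
    by (simp add: powr_minus_divide powr_half_sqrt)
  also have "\<dots> \<le> 2 * sqrt (1 + real L) - 2 * sqrt (real L)"
  proof -
    define a b where "a = sqrt (1 + real L)" and "b = sqrt (real L)"
    have ab: "a > 0" "b \<ge> 0" "a\<^sup>2 = b\<^sup>2 + 1" by (auto simp: a_def b_def)
    have "0 \<le> (a - b)\<^sup>2" by simp
    then have "1 \<le> (2 * a - 2 * b) * a" using ab by (simp add: power2_diff) (simp add: power2_eq_square algebra_simps)
    then show ?thesis using ab unfolding a_def[symmetric] b_def[symmetric] by (simp add: divide_simps)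
  qed
  finally show ?case using Suc by (simp add: add.commute)
qed simp

text \<open>Since \<eta> \<le> 1/2, each term is at most R^(1/2-\<eta>) times the inverse square
  root, so the single exponent 1/2, whose sums telescope, serves all \<eta> at once.\<close>

lemma sum_truncated_powr_le:
  assumes "0 \<le> \<eta>" "\<eta> \<le> 1/2" "R \<ge> 0"
  shows "(\<Sum>n<L. if 1 + real n \<le> R then (1 + real n) powr (-\<eta>) else 0) \<le> 2 * R powr (1 - \<eta>)"
proof -
  let ?A = "{n\<in>{..<L}. 1 + real n \<le> R}"
  have sub: "?A \<subseteq> {..<nat \<lfloor>R\<rfloor>}" 
  proof
    fix n assume "n \<in> ?A"
    then have "real (Suc n) \<le> R" by simp
    then have "int (Suc n) \<le> \<lfloor>R\<rfloor>" by (simp add: le_floor_iff)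
    then show "n \<in> {..<nat \<lfloor>R\<rfloor>}" by simp
  qed
  have "(\<Sum>n<L. if 1 + real n \<le> R then (1 + real n) powr (-\<eta>) else 0) = (\<Sum>n\<in>?A. (1 + real n) powr (-\<eta>))"
    by (rule sum.inter_filter [symmetric]) simp
  also have "\<dots> \<le> (\<Sum>n\<in>?A. R powr (1/2 - \<eta>) * (1 + real n) powr (-1/2))"
  proof (rule sum_mono)
    fix n assume n: "n \<in> ?A"
    have "(1 + real n) powr (-\<eta>) = (1 + real n) powr (1/2 - \<eta>) * (1 + real n) powr (-1/2)"
      by (simp flip: powr_add)
    also have "\<dots> \<le> R powr (1/2 - \<eta>) * (1 + real n) powr (-1/2)"
      using n assms by (intro mult_right_mono powr_mono2) auto
    finally show "(1 + real n) powr (-\<eta>) \<le> R powr (1/2 - \<eta>) * (1 + real n) powr (-1/2)" .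
  qed
  also have "\<dots> \<le> R powr (1/2 - \<eta>) * (\<Sum>n<nat \<lfloor>R\<rfloor>. (1 + real n) powr (-1/2))"
    unfolding sum_distrib_left [symmetric] using sub by (intro mult_left_mono sum_mono2) auto
  also have "\<dots> \<le> R powr (1/2 - \<eta>) * (2 * sqrt (real (nat \<lfloor>R\<rfloor>)))"
    by (intro mult_left_mono sum_inverse_sqrt_le) auto
  also have "\<dots> \<le> R powr (1/2 - \<eta>) * (2 * sqrt R)"
    using assms by (intro mult_left_mono real_sqrt_le_mono) auto
  also have "\<dots> = 2 * R powr (1 - \<eta>)"
    using assms by (simp add: powr_half_sqrt [symmetric] flip: powr_add)
  finally show ?thesis .
qed

lemma sum_int_truncated_powr_le:
  assumes "0 \<le> \<eta>" "\<eta> \<le> 1/2" "R \<ge> 0" "finite F" "\<And>j. j \<in> F \<Longrightarrow> 1 + \<bar>of_int j\<bar> \<le> R"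
  shows "(\<Sum>j\<in>F. (1 + \<bar>real_of_int j\<bar>) powr (-\<eta>)) \<le> 4 * R powr (1 - \<eta>)"
proof -
  have "(\<Sum>j\<in>F. (1 + \<bar>real_of_int j\<bar>) powr (-\<eta>)) =
     (\<Sum>j\<in>F. if 1 + real (nat \<bar>j\<bar>) \<le> R then (1 + real (nat \<bar>j\<bar>)) powr (-\<eta>) else 0)"
    using assms(5) by (intro sum.cong) auto
  also have "\<dots> \<le> 2 * (2 * R powr (1 - \<eta>))"
    using assms sum_truncated_powr_le by (intro sum_int_le_of_sum_nat_le) auto
  finally show ?thesis by simp
qed

text \<open>The Poisson average at scale N around m sees the weight as if it were frozen at L = N +
  |m|. If 1 + |j| \<le> L/4, then N or |j - m| is at least L/4, so the kernel is at most 16/L, and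
  the weights sum to at most 4 L^(1-\<eta>). For all other j the weight itself is at most 2
  L^(-\<eta>), and the kernel has total mass at most 8.\<close>

lemma sum_poisson_weight_le:
  assumes "0 \<le> \<eta>" "\<eta> \<le> 1/2" "N \<ge> 1" "finite F"
  shows "(\<Sum>j\<in>F. poisson N (of_int (j - m)) * (1 + \<bar>real_of_int j\<bar>) powr (-\<eta>))
    \<le> 100 * (N + \<bar>of_int m\<bar>) powr (-\<eta>)"
proof -
  define L where "L = N + \<bar>real_of_int m\<bar>"
  have L: "L \<ge> 1" using assms by (simp add: L_def)
  define A where "A = {j\<in>F. 1 + \<bar>real_of_int j\<bar> \<le> L / 4}"
  define B where "B = {j\<in>F. \<not> 1 + \<bar>real_of_int j\<bar> \<le> L / 4}"
  let ?t = "\<lambda>j. poisson N (of_int (j - m)) * (1 + \<bar>real_of_int j\<bar>) powr (-\<eta>)"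
  have "(\<Sum>j\<in>F. ?t j) = (\<Sum>j\<in>A. ?t j) + (\<Sum>j\<in>B. ?t j)"
    using assms by (subst sum.union_disjoint [symmetric]) (auto simp: A_def B_def intro!: sum.cong)
  moreover have "(\<Sum>j\<in>A. ?t j) \<le> 64 * L powr (-\<eta>)"
  proof -
    have "(\<Sum>j\<in>A. ?t j) \<le> (\<Sum>j\<in>A. 16 / L * (1 + \<bar>real_of_int j\<bar>) powr (-\<eta>))"
    proof (intro sum_mono mult_right_mono)
      fix j assume "j \<in> A"
      then have j: "1 + \<bar>real_of_int j\<bar> \<le> L / 4" by (simp add: A_def)
      have "(L / 4)\<^sup>2 \<le> N\<^sup>2 + (of_int (j - m))\<^sup>2"
      proof (cases "\<bar>real_of_int m\<bar> \<le> N")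
        case True
        then have "L / 4 \<le> N" using assms by (simp add: L_def)
        then have "(L / 4)\<^sup>2 \<le> N\<^sup>2" using L by (intro power_mono) auto
        then show ?thesis by (simp add: add_increasing2)
      next
        case False
        have "\<bar>real_of_int m\<bar> \<le> \<bar>real_of_int j\<bar> + \<bar>real_of_int (j - m)\<bar>" by simp
        moreover have "(N + x) / 4 \<le> z" if "x \<le> y + z" "1 + y \<le> (N + x) / 4" "\<not> x \<le> N" for x y z :: real
          using that by simp
        ultimately have "L / 4 \<le> \<bar>real_of_int (j - m)\<bar>" using j False unfolding L_def by blast
        then have "(L / 4)\<^sup>2 \<le> \<bar>real_of_int (j - m)\<bar>\<^sup>2" using L by (intro power_mono) auto
        then show ?thesis by (simp add: add_increasing)
      qed
      then have "poisson N (of_int (j - m)) \<le> N / (L / 4)\<^sup>2"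
        unfolding poisson_def using L assms by (intro divide_left_mono) (auto intro!: mult_pos_pos add_pos_nonneg)
      also have "\<dots> \<le> L / (L / 4)\<^sup>2"
        using L by (intro divide_right_mono) (auto simp: L_def)
      also have "\<dots> = 16 / L" using L by (simp add: power2_eq_square)
      finally show "poisson N (of_int (j - m)) \<le> 16 / L" .
    qed auto
    also have "\<dots> = 16 / L * (\<Sum>j\<in>A. (1 + \<bar>real_of_int j\<bar>) powr (-\<eta>))"
      by (simp add: sum_distrib_left)
    also have "\<dots> \<le> 16 / L * (4 * L powr (1 - \<eta>))"
    proof (intro mult_left_mono sum_int_truncated_powr_le)
      fix j assume "j \<in> A" then show "1 + \<bar>real_of_int j\<bar> \<le> L" using L by (simp add: A_def)
    qed (use assms L in \<open>auto simp: A_def\<close>)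
    also have "L powr (1 - \<eta>) = L * L powr (-\<eta>)"
      using L powr_add[of L 1 "-\<eta>"] by simp
    also have "16 / L * (4 * (L * L powr (-\<eta>))) = 64 * L powr (-\<eta>)" using L by simp
    finally show ?thesis .
  qed
  moreover have "(\<Sum>j\<in>B. ?t j) \<le> 16 * L powr (-\<eta>)"
  proof -
    have "(\<Sum>j\<in>B. ?t j) \<le> (\<Sum>j\<in>B. poisson N (of_int (j - m)) * (2 * L powr (-\<eta>)))"
    proof (intro sum_mono mult_left_mono)
      fix j assume "j \<in> B"
      then have j: "1 + \<bar>real_of_int j\<bar> \<ge> L / 4" by (simp add: B_def)
      have "(1 + \<bar>real_of_int j\<bar>) powr (-\<eta>) \<le> (L / 4) powr (-\<eta>)"
        using j L assms by (intro powr_mono2') auto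
      also have "\<dots> = 4 powr \<eta> * L powr (-\<eta>)"
        using L by (simp add: powr_divide powr_minus field_simps)
      also have "\<dots> \<le> 4 powr (1/2) * L powr (-\<eta>)"
        using assms by (intro mult_right_mono powr_mono) auto
      also have "4 powr (1/2) = (2::real)" by (simp add: powr_half_sqrt)
      finally show "(1 + \<bar>real_of_int j\<bar>) powr (-\<eta>) \<le> 2 * L powr (-\<eta>)" .
    qed (use assms in auto)
    also have "\<dots> = 2 * L powr (-\<eta>) * (\<Sum>j\<in>B. poisson N (of_int (j - m)))"
      by (simp add: sum_distrib_left mult_ac)
    also have "\<dots> \<le> 2 * L powr (-\<eta>) * 8"
      using assms by (intro mult_left_mono sum_poisson_le) (auto simp: B_def)
    finally show ?thesis by simp
  qed
  ultimately have "(\<Sum>j\<in>F. ?t j) \<le> 80 * L powr (-\<eta>)" by simp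
  also have "\<dots> \<le> 100 * L powr (-\<eta>)" by (intro mult_right_mono) auto
  finally show ?thesis by (simp add: L_def)
qed

text \<open>Writing y = 2^l, the k-th term is at most 2^(-\<mu>|k-l|) with \<mu> = min a b, a
  geometric series in both directions. Rounding l to an integer costs the factor 2^\<mu>. The point
  is uniformity in both y and K.\<close>

lemma sum_min_powr_le:
  fixes a b :: real
  assumes "a > 0" "b > 0"
  obtains C where "C > 0"
    "\<And>y K. y > 0 \<Longrightarrow> (\<Sum>k<K. min ((2 ^ k / y) powr a) ((2 ^ k / y) powr (-b))) \<le> C"
proof -
  define \<mu> where "\<mu> = min a b"
  define x where "x = (2::real) powr (-\<mu>)"
  have \<mu>: "\<mu> > 0" using assms by (simp add: \<mu>_def)
  have x: "0 < x" "x < 1" using \<mu> by (simp_all add: x_def powr_less_one)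
  define C where "C = 2 powr \<mu> * (2 * (1 / (1 - x)))"
  have "(\<Sum>k<K. min ((2 ^ k / y) powr a) ((2 ^ k / y) powr (-b))) \<le> C" if y: "y > 0" for y :: real and K
  proof -
    define l where "l = log 2 y"
    define n where "n = \<lfloor>l\<rfloor>"
    have eq: "2 ^ k / y = 2 powr (real k - l)" for k
      using y by (simp add: l_def powr_diff powr_realpow)
    have "min ((2 ^ k / y) powr a) ((2 ^ k / y) powr (-b)) \<le> 2 powr \<mu> * x ^ nat \<bar>int k - n\<bar>" for k
    proof -
      have "min ((2 ^ k / y) powr a) ((2 ^ k / y) powr (-b)) \<le> 2 powr (- \<mu> * \<bar>real k - l\<bar>)"
      proof (cases "real k \<le> l")
        case True
        have "(real k - l) * a \<le> (real k - l) * \<mu>"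
          using True by (intro mult_left_mono_neg) (auto simp: \<mu>_def)
        then show ?thesis using True unfolding eq powr_powr by (intro min.coboundedI1) (simp add: algebra_simps)
      next
        case False
        have "(real k - l) * \<mu> \<le> (real k - l) * b"
          using False by (intro mult_left_mono) (auto simp: \<mu>_def)
        then show ?thesis using False unfolding eq powr_powr by (intro min.coboundedI2) (simp add: algebra_simps)
      qed
      also have "\<dots> \<le> 2 powr (\<mu> - \<mu> * real (nat \<bar>int k - n\<bar>))"
      proof (rule powr_mono)
        have "real_of_int n \<le> l" "l < real_of_int n + 1" by (auto simp: n_def)
        then have "\<bar>of_int (int k - n)\<bar> \<le> \<bar>real k - l\<bar> + 1" unfolding of_int_diff of_int_of_nat_eq by linarith
        then have "real (nat \<bar>int k - n\<bar>) - 1 \<le> \<bar>real k - l\<bar>" by simp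
        then have "\<mu> * (real (nat \<bar>int k - n\<bar>) - 1) \<le> \<mu> * \<bar>real k - l\<bar>" using \<mu> by (intro mult_left_mono) auto
        then show "- \<mu> * \<bar>real k - l\<bar> \<le> \<mu> - \<mu> * real (nat \<bar>int k - n\<bar>)" by (simp add: algebra_simps)
      qed simp
      also have "\<dots> = 2 powr \<mu> * 2 powr (- \<mu> * real (nat \<bar>int k - n\<bar>))"
        by (simp flip: powr_add)
      also have "2 powr (- \<mu> * real (nat \<bar>int k - n\<bar>)) = x ^ nat \<bar>int k - n\<bar>"
        using x by (simp add: x_def powr_powr flip: powr_realpow)
      finally show ?thesis .
    qed
    then have "(\<Sum>k<K. min ((2 ^ k / y) powr a) ((2 ^ k / y) powr (-b))) \<le> (\<Sum>k<K. 2 powr \<mu> * x ^ nat \<bar>int k - n\<bar>)"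
      by (intro sum_mono)
    also have "\<dots> = 2 powr \<mu> * (\<Sum>j\<in>(\<lambda>k. int k - n) ` {..<K}. x ^ nat \<bar>j\<bar>)"
      by (subst sum.reindex) (auto simp: inj_on_def sum_distrib_left)
    also have "(\<Sum>j\<in>(\<lambda>k. int k - n) ` {..<K}. x ^ nat \<bar>j\<bar>) \<le> 2 * (1 / (1 - x))"
    proof (rule sum_int_le_of_sum_nat_le)
      show "(\<Sum>n<L. x ^ n) \<le> 1 / (1 - x)" for L
        using x by (simp add: sum_gp_strict divide_right_mono)
    qed (use x in auto)
    finally show ?thesis by (simp add: C_def)
  qed
  moreover have "C > 0" using x by (simp add: C_def)
  ultimately show ?thesis using that by blast
qed

section \<open>Square estimates for discrete Poisson sums\<close>

definition poisson_sum :: "(int \<Rightarrow> real) \<Rightarrow> int set \<Rightarrow> real \<Rightarrow> int \<Rightarrow> real" where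
  "poisson_sum f M N j = (\<Sum>m\<in>M. f m * poisson N (of_int (j - m)))"

lemma poisson_sum_nonneg: "(\<And>m. f m \<ge> 0) \<Longrightarrow> N \<ge> 0 \<Longrightarrow> poisson_sum f M N j \<ge> 0"
  unfolding poisson_sum_def by (intro sum_nonneg) auto

text \<open>Cauchy-Schwarz, with the kernel split evenly and the weight (1+|m|)^(\<eta>/2) played
  against its inverse. The kernel being even, the second factor is an instance of
  \<open>sum_poisson_weight_le\<close> with j as centre.\<close>

lemma poisson_sum_power2_le_weighted:
  assumes "N \<ge> 1" "finite M" "0 \<le> \<eta>" "\<eta> \<le> 1/2"
  shows "(poisson_sum f M N j)\<^sup>2 \<le> 100 * (N + \<bar>of_int j\<bar>) powr (-\<eta>) *
    (\<Sum>m\<in>M. (f m)\<^sup>2 * (1 + \<bar>of_int m\<bar>) powr \<eta> * poisson N (of_int (j - m)))"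
proof -
  define w where "w = (\<lambda>m. (1 + \<bar>real_of_int m\<bar>) powr (\<eta>/2))"
  have w: "w m > 0" for m by (simp add: w_def add_pos_nonneg)
  have w2: "(w m)\<^sup>2 = (1 + \<bar>real_of_int m\<bar>) powr \<eta>" for m
    by (simp add: w_def power2_eq_square flip: powr_add)
  define P where "P = (\<lambda>m. poisson N (of_int (j - m)))"
  have P: "P m \<ge> 0" for m using assms by (simp add: P_def)
  have "(poisson_sum f M N j)\<^sup>2 = (\<Sum>m\<in>M. (f m * w m * sqrt (P m)) * (sqrt (P m) / w m))\<^sup>2"
  proof -
    have "f m * w m * sqrt (P m) * (sqrt (P m) / w m) = f m * P m" for m
      using w[of m] P[of m] by simp
    then show ?thesis by (simp add: poisson_sum_def P_def)
  qed
  also have "\<dots> \<le> (\<Sum>m\<in>M. (f m * w m * sqrt (P m))\<^sup>2) * (\<Sum>m\<in>M. (sqrt (P m) / w m)\<^sup>2)"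
    by (rule Cauchy_Schwarz_ineq_sum)
  also have "(\<Sum>m\<in>M. (f m * w m * sqrt (P m))\<^sup>2) = (\<Sum>m\<in>M. (f m)\<^sup>2 * (1 + \<bar>of_int m\<bar>) powr \<eta> * poisson N (of_int (j - m)))"
    using P w2 by (simp add: power_mult_distrib P_def)
  also have "(\<Sum>m\<in>M. (sqrt (P m) / w m)\<^sup>2) = (\<Sum>m\<in>M. poisson N (of_int (m - j)) * (1 + \<bar>real_of_int m\<bar>) powr (-\<eta>))"
  proof (rule sum.cong)
    fix m assume "m \<in> M"
    have "P m = poisson N (of_int (m - j))" by (simp add: P_def poisson_def power2_commute)
    then show "(sqrt (P m) / w m)\<^sup>2 = poisson N (of_int (m - j)) * (1 + \<bar>real_of_int m\<bar>) powr (-\<eta>)"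
      using P[of m] w2[of m] by (simp add: power_divide powr_minus_divide)
  qed simp
  also have "(\<Sum>m\<in>M. (f m)\<^sup>2 * (1 + \<bar>of_int m\<bar>) powr \<eta> * poisson N (of_int (j - m))) * \<dots>
      \<le> (\<Sum>m\<in>M. (f m)\<^sup>2 * (1 + \<bar>of_int m\<bar>) powr \<eta> * poisson N (of_int (j - m))) * (100 * (N + \<bar>of_int j\<bar>) powr (-\<eta>))"
    using assms by (intro mult_left_mono sum_poisson_weight_le sum_nonneg) auto
  finally show ?thesis by (simp add: mult_ac)
qed

text \<open>The case \<eta> = 0 combined with the height 1/N of the kernel. This pointwise bound
  supplies the factor N^(-\<gamma>) in the Hedberg step.\<close>

lemma poisson_sum_power2_le:
  assumes "N \<ge> 1" "finite M"
  shows "(poisson_sum f M N j)\<^sup>2 \<le> 100 * (\<Sum>m\<in>M. (f m)\<^sup>2) / N"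
proof -
  have "(poisson_sum f M N j)\<^sup>2 \<le> 100 * (N + \<bar>of_int j\<bar>) powr (-0) *
    (\<Sum>m\<in>M. (f m)\<^sup>2 * (1 + \<bar>of_int m\<bar>) powr 0 * poisson N (of_int (j - m)))"
    by (rule poisson_sum_power2_le_weighted) (use assms in auto)
  also have "\<dots> \<le> 100 * (\<Sum>m\<in>M. (f m)\<^sup>2 * (1 / N))"
  proof -
    have "(\<Sum>m\<in>M. (f m)\<^sup>2 * (1 + \<bar>real_of_int m\<bar>) powr 0 * poisson N (of_int (j - m))) \<le> (\<Sum>m\<in>M. (f m)\<^sup>2 * (1 / N))"
    proof (intro sum_mono mult_mono)
      show "(f m)\<^sup>2 * (1 + \<bar>real_of_int m\<bar>) powr 0 \<le> (f m)\<^sup>2" for m by (simp add: powr_zero_eq_one)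
    qed (use assms poisson_le in auto)
    moreover have "(N + \<bar>real_of_int j\<bar>) powr (-0) = 1" using assms by simp
    ultimately show ?thesis by simp
  qed
  finally show ?thesis by (simp add: sum_distrib_right sum_divide_distrib sum_distrib_left)
qed

lemma sum_swap3:
  fixes g :: "'a \<Rightarrow> 'b \<Rightarrow> 'c \<Rightarrow> 'd :: comm_monoid_add"
  shows "(\<Sum>j\<in>J. \<Sum>k\<in>K. \<Sum>m\<in>M. g j k m) = (\<Sum>m\<in>M. \<Sum>k\<in>K. \<Sum>j\<in>J. g j k m)"
proof -
  have "(\<Sum>j\<in>J. \<Sum>k\<in>K. \<Sum>m\<in>M. g j k m) = (\<Sum>k\<in>K. \<Sum>j\<in>J. \<Sum>m\<in>M. g j k m)"
    by (rule sum.swap)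
  also have "\<dots> = (\<Sum>k\<in>K. \<Sum>m\<in>M. \<Sum>j\<in>J. g j k m)"
    by (intro sum.cong sum.swap) auto
  also have "\<dots> = (\<Sum>m\<in>M. \<Sum>k\<in>K. \<Sum>j\<in>J. g j k m)"
    by (rule sum.swap)
  finally show ?thesis .
qed

text \<open>The weight \<open>(1 + |m|) powr (1/4)\<close> of the Schur test is needed: without it the sum over \<open>j\<close> of a single
  Poisson kernel diverges logarithmically.\<close>

lemma sum_poisson_sum_power2_le:
  assumes "0 < \<epsilon>" "\<epsilon> \<le> 1/4"
  obtains C where "C > 0"
    "\<And>f M J K. finite M \<Longrightarrow> finite J \<Longrightarrow>
      (\<Sum>j\<in>J. \<Sum>k<K. (poisson_sum f M (2 ^ k) j)\<^sup>2 * (2 ^ k / (1 + \<bar>of_int j\<bar>)) powr \<epsilon>) \<le> C * (\<Sum>m\<in>M. (f m)\<^sup>2)"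
proof -
  obtain C0 where C0: "C0 > 0"
    "\<And>y K. y > 0 \<Longrightarrow> (\<Sum>k<K. min ((2 ^ k / y) powr \<epsilon>) ((2 ^ k / y) powr (-(1/4)))) \<le> C0"
    by (rule sum_min_powr_le[of \<epsilon> "1/4"]) (use assms in auto)
  have "(\<Sum>j\<in>J. \<Sum>k<K. (poisson_sum f M (2 ^ k) j)\<^sup>2 * (2 ^ k / (1 + \<bar>of_int j\<bar>)) powr \<epsilon>) \<le> 10000 * C0 * (\<Sum>m\<in>M. (f m)\<^sup>2)"
    if fin: "finite M" "finite J" for f :: "int \<Rightarrow> real" and M J K
  proof -
    define u where "u = (\<lambda>j::int. 1 + \<bar>real_of_int j\<bar>)"
    have u: "u j \<ge> 1" for j by (simp add: u_def)
    have "(\<Sum>j\<in>J. \<Sum>k<K. (poisson_sum f M (2 ^ k) j)\<^sup>2 * (2 ^ k / u j) powr \<epsilon>) \<le>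
        (\<Sum>j\<in>J. \<Sum>k<K. \<Sum>m\<in>M. 100 * (f m)\<^sup>2 * (u m powr (1/4) * (2 ^ k) powr \<epsilon> * (poisson (2 ^ k) (of_int (j - m)) * u j powr (- (1/4 + \<epsilon>)))))"
    proof (intro sum_mono)
      fix j k
      have "(poisson_sum f M (2 ^ k) j)\<^sup>2 \<le> 100 * (2 ^ k + \<bar>of_int j\<bar>) powr (-(1/4)) *
        (\<Sum>m\<in>M. (f m)\<^sup>2 * (1 + \<bar>of_int m\<bar>) powr (1/4) * poisson (2 ^ k) (of_int (j - m)))"
        by (rule poisson_sum_power2_le_weighted) (use fin in auto)
      also have "\<dots> \<le> 100 * u j powr (-(1/4)) * (\<Sum>m\<in>M. (f m)\<^sup>2 * (1 + \<bar>of_int m\<bar>) powr (1/4) * poisson (2 ^ k) (of_int (j - m)))"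
        by (intro mult_right_mono mult_left_mono powr_mono2' sum_nonneg) (auto simp: u_def)
      finally have "(poisson_sum f M (2 ^ k) j)\<^sup>2 * (2 ^ k / u j) powr \<epsilon> \<le>
        (100 * u j powr (-(1/4)) * (\<Sum>m\<in>M. (f m)\<^sup>2 * (1 + \<bar>of_int m\<bar>) powr (1/4) * poisson (2 ^ k) (of_int (j - m)))) * (2 ^ k / u j) powr \<epsilon>"
        by (intro mult_right_mono) auto
      also have "\<dots> = (\<Sum>m\<in>M. 100 * (f m)\<^sup>2 * (u m powr (1/4) * (2 ^ k) powr \<epsilon> * (poisson (2 ^ k) (of_int (j - m)) * (u j powr (-(1/4)) * u j powr (-\<epsilon>)))))"
      proof -
        have "(2 ^ k / u j) powr \<epsilon> = (2 ^ k) powr \<epsilon> * u j powr (-\<epsilon>)"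
          using u[of j] by (simp add: powr_divide powr_minus_divide)
        then show ?thesis
          unfolding sum_distrib_left sum_distrib_right by (intro sum.cong) (simp_all add: u_def)
      qed
      also have "u j powr (-(1/4)) * u j powr (-\<epsilon>) = u j powr (- (1/4 + \<epsilon>))"
        by (simp flip: powr_add)
      finally show "(poisson_sum f M (2 ^ k) j)\<^sup>2 * (2 ^ k / u j) powr \<epsilon> \<le>
        (\<Sum>m\<in>M. 100 * (f m)\<^sup>2 * (u m powr (1/4) * (2 ^ k) powr \<epsilon> * (poisson (2 ^ k) (of_int (j - m)) * u j powr (- (1/4 + \<epsilon>)))))" .
    qed
    also have "\<dots> = (\<Sum>m\<in>M. 100 * (f m)\<^sup>2 * (\<Sum>k<K. u m powr (1/4) * (2 ^ k) powr \<epsilon> * (\<Sum>j\<in>J. poisson (2 ^ k) (of_int (j - m)) * u j powr (- (1/4 + \<epsilon>)))))"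
      by (subst sum_swap3) (simp add: sum_distrib_left)
    also have "\<dots> \<le> (\<Sum>m\<in>M. 100 * (f m)\<^sup>2 * (100 * C0))"
    proof (intro sum_mono mult_left_mono)
      fix m
      have "(\<Sum>k<K. u m powr (1/4) * (2 ^ k) powr \<epsilon> * (\<Sum>j\<in>J. poisson (2 ^ k) (of_int (j - m)) * u j powr (- (1/4 + \<epsilon>))))
        \<le> (\<Sum>k<K. 100 * min ((2 ^ k / u m) powr \<epsilon>) ((2 ^ k / u m) powr (-(1/4))))"
      proof (rule sum_mono)
        fix k :: nat
        define N where "N = (2::real) ^ k"
        have N: "N \<ge> 1" by (simp add: N_def)
        \<comment> \<open>The weight in j joins the Schur weight to the decay contributed by (2^k /
          u j)^\<epsilon>. Its exponent 1/4 + \<epsilon> must not exceed 1/2, which is where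
          \<epsilon> \<le> 1/4 enters.\<close>
        have "(\<Sum>j\<in>J. poisson N (of_int (j - m)) * u j powr (- (1/4 + \<epsilon>))) \<le> 100 * (N + \<bar>of_int m\<bar>) powr (- (1/4 + \<epsilon>))"
          unfolding u_def by (rule sum_poisson_weight_le) (use N assms fin in auto)
        then have "u m powr (1/4) * N powr \<epsilon> * (\<Sum>j\<in>J. poisson N (of_int (j - m)) * u j powr (- (1/4 + \<epsilon>)))
          \<le> u m powr (1/4) * N powr \<epsilon> * (100 * (N + \<bar>of_int m\<bar>) powr (- (1/4 + \<epsilon>)))"
          by (intro mult_left_mono) auto
        \<comment> \<open>Bounding N + |m| below by u m, and then by N, yields the two arguments of
          the minimum. The first is small for 2^k below u m, the second above it, so the sum over k
          converges at both ends.\<close>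
        moreover have "u m powr (1/4) * N powr \<epsilon> * (N + \<bar>of_int m\<bar>) powr (- (1/4 + \<epsilon>)) \<le> (N / u m) powr \<epsilon>"
        proof -
          have "u m powr (1/4) * N powr \<epsilon> * (N + \<bar>of_int m\<bar>) powr (- (1/4 + \<epsilon>)) \<le> u m powr (1/4) * N powr \<epsilon> * u m powr (- (1/4 + \<epsilon>))"
            using N assms by (intro mult_left_mono powr_mono2') (auto simp: u_def)
          also have "\<dots> = N powr \<epsilon> * (u m powr (1/4) * u m powr (- (1/4 + \<epsilon>)))" by simp
          also have "u m powr (1/4) * u m powr (- (1/4 + \<epsilon>)) = u m powr (-\<epsilon>)"
            unfolding powr_add [symmetric] by simp
          finally show ?thesis using N u[of m] by (simp add: powr_divide powr_minus_divide)
        qed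
        moreover have "u m powr (1/4) * N powr \<epsilon> * (N + \<bar>of_int m\<bar>) powr (- (1/4 + \<epsilon>)) \<le> (N / u m) powr (-(1/4))"
        proof -
          have "u m powr (1/4) * N powr \<epsilon> * (N + \<bar>of_int m\<bar>) powr (- (1/4 + \<epsilon>)) \<le> u m powr (1/4) * N powr \<epsilon> * N powr (- (1/4 + \<epsilon>))"
          proof (rule mult_left_mono)
            show "(N + \<bar>of_int m\<bar>) powr (- (1/4 + \<epsilon>)) \<le> N powr (- (1/4 + \<epsilon>))"
              using N assms by (intro powr_mono2') simp_all
          qed simp
          also have "\<dots> = u m powr (1/4) * (N powr \<epsilon> * N powr (- (1/4 + \<epsilon>)))" by simp
          also have "N powr \<epsilon> * N powr (- (1/4 + \<epsilon>)) = N powr (-(1/4))"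
            unfolding powr_add [symmetric] by simp
          finally show ?thesis using N u[of m] by (simp add: powr_divide powr_minus_divide)
        qed
        ultimately show "u m powr (1/4) * (2 ^ k) powr \<epsilon> * (\<Sum>j\<in>J. poisson (2 ^ k) (of_int (j - m)) * u j powr (- (1/4 + \<epsilon>)))
           \<le> 100 * min ((2 ^ k / u m) powr \<epsilon>) ((2 ^ k / u m) powr (-(1/4)))"
          unfolding N_def by (simp add: min_def)
      qed
      also have "\<dots> \<le> 100 * C0"
        unfolding sum_distrib_left [symmetric] using u[of m] C0(2)[of "u m" K] by simp
      finally show "(\<Sum>k<K. u m powr (1/4) * (2 ^ k) powr \<epsilon> * (\<Sum>j\<in>J. poisson (2 ^ k) (of_int (j - m)) * u j powr (- (1/4 + \<epsilon>)))) \<le> 100 * C0" .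
    qed auto
    finally show ?thesis by (simp add: u_def sum_distrib_left sum_distrib_right mult_ac)
  qed
  then show ?thesis using C0(1) by (intro that[of "10000 * C0"]) auto
qed

text \<open>Each z k is at most the l^q norm of z. Unlike Hoelder's inequality this crude bound is
  also valid for q < 1, which occurs, for instance when \<gamma> = 0 and p < 1.\<close>

lemma powr_sum_le_of_factor:
  fixes l z :: "nat \<Rightarrow> real"
  assumes "\<And>k. l k \<ge> 0" "\<And>k. z k \<ge> 0" "q > 0" "(\<Sum>k<K. l k) \<le> C"
  shows "(\<Sum>k<K. l k * z k) powr q \<le> C powr q * (\<Sum>k<K. z k powr q)"
proof -
  define S where "S = (\<Sum>k<K. z k powr q)"
  have S: "S \<ge> 0" unfolding S_def by (intro sum_nonneg) auto
  have "z k \<le> S powr (1 / q)" if "k < K" for k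
  proof -
    have "z k powr q \<le> S" unfolding S_def using that by (intro member_le_sum) auto
    then have "(z k powr q) powr (1 / q) \<le> S powr (1 / q)" using assms by (intro powr_mono2) auto
    then show ?thesis using assms(2)[of k] assms(3) by (simp add: powr_powr)
  qed
  then have "(\<Sum>k<K. l k * z k) \<le> (\<Sum>k<K. l k * S powr (1 / q))"
    using assms by (intro sum_mono mult_left_mono) auto
  also have "\<dots> \<le> C * S powr (1 / q)"
    unfolding sum_distrib_right [symmetric] using assms by (intro mult_right_mono) auto
  finally have "(\<Sum>k<K. l k * z k) powr q \<le> (C * S powr (1 / q)) powr q"
    using assms by (intro powr_mono2 sum_nonneg) auto
  also have "0 \<le> (\<Sum>k<K. l k)" using assms by (intro sum_nonneg) auto
  then have "(C * S powr (1 / q)) powr q = C powr q * S"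
    using assms S by (simp add: powr_mult powr_powr)
  finally show ?thesis by (simp add: S_def)
qed

text \<open>With y = 2^k/(1+|j|) the weight is at most min(y^(\<beta>-\<delta>), y^(-\<delta>))
  y^\<delta>. The minimum is summable over k and pays for moving the q-th power inside the sum; the
  remaining y^\<delta> becomes the factor y^(\<delta> q) that the square estimate
  \<open>sum_poisson_sum_power2_le\<close> admits.\<close>

lemma sum_powr_dyadic_poisson_le:
  assumes "0 < \<beta>" "0 < q"
  obtains C where "C > 0"
    "\<And>f M J K. (\<And>m. f m \<ge> 0) \<Longrightarrow> finite M \<Longrightarrow> finite J \<Longrightarrow>
      (\<Sum>j\<in>J. (\<Sum>k<K. poisson_sum f M (2 ^ k) j powr (2 / q) * (2 ^ k / (\<bar>of_int j\<bar> + 2 ^ k)) powr \<beta>) powr q)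
      \<le> C * (\<Sum>m\<in>M. (f m)\<^sup>2)"
proof -
  \<comment> \<open>The bound \<beta>/2 keeps both exponents \<beta> - \<delta> and \<delta>
    positive; the bound 1/(4q) makes \<delta> q at most 1/4.\<close>
  define \<delta> where "\<delta> = min (\<beta> / 2) (1 / (4 * q))"
  have \<delta>: "0 < \<delta>" "\<delta> < \<beta>" using assms by (auto simp: \<delta>_def min_def)
  have "\<delta> * q \<le> 1 / (4 * q) * q" using assms by (intro mult_right_mono) (auto simp: \<delta>_def)
  then have \<delta>q: "0 < \<delta> * q" "\<delta> * q \<le> 1/4" using \<delta> assms by auto
  obtain C1 where C1: "C1 > 0" "\<And>f M J K. finite M \<Longrightarrow> finite J \<Longrightarrow>
      (\<Sum>j\<in>J. \<Sum>k<K. (poisson_sum f M (2 ^ k) j)\<^sup>2 * (2 ^ k / (1 + \<bar>of_int j\<bar>)) powr (\<delta> * q)) \<le> C1 * (\<Sum>m\<in>M. (f m)\<^sup>2)"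
    by (rule sum_poisson_sum_power2_le[OF \<delta>q]) blast
  obtain C2 where C2: "C2 > 0"
    "\<And>y K. y > 0 \<Longrightarrow> (\<Sum>k<K. min ((2 ^ k / y) powr (\<beta> - \<delta>)) ((2 ^ k / y) powr (-\<delta>))) \<le> C2"
    by (rule sum_min_powr_le[of "\<beta> - \<delta>" \<delta>]) (use \<delta> in auto)
  have "(\<Sum>j\<in>J. (\<Sum>k<K. poisson_sum f M (2 ^ k) j powr (2 / q) * (2 ^ k / (\<bar>of_int j\<bar> + 2 ^ k)) powr \<beta>) powr q)
      \<le> C2 powr q * C1 * (\<Sum>m\<in>M. (f m)\<^sup>2)"
    if f: "\<And>m. f m \<ge> 0" and fin: "finite M" "finite J" for f :: "int \<Rightarrow> real" and M J K
  proof -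
    have "(\<Sum>k<K. poisson_sum f M (2 ^ k) j powr (2 / q) * (2 ^ k / (\<bar>of_int j\<bar> + 2 ^ k)) powr \<beta>) powr q
      \<le> C2 powr q * (\<Sum>k<K. (poisson_sum f M (2 ^ k) j)\<^sup>2 * (2 ^ k / (1 + \<bar>of_int j\<bar>)) powr (\<delta> * q))" for j
    proof -
      define y where "y = (\<lambda>k::nat. 2 ^ k / (1 + \<bar>real_of_int j\<bar>))"
      have y: "y k > 0" for k by (simp add: y_def add_pos_nonneg)
      define U where "U = (\<lambda>k::nat. poisson_sum f M (2 ^ k) j)"
      have U: "U k \<ge> 0" for k unfolding U_def using f by (intro poisson_sum_nonneg) auto
      define l where "l = (\<lambda>k. min (y k powr (\<beta> - \<delta>)) (y k powr (-\<delta>)))"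
      define z where "z = (\<lambda>k. U k powr (2 / q) * y k powr \<delta>)"
      have "(2 ^ k / (\<bar>of_int j\<bar> + 2 ^ k)) powr \<beta> \<le> l k * y k powr \<delta>" for k
      proof -
        have "(2 ^ k / (\<bar>of_int j\<bar> + 2 ^ k)) powr \<beta> \<le> y k powr \<beta>"
          unfolding y_def using assms by (intro powr_mono2 frac_le) (auto simp: add_pos_nonneg)
        moreover have "(2 ^ k / (\<bar>of_int j\<bar> + 2 ^ k)) powr \<beta> \<le> 1"
          using assms by (intro powr_le1) (auto simp: divide_simps add_nonneg_pos)
        moreover have "y k powr \<beta> = y k powr (\<beta> - \<delta>) * y k powr \<delta>" "1 = y k powr (-\<delta>) * y k powr \<delta>"
          using y[of k] by (auto simp flip: powr_add)
        ultimately show ?thesis by (auto simp: l_def min_def)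
      qed
      then have "U k powr (2 / q) * (2 ^ k / (\<bar>of_int j\<bar> + 2 ^ k)) powr \<beta> \<le> l k * z k" for k
        using mult_left_mono[of "(2 ^ k / (\<bar>of_int j\<bar> + 2 ^ k)) powr \<beta>" "l k * y k powr \<delta>" "U k powr (2 / q)"]
        by (simp add: z_def mult_ac)
      then have "(\<Sum>k<K. U k powr (2 / q) * (2 ^ k / (\<bar>of_int j\<bar> + 2 ^ k)) powr \<beta>) powr q \<le> (\<Sum>k<K. l k * z k) powr q"
        using assms by (intro powr_mono2 sum_mono sum_nonneg) auto
      also have "\<dots> \<le> C2 powr q * (\<Sum>k<K. z k powr q)"
      proof (rule powr_sum_le_of_factor)
        have "0 < 1 + \<bar>real_of_int j\<bar>" by (simp add: add_pos_nonneg)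
        from C2(2)[OF this, of K] show "(\<Sum>k<K. l k) \<le> C2" unfolding l_def y_def .
      qed (use y assms in \<open>auto simp: l_def z_def\<close>)
      also have "(\<Sum>k<K. z k powr q) = (\<Sum>k<K. (U k)\<^sup>2 * y k powr (\<delta> * q))"
        using U assms by (intro sum.cong) (auto simp: z_def powr_mult powr_powr)
      finally show ?thesis by (simp add: U_def y_def)
    qed
    then have "(\<Sum>j\<in>J. (\<Sum>k<K. poisson_sum f M (2 ^ k) j powr (2 / q) * (2 ^ k / (\<bar>of_int j\<bar> + 2 ^ k)) powr \<beta>) powr q)
      \<le> (\<Sum>j\<in>J. C2 powr q * (\<Sum>k<K. (poisson_sum f M (2 ^ k) j)\<^sup>2 * (2 ^ k / (1 + \<bar>of_int j\<bar>)) powr (\<delta> * q)))"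
      by (intro sum_mono)
    also have "\<dots> \<le> C2 powr q * (C1 * (\<Sum>m\<in>M. (f m)\<^sup>2))"
      unfolding sum_distrib_left [symmetric] using C1(2)[OF fin] by (intro mult_left_mono) auto
    finally show ?thesis by simp
  qed
  then show ?thesis using C1(1) C2(1) by (intro that[of "C2 powr q * C1"]) auto
qed

text \<open>Hedberg's device: U^(2/p) = U^(2/q) U^(2\<gamma>), where only the second factor is
  replaced by its pointwise bound (100 X/N)^\<gamma>. The gained N^(-\<gamma>) turns N^(1-\<alpha>)
  into N^\<beta>, which leaves the scale invariant weight of
  \<open>sum_powr_dyadic_poisson_le\<close>.\<close>

lemma sum_powr_dyadic_poisson_fractional_le:
  fixes \<alpha> \<beta> \<gamma> p q :: real
  assumes "0 \<le> \<gamma>" "0 < \<beta>" "\<alpha> + \<beta> = 1 - \<gamma>" "0 < p" "0 < q" "1 / q = 1 / p - \<gamma>"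
  obtains C where "C > 0"
    "\<And>f M J K. (\<And>m. f m \<ge> 0) \<Longrightarrow> finite M \<Longrightarrow> finite J \<Longrightarrow>
      (\<Sum>j\<in>J. (\<Sum>k<K. (2 ^ k) powr (1 - \<alpha>) * (\<bar>of_int j\<bar> + 2 ^ k) powr (-\<beta>) * poisson_sum f M (2 ^ k) j powr (2 / p)) powr q)
      \<le> C * (\<Sum>m\<in>M. (f m)\<^sup>2) powr (q / p)"
proof -
  obtain C1 where C1: "C1 > 0" "\<And>f M J K. (\<And>m. f m \<ge> 0) \<Longrightarrow> finite M \<Longrightarrow> finite J \<Longrightarrow>
      (\<Sum>j\<in>J. (\<Sum>k<K. poisson_sum f M (2 ^ k) j powr (2 / q) * (2 ^ k / (\<bar>of_int j\<bar> + 2 ^ k)) powr \<beta>) powr q)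
      \<le> C1 * (\<Sum>m\<in>M. (f m)\<^sup>2)"
    by (rule sum_powr_dyadic_poisson_le[OF assms(2,5)]) blast
  have "(\<Sum>j\<in>J. (\<Sum>k<K. (2 ^ k) powr (1 - \<alpha>) * (\<bar>of_int j\<bar> + 2 ^ k) powr (-\<beta>) * poisson_sum f M (2 ^ k) j powr (2 / p)) powr q)
      \<le> 100 powr (\<gamma> * q) * C1 * (\<Sum>m\<in>M. (f m)\<^sup>2) powr (q / p)"
    if f: "\<And>m. f m \<ge> 0" and fin: "finite M" "finite J" for f :: "int \<Rightarrow> real" and M J K
  proof -
    define X where "X = (\<Sum>m\<in>M. (f m)\<^sup>2)"
    have X: "X \<ge> 0" by (simp add: X_def sum_nonneg)
    have "(2 ^ k) powr (1 - \<alpha>) * (\<bar>of_int j\<bar> + 2 ^ k) powr (-\<beta>) * poisson_sum f M (2 ^ k) j powr (2 / p) \<le>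
       (100 * X) powr \<gamma> * (poisson_sum f M (2 ^ k) j powr (2 / q) * (2 ^ k / (\<bar>of_int j\<bar> + 2 ^ k)) powr \<beta>)" for j k
    proof -
      define N where "N = (2::real) ^ k"
      have N: "N \<ge> 1" by (simp add: N_def)
      define U where "U = poisson_sum f M N j"
      have U: "U \<ge> 0" unfolding U_def using f N by (intro poisson_sum_nonneg) auto
      have "2 / p = 2 * (1 / p)" "2 / q = 2 * (1 / q)" by simp_all
      then have "2 / p = 2 / q + 2 * \<gamma>" using assms(6) by argo
      then have "U powr (2 / p) = U powr (2 / q + 2 * \<gamma>)" by simp
      also have "\<dots> = U powr (2 / q) * U powr (2 * \<gamma>)" by (rule powr_add)
      also have "U powr (2 * \<gamma>) = (U\<^sup>2) powr \<gamma>" using U by (simp flip: powr_powr)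
      also have "U powr (2 / q) * (U\<^sup>2) powr \<gamma> \<le> U powr (2 / q) * (100 * X / N) powr \<gamma>"
        using poisson_sum_power2_le[OF N fin(1), of f j] assms
        by (intro mult_left_mono powr_mono2) (auto simp: U_def X_def)
      also have "(100 * X / N) powr \<gamma> = (100 * X) powr \<gamma> * N powr (-\<gamma>)"
        using X N by (simp add: powr_divide powr_minus_divide)
      finally have "N powr (1 - \<alpha>) * (\<bar>of_int j\<bar> + N) powr (-\<beta>) * U powr (2 / p) \<le>
         N powr (1 - \<alpha>) * (\<bar>of_int j\<bar> + N) powr (-\<beta>) * (U powr (2 / q) * ((100 * X) powr \<gamma> * N powr (-\<gamma>)))"
        by (intro mult_left_mono) auto
      also have "\<dots> = (100 * X) powr \<gamma> * (U powr (2 / q) * ((N powr (1 - \<alpha>) * N powr (-\<gamma>)) * (\<bar>of_int j\<bar> + N) powr (-\<beta>)))"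
        by (simp add: mult_ac)
      also have "N powr (1 - \<alpha>) * N powr (-\<gamma>) = N powr \<beta>"
        using assms(3) unfolding powr_add [symmetric] by (intro arg_cong2[where f = "(powr)"]) auto
      also have "N powr \<beta> * (\<bar>of_int j\<bar> + N) powr (-\<beta>) = (N / (\<bar>of_int j\<bar> + N)) powr \<beta>"
        using N by (simp add: powr_divide powr_minus_divide)
      finally show ?thesis by (simp add: N_def U_def)
    qed
    then have "(\<Sum>j\<in>J. (\<Sum>k<K. (2 ^ k) powr (1 - \<alpha>) * (\<bar>of_int j\<bar> + 2 ^ k) powr (-\<beta>) * poisson_sum f M (2 ^ k) j powr (2 / p)) powr q)
      \<le> (\<Sum>j\<in>J. (\<Sum>k<K. (100 * X) powr \<gamma> * (poisson_sum f M (2 ^ k) j powr (2 / q) * (2 ^ k / (\<bar>of_int j\<bar> + 2 ^ k)) powr \<beta>)) powr q)"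
      using assms by (intro sum_mono powr_mono2 sum_nonneg) auto
    also have "\<dots> = (100 * X) powr (\<gamma> * q) * (\<Sum>j\<in>J. (\<Sum>k<K. poisson_sum f M (2 ^ k) j powr (2 / q) * (2 ^ k / (\<bar>of_int j\<bar> + 2 ^ k)) powr \<beta>) powr q)"
      unfolding sum_distrib_left [symmetric]
      by (simp add: powr_mult powr_powr sum_nonneg X sum_distrib_left [symmetric])
    also have "\<dots> \<le> (100 * X) powr (\<gamma> * q) * (C1 * X)"
      using C1(2)[OF f fin] by (intro mult_left_mono) (auto simp: X_def)
    also have "\<dots> = 100 powr (\<gamma> * q) * C1 * X powr (\<gamma> * q + 1)"
      using X by (simp add: powr_mult powr_add)
    \<comment> \<open>The powers of X add up as homogeneity demands: \<gamma> q from the pointwise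
      bound, 1 from the estimate with exponent q.\<close>
    also have "\<gamma> * q + 1 = q / p"
      using assms(4-6) by (simp add: field_simps)
    finally show ?thesis by (simp add: X_def)
  qed
  then show ?thesis using C1(1) by (intro that[of "100 powr (\<gamma> * q) * C1"]) auto
qed

subsection \<open>A maximum principle in the upper half-plane\<close>

text \<open>At an interior maximum of \<open>|F|^r - Re h\<close> a local branch of \<open>F^r\<close> shows that this function is locally
  constant; a maximiser with least imaginary part is therefore impossible.\<close>

lemma norm_powr_le_Re_upper_half_plane:
  fixes F h :: "complex \<Rightarrow> complex" and r :: real
  assumes F: "F holomorphic_on UNIV"
    and h: "h holomorphic_on {z. Im z > -1}"
    and pos: "\<And>z. Im z \<ge> 0 \<Longrightarrow> Re (h z) \<ge> 0"
    and decay: "\<And>e. e > 0 \<Longrightarrow> \<exists>R. \<forall>z. Im z \<ge> 0 \<longrightarrow> norm z \<ge> R \<longrightarrow> norm (F z) < e"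
    and r: "r > 0"
    and bdry: "\<And>x. norm (F (of_real x)) powr r \<le> Re (h (of_real x))"
    and z: "Im z \<ge> 0"
  shows "norm (F z) powr r \<le> Re (h z)"
proof (rule ccontr)
  define v where "v = (\<lambda>z. norm (F z) powr r - Re (h z))"
  assume "\<not> norm (F z) powr r \<le> Re (h z)"
  then have vz: "v z > 0" by (simp add: v_def)
  \<comment> \<open>The threshold is chosen so that |F|^r < v z outside the disc. As Re h \<ge> 0, v
    stays below v z there, so the supremum over the closed half-plane is attained in the compact set
    \<open>K\<close>.\<close>
  obtain R where R: "\<And>w. Im w \<ge> 0 \<Longrightarrow> norm w \<ge> R \<Longrightarrow> norm (F w) < v z powr (1 / r)"
    using decay[of "v z powr (1 / r)"] vz by auto
  have small: "v w < v z" if "Im w \<ge> 0" "norm w \<ge> R" for w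
  proof -
    have "norm (F w) powr r < (v z powr (1 / r)) powr r"
      using R[OF that] r by (intro powr_less_mono2) auto
    then show ?thesis using vz r pos[OF that(1)] by (simp add: v_def powr_powr)
  qed
  define K where "K = cball 0 R \<inter> {w. Im w \<ge> 0}"
  have "closed {w. Im w \<ge> 0}" by (simp add: closed_halfspace_Im_ge)
  then have K: "compact K" unfolding K_def by (intro compact_Int_closed) auto
  have zK: "z \<in> K" using small[of z] z by (force simp: K_def)
  have Im_open: "open {z. Im z > -1}" by (simp add: open_halfspace_Im_gt)
  have contv: "continuous_on {z. Im z > -1} v"
    unfolding v_def using holomorphic_on_imp_continuous_on[OF F] holomorphic_on_imp_continuous_on[OF h] r
    by (intro continuous_intros continuous_on_powr') (auto elim: continuous_on_subset)
  then have "continuous_on K v" by (rule continuous_on_subset) (auto simp: K_def)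
  then obtain z1 where z1: "z1 \<in> K" "\<And>w. w \<in> K \<Longrightarrow> v w \<le> v z1"
    using continuous_attains_sup[OF K, of v] zK by blast
  define m where "m = v z1"
  have max: "v w \<le> m" if "Im w \<ge> 0" for w
  proof (cases "norm w \<ge> R")
    case True
    then show ?thesis using small[OF that True] z1(2)[OF zK] by (simp add: m_def)
  next
    case False
    then show ?thesis using z1(2)[of w] that by (simp add: m_def K_def)
  qed
  define Z where "Z = K \<inter> {w \<in> {z. Im z > -1}. v w = m}"
  have "compact Z"
  proof -
    have "closedin (top_of_set K) {w \<in> K. v w = m}"
      using \<open>continuous_on K v\<close> by (intro continuous_closedin_preimage_constant)
    then have "compact {w \<in> K. v w = m}" by (rule closedin_compact[OF K])
    moreover have "{w \<in> K. v w = m} = Z" by (auto simp: Z_def K_def)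
    ultimately show ?thesis by simp
  qed
  moreover have "z1 \<in> Z" using z1 by (auto simp: Z_def m_def K_def)
  moreover have "continuous_on Z Im" by (intro continuous_intros)
  ultimately obtain z0 where z0: "z0 \<in> Z" "\<And>w. w \<in> Z \<Longrightarrow> Im z0 \<le> Im w"
    using continuous_attains_inf[of Z Im] by blast
  have m: "m > 0" using z1(2)[OF zK] vz by (simp add: m_def)
  have vz0: "v z0 = m" and z0K: "z0 \<in> K" using z0 by (auto simp: Z_def)
  have "Im z0 \<noteq> 0"
  proof
    assume "Im z0 = 0"
    then have "z0 = of_real (Re z0)" by (simp add: complex_eq_iff)
    then have "v z0 \<le> 0" using bdry[of "Re z0"] by (simp add: v_def)
    then show False using m vz0 by simp
  qed
  then have Imz0: "Im z0 > 0" using z0K by (auto simp: K_def)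
  have Fz0: "F z0 \<noteq> 0"
  proof
    assume "F z0 = 0"
    then show False using pos[of z0] Imz0 vz0 m by (simp add: v_def)
  qed
  have "isCont F z0" using holomorphic_on_imp_continuous_on[OF F] by (simp add: continuous_on_eq_continuous_at)
  then have "isCont (\<lambda>w. Re (F w / F z0)) z0" using Fz0 by (intro isCont_Re isCont_divide) auto
  then have "((\<lambda>w. Re (F w / F z0)) \<longlongrightarrow> Re (F z0 / F z0)) (nhds z0)"
    using tendsto_at_iff_tendsto_nhds[of "\<lambda>w. Re (F w / F z0)" z0] by (simp only: isCont_def)
  moreover have "Re (F z0 / F z0) > 0" using Fz0 by simp
  ultimately have "eventually (\<lambda>w. Re (F w / F z0) > 0) (nhds z0)"
    using order_tendstoD(1) by blast
  moreover have "eventually (\<lambda>w. w \<in> {w. Im w > 0}) (nhds z0)"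
    using Imz0 by (intro eventually_nhds_in_open) (auto simp: open_halfspace_Im_gt)
  ultimately have "eventually (\<lambda>w. Re (F w / F z0) > 0 \<and> Im w > 0) (nhds z0)"
    by (auto intro: eventually_conj)
  then obtain d where d: "d > 0" "\<And>w. dist w z0 < d \<Longrightarrow> Re (F w / F z0) > 0 \<and> Im w > 0"
    unfolding eventually_nhds_metric by blast
  define B where "B = ball z0 d"
  have B: "Re (F w / F z0) > 0" "Im w > 0" if "w \<in> B" for w
    using d(2)[of w] that by (auto simp: B_def dist_commute)
  \<comment> \<open>A branch of F^r on a ball where F w / F z0 stays in the right half-plane,
    normalised to be positive at z0. Thus Re f \<le> |f| = |F|^r, with equality at z0.\<close>
  define f where "f = (\<lambda>w. of_real (norm (F z0) powr r) * exp (of_real r * Ln (F w / F z0)))"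
  have normf: "norm (f w) = norm (F w) powr r" if "w \<in> B" for w
  proof -
    have nz: "F w / F z0 \<noteq> 0" using B(1)[OF that] by auto
    have "norm (f w) = norm (F z0) powr r * exp (r * Re (Ln (F w / F z0)))"
      by (simp add: f_def norm_mult)
    also have "Re (Ln (F w / F z0)) = ln (norm (F w / F z0))" using nz by simp
    also have "exp (r * ln (norm (F w / F z0))) = norm (F w / F z0) powr r"
      using nz by (simp add: powr_def)
    finally show ?thesis using nz Fz0 by (simp add: norm_divide powr_divide)
  qed
  have fz0: "f z0 = of_real (norm (F z0) powr r)" using Fz0 by (simp add: f_def)
  have holf: "f holomorphic_on B"
    unfolding f_def
  proof (intro holomorphic_intros)
    show "F holomorphic_on B" using F holomorphic_on_subset by blast
    fix w assume "w \<in> B"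
    then show "F w / F z0 \<notin> \<real>\<^sub>\<le>\<^sub>0" using B(1)[of w] by (auto simp: complex_nonpos_Reals_iff)
  qed (use Fz0 in auto)
  \<comment> \<open>Exponentiation turns Re (f - h) \<le> v \<le> m, an equality at z0, into a
    statement about moduli, so that the maximum modulus principle makes g constant and hence v = m
    on the ball.\<close>
  define g where "g = (\<lambda>w. exp (f w - h w))"
  have "g holomorphic_on B"
    unfolding g_def using B(2) holf by (intro holomorphic_intros holomorphic_on_subset[OF h]) force+
  moreover have gle: "norm (g w) \<le> norm (g z0)" if "w \<in> B" for w
  proof -
    have "Re (f w) \<le> norm (F w) powr r" using complex_Re_le_cmod[of "f w"] normf[OF that] by simp
    then have "Re (f w) - Re (h w) \<le> v w" by (simp add: v_def)
    also have "\<dots> \<le> v z0" using max[of w] B(2)[OF that] vz0 by simp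
    also have "\<dots> = Re (f z0) - Re (h z0)" by (simp add: v_def fz0)
    finally show ?thesis by (simp add: g_def)
  qed
  ultimately have "g constant_on B"
    using d(1) by (intro maximum_modulus_principle[of g B B z0]) (auto simp: B_def)
  have vB: "v w = m" if "w \<in> B" for w
  proof -
    have "g w = g z0" using \<open>g constant_on B\<close> that d(1) by (auto simp: constant_on_def B_def)
    then have "norm (g w) = norm (g z0)" by simp
    then have "Re (f w) - Re (h w) = Re (f z0) - Re (h z0)" by (simp add: g_def)
    also have "\<dots> = m" using vz0 by (simp add: v_def fz0)
    finally have "m = Re (f w) - Re (h w)" by simp
    also have "\<dots> \<le> v w" using complex_Re_le_cmod[of "f w"] normf[OF that] by (simp add: v_def)
    finally show ?thesis using max[of w] B(2)[OF that] by simp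
  qed
  \<comment> \<open>A point of the ball straight below z0 is again a maximiser, and the choice of
    \<open>R\<close> places it in \<open>K\<close>; this contradicts the minimality of Im
    z0.\<close>
  define w where "w = z0 - \<i> * of_real (d / 2)"
  have w: "w \<in> B" using d(1) by (simp add: w_def B_def dist_norm norm_mult)
  have "norm w < R" using small[of w] B(2)[OF w] vB[OF w] z1(2)[OF zK] by (force simp: m_def)
  then have "w \<in> Z" using vB[OF w] B(2)[OF w] by (simp add: Z_def K_def)
  then have "Im z0 \<le> Im w" by (rule z0(2))
  then show False using d(1) by (simp add: w_def)
qed

subsection \<open>Oversampled interpolation of entire functions of exponential type\<close>

lemma contour_integral_rectpath:
  assumes f: "continuous_on (path_image (rectpath a b)) f" and ab: "Re a \<le> Re b" "Im a \<le> Im b"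
  defines "c \<equiv> Complex (Re b) (Im a)" and "d \<equiv> Complex (Re a) (Im b)"
  shows "contour_integral (rectpath a b) f = contour_integral (linepath a c) f +
    contour_integral (linepath c b) f + contour_integral (linepath b d) f + contour_integral (linepath d a) f"
proof -
  have "path_image (rectpath a b) = closed_segment a c \<union> closed_segment c b \<union> closed_segment b d \<union> closed_segment d a"
    by (simp add: rectpath_def Let_def path_image_join c_def d_def Un_assoc)
  then have cont: "continuous_on (closed_segment a c) f" "continuous_on (closed_segment c b) f"
     "continuous_on (closed_segment b d) f" "continuous_on (closed_segment d a) f"
    by (auto intro!: continuous_on_subset[OF f])
  then have "f contour_integrable_on linepath a c" "f contour_integrable_on linepath c b"
     "f contour_integrable_on linepath b d" "f contour_integrable_on linepath d a"
    by (auto intro: contour_integrable_continuous_linepath)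
  then show ?thesis
    by (simp add: rectpath_def Let_def c_def d_def)
qed

lemma norm_contour_integral_linepath_le:
  assumes "continuous_on (closed_segment a b) f" "B \<ge> 0" "\<And>w. w \<in> closed_segment a b \<Longrightarrow> norm (f w) \<le> B"
    and "norm (b - a) \<le> L"
  shows "norm (contour_integral (linepath a b) f) \<le> B * L"
proof -
  have "norm (contour_integral (linepath a b) f) \<le> B * norm (b - a)"
    using assms by (intro contour_integral_bound_linepath contour_integrable_continuous_linepath) auto
  also have "\<dots> \<le> B * L" using assms by (intro mult_left_mono)
  finally show ?thesis .
qed

lemma norm_contour_integral_rectpath_le:
  assumes f: "continuous_on (path_image (rectpath a b)) f" and ab: "Re a \<le> Re b" "Im a \<le> Im b"
    and B: "B \<ge> 0" "\<And>w. w \<in> path_image (rectpath a b) \<Longrightarrow> norm (f w) \<le> B"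
  shows "norm (contour_integral (rectpath a b) f) \<le> B * (2 * (Re b - Re a) + 2 * (Im b - Im a))"
proof -
  define c d where "c = Complex (Re b) (Im a)" and "d = Complex (Re a) (Im b)"
  have sub: "path_image (rectpath a b) = closed_segment a c \<union> closed_segment c b \<union> closed_segment b d \<union> closed_segment d a"
    by (simp add: rectpath_def Let_def path_image_join c_def d_def Un_assoc)
  have len: "norm (c - a) \<le> Re b - Re a" "norm (b - c) \<le> Im b - Im a" "norm (d - b) \<le> Re b - Re a" "norm (a - d) \<le> Im b - Im a"
    using ab by (auto simp: c_def d_def cmod_def)
  have "norm (contour_integral (linepath a c) f) \<le> B * (Re b - Re a)"
       "norm (contour_integral (linepath c b) f) \<le> B * (Im b - Im a)"
       "norm (contour_integral (linepath b d) f) \<le> B * (Re b - Re a)"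
       "norm (contour_integral (linepath d a) f) \<le> B * (Im b - Im a)"
    using B len by (auto intro!: norm_contour_integral_linepath_le continuous_on_subset[OF f] simp: sub)
  moreover have "norm (w + x + y + z) \<le> norm w + norm x + norm y + norm z" for w x y z :: complex
    by (meson add_mono_thms_linordered_semiring(3) norm_triangle_le norm_triangle_ineq order_trans)
  ultimately show ?thesis
    unfolding contour_integral_rectpath[OF f ab] c_def[symmetric] d_def[symmetric]
    by (smt (verit, best) distrib_left mult_2)
qed

section \<open>The entire function sin z / z and bounds for the sine\<close>

definition csinc :: "complex \<Rightarrow> complex" where
  "csinc z = (if z = 0 then 1 else sin z / z)"

lemma csinc_0 [simp]: "csinc 0 = 1"
  by (simp add: csinc_def)

lemma holomorphic_csinc: "csinc holomorphic_on UNIV"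
proof (rule pole_theorem_open_0[where g = sin and a = 0])
  have "(sin has_field_derivative cos 0) (at (0::complex))" by (rule DERIV_sin)
  then show "csinc 0 = deriv sin 0" by (simp add: DERIV_imp_deriv)
  have "(\<lambda>z::complex. sin z) holomorphic_on UNIV" by (intro holomorphic_intros)
  then show "sin holomorphic_on (UNIV :: complex set)" .
qed (auto simp: csinc_def)

lemma holomorphic_csinc' [holomorphic_intros]:
  "f holomorphic_on A \<Longrightarrow> (\<lambda>z. csinc (f z)) holomorphic_on A"
  by (rule holomorphic_on_compose_gen[of f A csinc UNIV, unfolded o_def]) (auto intro: holomorphic_csinc)

lemma norm_sin_le_exp: "norm (sin z) \<le> exp \<bar>Im z\<bar>"
  using cmod_sin_le_exp[of 1 z] by simp

lemma norm_sin_le_norm_exp: "norm (sin z) \<le> norm z * exp \<bar>Im z\<bar>"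
proof -
  have "norm (sin z - sin 0) \<le> exp \<bar>Im z\<bar> * norm (z - 0)"
  proof (rule field_differentiable_bound)
    show "norm (cos w) \<le> exp \<bar>Im z\<bar>" if w: "w \<in> closed_segment 0 z" for w
    proof -
      obtain u where u: "0 \<le> u" "u \<le> 1" "w = (1 - u) *\<^sub>R 0 + u *\<^sub>R z"
        using w unfolding in_segment by blast
      have "w = u *\<^sub>R z" using u(3) by simp
      then show ?thesis using cmod_cos_le_exp[OF u(1,2), of z] by (simp only:)
    qed
    show "(sin has_field_derivative cos w) (at w within closed_segment 0 z)" for w :: complex
      by (rule has_field_derivative_at_within[OF DERIV_sin])
  qed auto
  then show ?thesis by (simp add: mult.commute)
qed

lemma norm_csinc_le: "norm (csinc z) \<le> exp \<bar>Im z\<bar>"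
  using norm_sin_le_norm_exp[of z] by (auto simp: csinc_def norm_divide divide_simps mult.commute)

lemma norm_csinc_le_divide: "z \<noteq> 0 \<Longrightarrow> norm (csinc z) \<le> exp \<bar>Im z\<bar> / norm z"
  using norm_sin_le_exp[of z] by (simp add: csinc_def norm_divide divide_right_mono)

text \<open>The half side N/2 + 1/4 puts the vertical sides midway between neighbouring zeros in
  \<int>/2, where the modulus of the sine is a hyperbolic cosine. On the horizontal sides |Im w|
  \<ge> 1/4 already makes the exponential dominate.\<close>

lemma norm_sin_ge_square:
  assumes "w \<in> path_image (rectpath (Complex (-R) (-R)) (Complex R R))" "R = real N / 2 + 1 / 4"
  shows "norm (sin (2 * of_real pi * w)) \<ge> exp (2 * pi * \<bar>Im w\<bar>) / 4"
proof -
  define z where "z = 2 * of_real pi * w"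
  define a where "a = 2 * pi * \<bar>Im w\<bar>"
  have R: "R > 0" using assms(2) by simp
  have a: "\<bar>Im z\<bar> = a" "a \<ge> 0" by (auto simp: z_def a_def abs_mult)
  have e: "exp (2 * Im z) + inverse (exp (2 * Im z)) = exp (2 * a) + exp (-(2 * a))"
    using a by (auto simp: abs_if exp_minus split: if_splits)
  have "\<bar>Re w\<bar> = R \<or> \<bar>Im w\<bar> = R"
    using assms(1) R by (subst (asm) path_image_rectpath) auto
  then have "(exp a / 4)\<^sup>2 \<le> (norm (sin z))\<^sup>2"
  proof
    assume "\<bar>Re w\<bar> = R"
    then have "\<bar>2 * Re z\<bar> = 2 * pi * real N + pi"
      using assms(2) by (simp add: z_def abs_mult algebra_simps)
    then have "cos (2 * Re z) = -1"
      by (metis cos_abs_real cos_2npi cos_periodic_pi mult.commute mult.left_commute)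
    then have "4 * (norm (sin z))\<^sup>2 \<ge> exp (2 * a)" unfolding norm_sin_squared e by simp
    then have "(norm (sin z))\<^sup>2 * 16 \<ge> exp (2 * a)" using zero_le_power2[of "norm (sin z)"] by linarith
    then show ?thesis by (simp add: power_divide exp_double [symmetric])
  next
    assume "\<bar>Im w\<bar> = R"
    then have "a \<ge> 2 * pi * (1 / 4)" using assms(2) unfolding a_def by (intro mult_left_mono) auto
    then have "2 * a \<ge> 3" using pi_gt3 by simp
    then have "exp (2 * a) \<ge> 1 + 3" using exp_ge_add_one_self[of "2 * a"] by linarith
    moreover have "4 * (norm (sin z))\<^sup>2 \<ge> exp (2 * a) - 2"
    proof -
      have gen: "x - 2 \<le> 4 * ((x + y - 2 * c) / 4)" if "c \<le> 1" "0 < y" for x y c :: real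
        using that by simp
      show ?thesis unfolding norm_sin_squared e by (rule gen) auto
    qed
    ultimately have "4 * (norm (sin z))\<^sup>2 \<ge> exp (2 * a) / 4" by linarith
    then show ?thesis by (simp add: power_divide exp_double [symmetric])
  qed
  then have "exp a / 4 \<le> norm (sin z)" by (rule power2_le_imp_le) simp
  then show ?thesis by (simp add: z_def a_def)
qed

lemma sin_2pi_half_int: "sin (2 * of_real pi * (of_int n / 2 :: complex)) = 0"
  and cos_2pi_half_int: "cos (2 * of_real pi * (of_int n / 2 :: complex)) = (if even n then 1 else -1)"
proof -
  have eq: "2 * of_real pi * (of_int n / 2 :: complex) = of_real (pi * of_int n)" by simp
  show "sin (2 * of_real pi * (of_int n / 2 :: complex)) = 0"
    unfolding eq sin_of_real by simp
  show "cos (2 * of_real pi * (of_int n / 2 :: complex)) = (if even n then 1 else -1)"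
    unfolding eq cos_of_real by simp
qed

lemma sin_2pi_eq_0_imp:
  assumes "sin (2 * of_real pi * (w::complex)) = 0"
  obtains n :: int where "w = of_int n / 2"
proof -
  from assms obtain n :: int where "2 * of_real pi * w = of_real (of_int n * pi)"
    unfolding sin_eq_0 by blast
  then have "w = of_int n / 2" by (simp add: field_simps)
  then show ?thesis by (rule that)
qed

text \<open>Lagrange interpolation at \<open>\<int>/2\<close>, twice the Nyquist rate of an entire function of exponential
  type \<open>\<pi>\<close>; the oversampling leaves room for the factor \<open>csinc ^ m\<close>, which makes the
  interpolation kernel decay as fast as one likes.\<close>

lemma half_integer_interpolation:
  fixes S :: "complex \<Rightarrow> complex"
  assumes S: "S holomorphic_on UNIV" and D: "\<And>w. norm (S w) \<le> D * exp (pi * \<bar>Im w\<bar>)"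
    and m: "m \<ge> 1" and x: "sin (2 * of_real pi * complex_of_real x) \<noteq> 0"
  shows "(\<lambda>N. \<Sum>n\<in>{-int N..int N}. S (of_int n / 2) * csinc (of_real pi * (of_real x - of_int n / 2) / of_nat m) ^ m
            / ((of_int n / 2 - of_real x) * (2 * of_real pi * (if even n then 1 else -1))))
         \<longlonglongrightarrow> - S (of_real x) / sin (2 * of_real pi * of_real x)"
proof -
  define \<psi> where "\<psi> = (\<lambda>w::complex. csinc (of_real pi * (of_real x - w) / of_nat m) ^ m)"
  define num where "num = (\<lambda>w::complex. S w * \<psi> w)"
  \<comment> \<open>Its zeros are x and the half-integers, all simple because sin(2\<pi> x) \<noteq>
    0. As \<psi> equals 1 at x, the residue of num/den at x is S(x)/sin(2\<pi> x), and the other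
    residues are the interpolation terms.\<close>
  define den where "den = (\<lambda>w::complex. (w - of_real x) * sin (2 * of_real pi * w))"
  define f where "f = (\<lambda>w. num w / den w)"
  define den' where "den' = (\<lambda>w::complex. sin (2 * of_real pi * w) + (w - of_real x) * (2 * of_real pi * cos (2 * of_real pi * w)))"
  define pts where "pts = (\<lambda>N::nat. insert (of_real x) ((\<lambda>n. of_int n / 2 :: complex) ` {-int N..int N}))"
  define R where "R = (\<lambda>N::nat. real N / 2 + 1 / 4)"
  define \<gamma> where "\<gamma> = (\<lambda>N. rectpath (Complex (- R N) (- R N)) (Complex (R N) (R N)))"
  have Rpos: "R N > 0" for N by (simp add: R_def)
  have num: "num holomorphic_on UNIV"
    unfolding num_def \<psi>_def using S m by (intro holomorphic_intros) auto
  have den: "den holomorphic_on UNIV" unfolding den_def by (intro holomorphic_intros)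
  have den_deriv: "(den has_field_derivative den' w) (at w)" for w
    unfolding den_def den'_def by (auto intro!: derivative_eq_intros simp: algebra_simps)
  have half_ne: "of_int n / 2 \<noteq> complex_of_real x" for n :: int
    using x sin_2pi_half_int[of n] by metis
  have zero: "w = of_real x \<or> (\<exists>n::int. w = of_int n / 2)" if "den w = 0" for w
    using that sin_2pi_eq_0_imp[of w] by (force simp: den_def)
  have den'_nz: "den' w \<noteq> 0" if "w = of_real x \<or> (\<exists>n::int. w = of_int n / 2)" for w
    using that
  proof
    assume "w = of_real x"
    then show ?thesis using x by (simp add: den'_def)
  next
    assume "\<exists>n::int. w = of_int n / 2"
    then obtain n :: int where n: "w = of_int n / 2" by blast
    have "den' w = (of_int n / 2 - of_real x) * (2 * of_real pi * (if even n then 1 else -1))"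
      unfolding den'_def n sin_2pi_half_int cos_2pi_half_int by simp
    moreover have "of_int n / 2 - complex_of_real x \<noteq> 0" using half_ne[of n] by simp
    ultimately show ?thesis by simp
  qed
  have den0: "den w = 0" if "w = of_real x \<or> (\<exists>n::int. w = of_int n / 2)" for w
    using that unfolding den_def by (elim disjE exE; hypsubst) (simp_all only: sin_2pi_half_int diff_self mult_zero_left mult_zero_right)
  have contf: "f holomorphic_on A" if "\<And>w. w \<in> A \<Longrightarrow> den w \<noteq> 0" for A
    unfolding f_def using that by (intro holomorphic_intros holomorphic_on_subset[OF num] holomorphic_on_subset[OF den]) auto
  have res: "residue f w = num w / den' w" if w: "w = of_real x \<or> (\<exists>n::int. w = of_int n / 2)" for w
  proof -
    have "((\<lambda>z. (den z - den w) / (z - w)) \<longlongrightarrow> den' w) (at w)"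
      using den_deriv[of w] by (simp add: has_field_derivative_iff)
    then have lim: "((\<lambda>z. den z / (z - w)) \<longlongrightarrow> den' w) (at w)" using den0[OF w] by simp
    then have "eventually (\<lambda>z. den z / (z - w) \<in> - {0}) (at w)"
      using den'_nz[OF w] by (intro topological_tendstoD) auto
    then have "eventually (\<lambda>z. den z \<noteq> 0) (at w)" by eventually_elim auto
    then obtain e where e: "e > 0" "\<And>z. z \<noteq> w \<Longrightarrow> dist z w < e \<Longrightarrow> den z \<noteq> 0"
      unfolding eventually_at by auto
    show ?thesis
    proof (rule residue_simple'[of "ball w e"])
      show "f holomorphic_on ball w e - {w}" using e by (intro contf) (auto simp: dist_commute)
      have "(num \<longlongrightarrow> num w) (at w)"
        using holomorphic_on_imp_continuous_on[OF num] by (simp add: continuous_on_eq_continuous_at isCont_def)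
      then have "((\<lambda>z. num z / (den z / (z - w))) \<longlongrightarrow> num w / den' w) (at w)"
        using lim den'_nz[OF w] by (intro tendsto_divide)
      then show "((\<lambda>z. f z * (z - w)) \<longlongrightarrow> num w / den' w) (at w)"
        by (rule Lim_transform_eventually) (auto simp: f_def eventually_at_filter)
    qed (use e in auto)
  qed
  have two_pi_i: "complex_of_real (2 * pi) * \<i> \<noteq> 0" by simp
  have main: "(\<Sum>n\<in>{-int N..int N}. num (of_int n / 2) / ((of_int n / 2 - of_real x) * (2 * of_real pi * (if even n then 1 else -1))))
      - (- S (of_real x) / sin (2 * of_real pi * of_real x)) = contour_integral (\<gamma> N) f / (2 * pi * \<i>)"
    if N: "R N > \<bar>x\<bar>" for N
  proof -
    define Q where "Q = box (Complex (- R N - 1/4) (- R N - 1/4)) (Complex (R N + 1/4) (R N + 1/4))"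
    have inbox: "w \<in> box (Complex (- R N) (- R N)) (Complex (R N) (R N))" if "w \<in> pts N" for w
      using that N Rpos[of N] unfolding pts_def R_def
      by (auto simp: in_box_complex_iff)
    have pts: "w \<in> pts N" if w: "w \<in> Q" "den w = 0" for w
    proof -
      consider "w = of_real x" | n :: int where "w = of_int n / 2" using zero[OF w(2)] by blast
      then show ?thesis
      proof cases
        case 2
        have "Re (complex_of_int n / 2) = real_of_int n / 2" by simp
        with 2 have "Re w = real_of_int n / 2" by (simp only:)
        moreover have "\<bar>Re w\<bar> < real N / 2 + 1 / 2" using w(1) by (auto simp: Q_def in_box_complex_iff R_def)
        ultimately have "\<bar>real_of_int n\<bar> < real N + 1" by simp
        then have "n \<in> {-int N..int N}" by (auto simp: abs_less_iff)
        then show ?thesis using 2 by (auto simp: pts_def)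
      qed (simp add: pts_def)
    qed
    have "contour_integral (\<gamma> N) f = 2 * pi * \<i> * (\<Sum>w\<in>pts N. winding_number (\<gamma> N) w * residue f w)"
    proof (rule Residue_theorem)
      show "open Q" "connected Q" by (auto simp: Q_def open_box intro: convex_connected convex_box)
      show "finite (pts N)" by (simp add: pts_def)
      show "f holomorphic_on Q - pts N" using pts by (intro contf) auto
      show "path_image (\<gamma> N) \<subseteq> Q - pts N"
      proof -
        have "path_image (\<gamma> N) = cbox (Complex (- R N) (- R N)) (Complex (R N) (R N)) - box (Complex (- R N) (- R N)) (Complex (R N) (R N))"
          using Rpos[of N] unfolding \<gamma>_def by (intro path_image_rectpath_cbox_minus_box) auto
        then show ?thesis using inbox by (auto simp: Q_def in_box_complex_iff in_cbox_complex_iff)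
      qed
      show "\<forall>z. z \<notin> Q \<longrightarrow> winding_number (\<gamma> N) z = 0"
        using Rpos[of N] unfolding \<gamma>_def
        by (auto intro!: winding_number_rectpath_outside simp: Q_def in_box_complex_iff in_cbox_complex_iff)
    qed (auto simp: \<gamma>_def)
    also have "(\<Sum>w\<in>pts N. winding_number (\<gamma> N) w * residue f w) = (\<Sum>w\<in>pts N. num w / den' w)"
    proof (rule sum.cong)
      fix w assume w: "w \<in> pts N"
      have "winding_number (\<gamma> N) w = 1" unfolding \<gamma>_def by (rule winding_number_rectpath[OF inbox[OF w]])
      moreover have "w = of_real x \<or> (\<exists>n::int. w = of_int n / 2)" using w by (auto simp: pts_def)
      ultimately show "winding_number (\<gamma> N) w * residue f w = num w / den' w" using res by simp
    qed simp
    also have "\<dots> = num (of_real x) / den' (of_real x) + (\<Sum>n\<in>{-int N..int N}. num (of_int n / 2) / den' (of_int n / 2))"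
    proof -
      have "inj_on (\<lambda>n. of_int n / 2 :: complex) {-int N..int N}" by (auto simp: inj_on_def)
      moreover have "complex_of_real x \<notin> (\<lambda>n. of_int n / 2) ` {-int N..int N}" 
      proof
        assume "complex_of_real x \<in> (\<lambda>n. of_int n / 2) ` {-int N..int N}"
        then obtain n :: int where "complex_of_real x = of_int n / 2" by blast
        then show False using half_ne[of n] by (simp only:)
      qed
      ultimately show ?thesis unfolding pts_def
        by (subst sum.insert) (simp_all only: finite_imageI finite_atLeastAtMost_int sum.reindex o_def not_False_eq_True)
    qed
    also have "num (of_real x) / den' (of_real x) = S (of_real x) / sin (2 * of_real pi * of_real x)"
    proof -
      have "num (of_real x) = S (of_real x)" by (simp add: num_def \<psi>_def)
      moreover have "den' (of_real x) = sin (2 * of_real pi * of_real x)"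
        unfolding den'_def by (simp only: diff_self mult_zero_left add_0_right)
      ultimately show ?thesis by (simp only:)
    qed
    also have "(\<Sum>n\<in>{-int N..int N}. num (of_int n / 2) / den' (of_int n / 2)) =
       (\<Sum>n\<in>{-int N..int N}. num (of_int n / 2) / ((of_int n / 2 - of_real x) * (2 * of_real pi * (if even n then 1 else -1))))"
      by (intro sum.cong) (simp_all only: den'_def sin_2pi_half_int cos_2pi_half_int add_0)
    finally have "contour_integral (\<gamma> N) f / (2 * pi * \<i>) = S (of_real x) / sin (2 * of_real pi * of_real x) +
       (\<Sum>n\<in>{-int N..int N}. num (of_int n / 2) / ((of_int n / 2 - of_real x) * (2 * of_real pi * (if even n then 1 else -1))))"
      by (simp only: nonzero_mult_div_cancel_left[OF two_pi_i])
    then show ?thesis by (simp only: minus_divide_left[symmetric] diff_minus_eq_add add.commute)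
  qed
  have D0: "D \<ge> 0" using D[of 0] norm_ge_zero[of "S 0"] by (simp del: norm_ge_zero)
  define c where "c = 4 * D * (real m / pi) ^ m"
  have c: "c \<ge> 0" using D0 by (simp add: c_def)
  \<comment> \<open>S and \<psi> each grow at most like exp(\<pi> |Im w|), and the product of the
    two is exactly compensated by sin(2\<pi> w). What remains is d^(-1-m) with d the distance to x;
    as m \<ge> 1 this beats the length 8R of the square.\<close>
  have bound: "norm (contour_integral (\<gamma> N) f) \<le> c / (R N - \<bar>x\<bar>)\<^sup>2 * (8 * R N)" if N: "R N \<ge> \<bar>x\<bar> + 1" for N
  proof -
    have path: "R N \<le> norm w" "den w \<noteq> 0" "norm (f w) \<le> c / (R N - \<bar>x\<bar>)\<^sup>2" if w: "w \<in> path_image (\<gamma> N)" for w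
    proof -
      have "\<bar>Re w\<bar> = R N \<or> \<bar>Im w\<bar> = R N"
        using w Rpos[of N] unfolding \<gamma>_def by (subst (asm) path_image_rectpath) auto
      then show Rw: "R N \<le> norm w" using abs_Re_le_cmod[of w] abs_Im_le_cmod[of w] by auto
      define d where "d = norm (w - of_real x)"
      have d: "d \<ge> R N - \<bar>x\<bar>" using Rw norm_triangle_ineq2[of w "of_real x"] by (simp add: d_def)
      have d1: "d \<ge> 1" using d N by simp
      define E where "E = exp (pi * \<bar>Im w\<bar>)"
      have E: "E > 0" by (simp add: E_def)
      have "norm (sin (2 * of_real pi * w)) \<ge> exp (2 * pi * \<bar>Im w\<bar>) / 4"
        using norm_sin_ge_square w unfolding \<gamma>_def R_def by blast
      also have "exp (2 * pi * \<bar>Im w\<bar>) = E * E" by (simp add: E_def flip: exp_add)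
      finally have sin: "norm (sin (2 * of_real pi * w)) \<ge> E * E / 4" .
      have "norm (sin (2 * of_real pi * w)) > 0"
        using less_le_trans[OF _ sin, of 0] E by (simp add: zero_less_mult_iff)
      then show "den w \<noteq> 0" using d1 by (auto simp: den_def d_def)
      define u where "u = of_real pi * (of_real x - w) / of_nat m"
      have nu: "norm u = pi * d / m" by (simp add: u_def d_def norm_mult norm_divide norm_minus_commute)
      have "u \<noteq> 0" using d1 m nu by (metis divide_eq_0_iff mult_eq_0_iff norm_zero not_one_le_zero of_nat_eq_0_iff pi_neq_zero)
      have "norm (csinc u) \<le> exp \<bar>Im u\<bar> / norm u" by (rule norm_csinc_le_divide) fact
      then have "norm (csinc u) ^ m \<le> (exp \<bar>Im u\<bar> / norm u) ^ m" by (intro power_mono) auto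
      also have "\<dots> = exp (real m * \<bar>Im u\<bar>) / norm u ^ m"
        by (simp add: power_divide flip: exp_of_nat_mult)
      also have "real m * \<bar>Im u\<bar> = pi * \<bar>Im w\<bar>"
        using m by (simp add: u_def abs_mult)
      also have "exp (pi * \<bar>Im w\<bar>) / norm u ^ m = E * (real m / pi) ^ m / d ^ m"
        using d1 m by (simp add: E_def nu power_divide power_mult_distrib)
      finally have psi: "norm (\<psi> w) \<le> E * (real m / pi) ^ m / d ^ m"
        by (simp add: \<psi>_def u_def norm_power)
      have "norm (num w) \<le> (D * E) * (E * (real m / pi) ^ m / d ^ m)"
        unfolding num_def norm_mult using D[of w] psi D0 E by (intro mult_mono) (auto simp: E_def)
      then have "norm (f w) \<le> ((D * E) * (E * (real m / pi) ^ m / d ^ m)) / (d * (E * E / 4))"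
        unfolding f_def norm_divide den_def norm_mult d_def [symmetric]
        using sin d1 E D0 by (intro frac_le mult_left_mono) auto
      also have "\<dots> = c / (d * d ^ m)" using E d1 by (simp add: c_def field_simps)
      also have "\<dots> \<le> c / (R N - \<bar>x\<bar>)\<^sup>2"
      proof (rule divide_left_mono)
        have "(R N - \<bar>x\<bar>)\<^sup>2 \<le> d\<^sup>2" using d N by (intro power_mono) auto
        also have "\<dots> \<le> d ^ Suc m" using d1 m by (intro power_increasing) auto
        finally show "(R N - \<bar>x\<bar>)\<^sup>2 \<le> d * d ^ m" by simp
      qed (use c d1 N in \<open>auto intro!: mult_pos_pos\<close>)
      finally show "norm (f w) \<le> c / (R N - \<bar>x\<bar>)\<^sup>2" .
    qed
    have "norm (contour_integral (\<gamma> N) f) \<le> c / (R N - \<bar>x\<bar>)\<^sup>2 *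
       (2 * (Re (Complex (R N) (R N)) - Re (Complex (- R N) (- R N))) + 2 * (Im (Complex (R N) (R N)) - Im (Complex (- R N) (- R N))))"
      unfolding \<gamma>_def
    proof (rule norm_contour_integral_rectpath_le)
      show "continuous_on (path_image (rectpath (Complex (- R N) (- R N)) (Complex (R N) (R N)))) f"
        using path(2) by (intro holomorphic_on_imp_continuous_on contf) (auto simp: \<gamma>_def)
    qed (use path(3) c Rpos[of N] in \<open>auto simp: \<gamma>_def\<close>)
    then show ?thesis by simp
  qed
  have "(\<lambda>N. c / (R N - \<bar>x\<bar>)\<^sup>2 * (8 * R N)) \<longlonglongrightarrow> 0"
    unfolding R_def by real_asymp
  moreover have "eventually (\<lambda>N. R N \<ge> \<bar>x\<bar> + 1) sequentially"
    unfolding R_def by real_asymp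
  ultimately have "(\<lambda>N. contour_integral (\<gamma> N) f) \<longlonglongrightarrow> 0"
    using bound by (elim Lim_null_comparison [rotated]) (auto elim: eventually_mono)
  then have "(\<lambda>N. contour_integral (\<gamma> N) f / (2 * pi * \<i>)) \<longlonglongrightarrow> 0"
    by (simp add: tendsto_divide_zero)
  moreover have "eventually (\<lambda>N. R N > \<bar>x\<bar>) sequentially"
    unfolding R_def by real_asymp
  then have "eventually (\<lambda>N. contour_integral (\<gamma> N) f / (2 * pi * \<i>) =
     (\<Sum>n\<in>{-int N..int N}. num (of_int n / 2) / ((of_int n / 2 - of_real x) * (2 * of_real pi * (if even n then 1 else -1))))
      - (- S (of_real x) / sin (2 * of_real pi * of_real x))) sequentially"
    by (rule eventually_mono) (use main in auto)
  ultimately show ?thesis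
    unfolding num_def \<psi>_def by (subst Lim_null) (rule Lim_transform_eventually)
qed

section \<open>Pointwise bounds for r-th powers on the real line\<close>

lemma powr_add_le:
  fixes x y :: real
  assumes "x \<ge> 0" "y \<ge> 0" "0 < r" "r \<le> 1"
  shows "(x + y) powr r \<le> x powr r + y powr r"
proof (cases "x + y = 0")
  case True
  then show ?thesis by simp
next
  case False
  define s where "s = x + y"
  have s: "s > 0" using False assms by (simp add: s_def)
  have le: "u / s * s powr r \<le> u powr r" if u: "0 \<le> u" "u \<le> s" for u
  proof -
    have "u / s \<le> (u / s) powr r"
    proof (cases "u = 0")
      case False
      then have "(u / s) powr 1 \<le> (u / s) powr r"
        using u s assms by (intro powr_mono') auto
      then show ?thesis using u s by simp
    qed simp
    then have "u / s * s powr r \<le> (u / s) powr r * s powr r" by (intro mult_right_mono) auto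
    also have "\<dots> = u powr r" using u s by (simp flip: powr_mult)
    finally show ?thesis .
  qed
  have "s powr r = x / s * s powr r + y / s * s powr r"
    using s by (simp add: s_def flip: distrib_right add_divide_distrib)
  also have "\<dots> \<le> x powr r + y powr r"
    using le[of x] le[of y] assms by (auto simp: s_def)
  finally show ?thesis by (simp add: s_def)
qed

lemma norm_sum_powr_le:
  assumes "0 < r" "r \<le> 1"
  shows "norm (\<Sum>i\<in>I. g i) powr r \<le> (\<Sum>i\<in>I. norm (g i) powr r)"
proof (induction I rule: infinite_finite_induct)
  case (insert i I)
  have "norm (\<Sum>i\<in>insert i I. g i) powr r \<le> (norm (g i) + norm (\<Sum>i\<in>I. g i)) powr r"
    using insert assms by (auto intro!: powr_mono2 norm_triangle_ineq)
  also have "\<dots> \<le> norm (g i) powr r + norm (\<Sum>i\<in>I. g i) powr r"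
    using assms by (intro powr_add_le) auto
  finally show ?case using insert by simp
qed (use assms in auto)

text \<open>At height N \<ge> 1 a unit shift is absorbed by N^2, so half-integer nodes and arbitrary
  real points may be moved to integers at the cost of a constant.\<close>

lemma poisson_shift_le:
  assumes "N \<ge> 1" "\<bar>u - v\<bar> \<le> 1"
  shows "poisson N u \<le> 3 * poisson N v"
proof -
  have "v\<^sup>2 \<le> 2 * u\<^sup>2 + 2 * (u - v)\<^sup>2"
    using zero_le_power2[of "2 * u - v"] by (simp add: power2_eq_square algebra_simps)
  moreover have "(u - v)\<^sup>2 \<le> 1" using assms(2) by (simp add: abs_square_le_1)
  moreover have "N\<^sup>2 \<ge> 1" using assms(1) by (simp add: one_le_power)
  ultimately have "v\<^sup>2 \<le> 2 * u\<^sup>2 + 2 * N\<^sup>2" by (meson add_left_mono mult_left_mono order_trans zero_le_numeral)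
  moreover have "a + b \<le> 3 * (a + c)" if "b \<le> 2 * c + 2 * a" "0 \<le> c" for a b c :: real
    using that by simp
  ultimately have "N\<^sup>2 + v\<^sup>2 \<le> 3 * (N\<^sup>2 + u\<^sup>2)" using zero_le_power2[of u] by blast
  moreover have "N\<^sup>2 + v\<^sup>2 > 0" "N\<^sup>2 + u\<^sup>2 > 0" using assms(1) by (auto intro!: add_pos_nonneg)
  ultimately have "N / (3 * (N\<^sup>2 + u\<^sup>2)) \<le> N / (N\<^sup>2 + v\<^sup>2)"
    using assms(1) by (intro divide_left_mono) auto
  moreover have "N / D = 3 * (N / (3 * D))" for D by simp
  ultimately show ?thesis unfolding poisson_def by (metis mult_left_mono zero_le_numeral)
qed

lemma sum_poisson_real_le:
  assumes "N \<ge> 1" "finite F"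
  shows "(\<Sum>k\<in>F. poisson N (x - of_int k)) \<le> 24"
proof -
  have "(\<Sum>k\<in>F. poisson N (x - of_int k)) \<le> (\<Sum>k\<in>F. 3 * poisson N (of_int (k - \<lfloor>x\<rfloor>)))"
  proof (rule sum_mono)
    fix k
    have "poisson N (x - of_int k) \<le> 3 * poisson N (of_int (\<lfloor>x\<rfloor> - k))"
      using assms(1) by (intro poisson_shift_le) (simp_all, linarith)
    then show "poisson N (x - of_int k) \<le> 3 * poisson N (of_int (k - \<lfloor>x\<rfloor>))"
      using poisson_minus[of N "of_int (k - \<lfloor>x\<rfloor>)"] by simp
  qed
  also have "\<dots> \<le> 3 * 8"
    unfolding sum_distrib_left [symmetric] using assms by (intro mult_left_mono sum_poisson_le) auto
  finally show ?thesis by simp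
qed

text \<open>Subadditivity of the r-th power is applied to the interpolation series, whose kernel
  decays so fast that its r-th power is dominated by the Poisson kernel of height 1. The constant
  depends on r alone; in particular the growth constant D does not enter it. No summability of f is
  asked for: outside the finite set M the bound e is integrated against the bounded total mass of
  the kernel.\<close>

lemma exponential_type_powr_le_poisson:
  fixes r :: real
  assumes r: "0 < r" "r \<le> 1"
  shows "\<exists>A>0. \<forall>S D f M e x. S holomorphic_on UNIV \<longrightarrow> (\<forall>w. norm (S w) \<le> D * exp (pi * \<bar>Im w\<bar>)) \<longrightarrow>
      (\<forall>k. norm (S (of_int k)) powr r \<le> f k) \<longrightarrow> (\<forall>k. norm (S (of_int k + 1/2)) powr r \<le> f k) \<longrightarrow>
      finite M \<longrightarrow> (\<forall>k. k \<notin> M \<longrightarrow> f k \<le> e) \<longrightarrow> e \<ge> 0 \<longrightarrow>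
      norm (S (of_real x)) powr r \<le> A * ((\<Sum>k\<in>M. f k * poisson 1 (x - of_int k)) + e)"
proof -
  \<comment> \<open>The r-th power of the kernel decays like |u|^(-r(m+1)), so r(m+1) \<ge> 2 is
    what a comparison with the Poisson kernel requires.\<close>
  obtain m0 :: nat where m0: "real m0 \<ge> 2 / r" using real_arch_simple by blast
  define m where "m = max 1 m0"
  have m: "m \<ge> 1" "real m \<ge> 2 / r" using m0 by (auto simp: m_def)
  have rm: "r * real (Suc m) \<ge> 2"
  proof -
    have "2 = r * (2 / r)" using r by simp
    also have "\<dots> \<le> r * real (Suc m)" using m r by (intro mult_left_mono) auto
    finally show ?thesis .
  qed
  define c where "c = (real m / pi) ^ m"
  have c: "c > 0" using m by (simp add: c_def)
  define A0 where "A0 = 2 * (1 + c powr r)"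
  have A0: "A0 \<ge> 2" by (simp add: A0_def)
  have kernel: "norm (csinc (of_real (pi * u) / of_nat m) ^ m * sin (of_real (2 * pi * u)) / of_real (2 * pi * u)) powr r
     \<le> A0 * poisson 1 u" if u: "u \<noteq> 0" for u :: real
  proof -
    have "of_real (pi * u) / of_nat m = complex_of_real (pi * u / real m)" by simp
    then have Im0: "Im (of_real (pi * u) / of_nat m) = 0" by (simp only: Im_complex_of_real)
    have nrm: "norm (of_real (pi * u) / of_nat m :: complex) = pi * \<bar>u\<bar> / m"
      by (simp add: norm_divide norm_mult)
    have nz: "of_real (pi * u) / of_nat m \<noteq> (0::complex)" using u m by simp
    have a1: "norm (csinc (of_real (pi * u) / of_nat m)) \<le> 1"
      using norm_csinc_le[of "of_real (pi * u) / of_nat m"] unfolding Im0 by simp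
    have a2: "norm (csinc (of_real (pi * u) / of_nat m)) \<le> m / (pi * \<bar>u\<bar>)"
      using norm_csinc_le_divide[OF nz] unfolding Im0 nrm by simp
    have Im1: "Im (complex_of_real (2 * pi * u)) = 0" by (rule Im_complex_of_real)
    have b1: "norm (sin (complex_of_real (2 * pi * u))) \<le> 2 * pi * \<bar>u\<bar>"
      using norm_sin_le_norm_exp[of "of_real (2 * pi * u)"] unfolding Im1 norm_of_real by (simp add: abs_mult)
    have b2: "norm (sin (complex_of_real (2 * pi * u))) \<le> 1"
      using norm_sin_le_exp[of "of_real (2 * pi * u)"] unfolding Im1 by simp
    define L where "L = norm (csinc (of_real (pi * u) / of_nat m) ^ m * sin (of_real (2 * pi * u)) / of_real (2 * pi * u))"
    have L: "L = norm (csinc (of_real (pi * u) / of_nat m)) ^ m * (norm (sin (complex_of_real (2 * pi * u))) / (2 * pi * \<bar>u\<bar>))"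
      unfolding L_def norm_mult norm_divide norm_power norm_of_real by (simp add: abs_mult)
    show ?thesis
    proof (cases "\<bar>u\<bar> \<le> 1")
      case True
      have "L \<le> 1 ^ m * 1"
        unfolding L using a1 b1 u by (intro mult_mono power_mono) (auto simp: divide_simps)
      then have "L powr r \<le> 1 powr r" using r by (intro powr_mono2) (auto simp: L_def)
      also have "\<dots> \<le> A0 * (1 / (1 + u\<^sup>2))"
      proof -
        have "u\<^sup>2 \<le> 1" using True by (simp add: abs_square_le_1)
        then have "2 * (1 / 2) \<le> A0 * (1 / (1 + u\<^sup>2))"
          using A0 by (intro mult_mono divide_left_mono) (auto intro!: mult_pos_pos add_pos_nonneg)
        then show ?thesis by simp
      qed
      finally show ?thesis by (simp add: L_def poisson_def)
    next
      case False
      then have u1: "\<bar>u\<bar> \<ge> 1" by simp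
      have "L \<le> (m / (pi * \<bar>u\<bar>)) ^ m * (1 / (1 * \<bar>u\<bar>))"
        unfolding L
        using a2 b2 u1 pi_ge_two by (intro mult_mono power_mono frac_le) auto
      also have "\<dots> = c / \<bar>u\<bar> ^ Suc m"
        by (simp add: c_def power_divide power_mult_distrib)
      finally have "L powr r \<le> (c / \<bar>u\<bar> ^ Suc m) powr r" using r by (intro powr_mono2) (auto simp: L_def)
      also have "\<dots> = c powr r / \<bar>u\<bar> powr (r * real (Suc m))"
      proof -
        have "\<bar>u\<bar> ^ Suc m = \<bar>u\<bar> powr real (Suc m)" using u1 by (intro powr_realpow [symmetric]) auto
        then have "(\<bar>u\<bar> ^ Suc m) powr r = \<bar>u\<bar> powr (r * real (Suc m))" by (simp only: powr_powr mult.commute)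
        then show ?thesis using c u1 by (simp add: powr_divide del: power_Suc of_nat_Suc)
      qed
      also have "\<dots> \<le> c powr r / \<bar>u\<bar> powr 2"
        using u1 rm by (intro divide_left_mono powr_mono) auto
      also have "\<bar>u\<bar> powr 2 = u\<^sup>2" using u1 by simp
      also have "c powr r / u\<^sup>2 \<le> A0 * (1 / (1 + u\<^sup>2))"
      proof -
        have u2: "u\<^sup>2 \<ge> 1" using u1 by (metis one_le_power power2_abs)
        have "c powr r / u\<^sup>2 = (2 * c powr r) / (2 * u\<^sup>2)" by simp
        also have "\<dots> \<le> A0 / (1 + u\<^sup>2)"
          using u2 by (intro frac_le) (auto simp: A0_def)
        finally show ?thesis by simp
      qed
      finally show ?thesis by (simp add: L_def poisson_def)
    qed
  qed
  define A where "A = 144 * A0"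
  have "norm (S (of_real x)) powr r \<le> A * ((\<Sum>k\<in>M. f k * poisson 1 (x - of_int k)) + e)"
    if S: "S holomorphic_on UNIV" and D: "\<And>w. norm (S w) \<le> D * exp (pi * \<bar>Im w\<bar>)"
      and f: "\<And>k. norm (S (of_int k)) powr r \<le> f k" "\<And>k. norm (S (of_int k + 1/2)) powr r \<le> f k"
      and M: "finite M" "\<And>k. k \<notin> M \<Longrightarrow> f k \<le> e" and e: "e \<ge> 0"
    for S D f M e x
  proof -
    have f0: "f k \<ge> 0" for k using f(1)[of k] by (meson order_trans powr_ge_zero)
    \<comment> \<open>The nodes k and k + 1/2 share the datum f k, so the half-integer n/2 is
      charged to n div 2.\<close>
    have Sn: "norm (S (of_int n / 2)) powr r \<le> f (n div 2)" for n
    proof (cases "even n")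
      case True
      then show ?thesis using f(1)[of "n div 2"] by (elim evenE) simp
    next
      case False
      then obtain k where k: "n = 2 * k + 1" by (elim oddE)
      have "of_int n / 2 = (of_int k + 1 / 2 :: complex)" by (simp add: k add_divide_distrib)
      moreover have "n div 2 = k" using k by simp
      ultimately show ?thesis using f(2)[of k] by (simp only:)
    qed
    have pos: "(\<Sum>k\<in>M. f k * poisson 1 (x - of_int k)) \<ge> 0" using f0 by (intro sum_nonneg) auto
    have near: "poisson 1 (x - of_int n / 2) \<le> 3 * poisson 1 (x - of_int (n div 2))" for n :: int
    proof -
      have "real_of_int n / 2 = of_int (n div 2) + of_int (n mod 2) / 2"
      proof -
        have "real_of_int (n div 2 * 2 + n mod 2) = real_of_int n" by (simp only: div_mult_mod_eq)
        then have "real_of_int (n div 2) * 2 + real_of_int (n mod 2) = real_of_int n"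
          unfolding of_int_add of_int_mult by simp
        then show ?thesis by linarith
      qed
      moreover have "0 \<le> real_of_int (n mod 2)" "real_of_int (n mod 2) \<le> 1" by auto
      ultimately have "\<bar>(x - of_int n / 2) - (x - of_int (n div 2))\<bar> \<le> 1" by linarith
      then show ?thesis by (intro poisson_shift_le) auto
    qed
    have total: "(\<Sum>k\<in>K. f k * poisson 1 (x - of_int k)) \<le> (\<Sum>k\<in>M. f k * poisson 1 (x - of_int k)) + 24 * e"
      if K: "finite K" for K
    proof -
      have "(\<Sum>k\<in>K. f k * poisson 1 (x - of_int k)) =
        (\<Sum>k\<in>K \<inter> M. f k * poisson 1 (x - of_int k)) + (\<Sum>k\<in>K - M. f k * poisson 1 (x - of_int k))"
        using K by (subst sum.union_disjoint [symmetric]) (auto intro!: sum.cong)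
      also have "(\<Sum>k\<in>K \<inter> M. f k * poisson 1 (x - of_int k)) \<le> (\<Sum>k\<in>M. f k * poisson 1 (x - of_int k))"
        using M f0 by (intro sum_mono2) auto
      also have "(\<Sum>k\<in>K - M. f k * poisson 1 (x - of_int k)) \<le> (\<Sum>k\<in>K - M. e * poisson 1 (x - of_int k))"
        using M by (intro sum_mono mult_right_mono) auto
      also have "\<dots> \<le> e * 24"
        unfolding sum_distrib_left [symmetric] using e K by (intro mult_left_mono sum_poisson_real_le) auto
      finally show ?thesis by simp
    qed
    \<comment> \<open>The factor 6 is 2 times 3: integers and proper half-integers are summed
      separately, and moving a node to its integer part costs 3 by \<open>near\<close>.\<close>
    define Y where "Y = 6 * A0 * ((\<Sum>k\<in>M. f k * poisson 1 (x - of_int k)) + 24 * e)"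
    have Y0: "Y \<ge> 0" using A0 pos e by (simp add: Y_def)
    have "norm (S (of_real x)) powr r \<le> Y"
    proof (cases "sin (2 * of_real pi * complex_of_real x) = 0")
      \<comment> \<open>At a half-integer the interpolation formula degenerates, but then x is
        itself a node and the hypothesis on f applies directly.\<close>
      case True
      then obtain n :: int where n: "complex_of_real x = of_int n / 2" by (rule sin_2pi_eq_0_imp)
      have "complex_of_real x = of_real (of_int n / 2)" using n by simp
      then have xn: "x = of_int n / 2" by (simp only: of_real_eq_iff)
      have "poisson 1 (x - of_int n / 2) = 1" by (simp add: xn poisson_def)
      with near[of n] have p: "3 * poisson 1 (x - of_int (n div 2)) \<ge> 1" by simp
      have "norm (S (of_real x)) powr r \<le> f (n div 2) * 1" unfolding n mult_1_right by (rule Sn)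
      also have "\<dots> \<le> f (n div 2) * (3 * poisson 1 (x - of_int (n div 2)))"
        using p f0 by (intro mult_left_mono) auto
      also have "\<dots> = 3 * (\<Sum>k\<in>{n div 2}. f k * poisson 1 (x - of_int k))" by simp
      also have "\<dots> \<le> 3 * ((\<Sum>k\<in>M. f k * poisson 1 (x - of_int k)) + 24 * e)"
        by (intro mult_left_mono total) auto
      also have "\<dots> \<le> Y" unfolding Y_def using A0 pos e by (intro mult_right_mono) auto
      finally show ?thesis .
    next
      case False
      define s where "s = sin (2 * of_real pi * complex_of_real x)"
      define T where "T = (\<lambda>n::int. S (of_int n / 2) * csinc (of_real pi * (of_real x - of_int n / 2) / of_nat m) ^ m
            / ((of_int n / 2 - of_real x) * (2 * of_real pi * (if even n then 1 else -1))))"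
      have "(\<lambda>N. (- s) * (\<Sum>n\<in>{-int N..int N}. T n)) \<longlonglongrightarrow> (- s) * (- S (of_real x) / s)"
        unfolding T_def s_def by (intro tendsto_intros half_integer_interpolation[OF S D m(1) False])
      moreover have "(- s) * (- S (of_real x) / s) = S (of_real x)" using False by (simp add: s_def)
      ultimately have lim: "(\<lambda>N. norm (\<Sum>n\<in>{-int N..int N}. s * T n)) \<longlonglongrightarrow> norm (S (of_real x))"
        using tendsto_norm[of "\<lambda>N. (- s) * (\<Sum>n\<in>{-int N..int N}. T n)" "S (of_real x)" sequentially]
        by (simp only: norm_mult norm_minus_cancel sum_distrib_left [symmetric])
      have "norm (s * T n) powr r \<le> f (n div 2) * (3 * A0 * poisson 1 (x - of_int (n div 2)))" for n
      proof -
        define u where "u = x - of_int n / 2"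
        have u0: "u \<noteq> 0"
        proof
          assume "u = 0"
          then have xn: "x = of_int n / 2" by (simp add: u_def)
          have "complex_of_real x = of_int n / 2"
            unfolding xn by (simp only: of_real_divide of_real_of_int_eq of_real_numeral)
          then show False using False sin_2pi_half_int[of n] by (simp only:)
        qed
        have cu: "of_real x - of_int n / 2 = complex_of_real u" by (simp add: u_def)
        \<comment> \<open>A shift by a half-integer changes sin(2\<pi> x) only by a sign. Hence the
          prefactor s can be read as sin(2\<pi> u), whose zero at u = 0 cancels the pole of the
          interpolation term.\<close>
        have ns: "norm s = norm (sin (complex_of_real (2 * pi * u)))"
        proof -
          have eq: "complex_of_real (2 * pi * u) = 2 * of_real pi * of_real x - 2 * of_real pi * (of_int n / 2)"
            by (simp add: u_def algebra_simps)
          show ?thesis unfolding eq sin_diff sin_2pi_half_int cos_2pi_half_int s_def by (simp add: norm_mult)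
        qed
        have "norm (s * T n) = norm (S (of_int n / 2)) * norm (csinc (of_real (pi * u) / of_nat m) ^ m * sin (of_real (2 * pi * u)) / of_real (2 * pi * u))"
        proof -
          have "norm (of_int n / 2 - complex_of_real x) = \<bar>u\<bar>" using cu by (metis norm_minus_commute norm_of_real real_norm_def)
          then show ?thesis unfolding T_def norm_mult norm_divide ns cu
            by (simp add: norm_mult norm_power abs_mult mult_ac)
        qed
        then have "norm (s * T n) powr r = norm (S (of_int n / 2)) powr r * norm (csinc (of_real (pi * u) / of_nat m) ^ m * sin (of_real (2 * pi * u)) / of_real (2 * pi * u)) powr r"
          by (simp only: powr_mult)
        also have "\<dots> \<le> f (n div 2) * (A0 * poisson 1 u)"
          using Sn kernel[OF u0] f0 by (intro mult_mono) auto
        also have "\<dots> \<le> f (n div 2) * (A0 * (3 * poisson 1 (x - of_int (n div 2))))"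
          using near[of n] f0 A0 unfolding u_def by (intro mult_left_mono) auto
        finally show ?thesis by (simp add: mult_ac)
      qed
      note termle = this
      have "norm (\<Sum>n\<in>{-int N..int N}. s * T n) \<le> Y powr (1 / r)" for N
      proof -
        have "norm (\<Sum>n\<in>{-int N..int N}. s * T n) powr r \<le> (\<Sum>n\<in>{-int N..int N}. norm (s * T n) powr r)"
          by (rule norm_sum_powr_le[OF r])
        also have "\<dots> \<le> (\<Sum>n\<in>{-int N..int N}. f (n div 2) * (3 * A0 * poisson 1 (x - of_int (n div 2))))"
          by (intro sum_mono termle)
        also have "\<dots> \<le> (\<Sum>n\<in>(\<lambda>k. 2 * k) ` {-int N..int N} \<union> (\<lambda>k. 2 * k + 1) ` {-int N-1..int N}. f (n div 2) * (3 * A0 * poisson 1 (x - of_int (n div 2))))"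
        proof (intro sum_mono2)
          show "{-int N..int N} \<subseteq> (\<lambda>k. 2 * k) ` {-int N..int N} \<union> (\<lambda>k. 2 * k + 1) ` {-int N-1..int N}"
          proof
            fix n assume n: "n \<in> {-int N..int N}"
            show "n \<in> (\<lambda>k. 2 * k) ` {-int N..int N} \<union> (\<lambda>k. 2 * k + 1) ` {-int N-1..int N}"
            proof (cases "even n")
              case True
              then have "n = 2 * (n div 2)" "n div 2 \<in> {-int N..int N}" using n by auto
              then show ?thesis by blast
            next
              case False
              then have "n = 2 * (n div 2) + 1" "n div 2 \<in> {-int N-1..int N}" using n by auto
              then show ?thesis by blast
            qed
          qed
        qed (use f0 A0 in auto)
        also have "\<dots> = (\<Sum>n\<in>(\<lambda>k. 2 * k) ` {-int N..int N}. f (n div 2) * (3 * A0 * poisson 1 (x - of_int (n div 2)))) +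
            (\<Sum>n\<in>(\<lambda>k. 2 * k + 1) ` {-int N-1..int N}. f (n div 2) * (3 * A0 * poisson 1 (x - of_int (n div 2))))"
        proof (rule sum.union_disjoint)
          have "2 * a \<noteq> 2 * b + 1" for a b :: int by presburger
          then show "(\<lambda>k. 2 * k) ` {-int N..int N} \<inter> (\<lambda>k. 2 * k + 1) ` {-int N-1..int N} = {}" by blast
        qed auto
        also have "\<dots> = 3 * A0 * (\<Sum>k\<in>{-int N..int N}. f k * poisson 1 (x - of_int k)) +
            3 * A0 * (\<Sum>k\<in>{-int N-1..int N}. f k * poisson 1 (x - of_int k))"
          by (subst (1 2) sum.reindex) (auto simp: inj_on_def sum_distrib_left mult_ac)
        also have "\<dots> \<le> 3 * A0 * ((\<Sum>k\<in>M. f k * poisson 1 (x - of_int k)) + 24 * e) +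
            3 * A0 * ((\<Sum>k\<in>M. f k * poisson 1 (x - of_int k)) + 24 * e)"
          using A0 by (intro add_mono mult_left_mono total) auto
        also have "\<dots> = Y" by (simp add: Y_def)
        finally have "(norm (\<Sum>n\<in>{-int N..int N}. s * T n) powr r) powr (1 / r) \<le> Y powr (1 / r)"
          using r by (intro powr_mono2) auto
        then show ?thesis using r by (simp add: powr_powr)
      qed
      then have "norm (S (of_real x)) \<le> Y powr (1 / r)"
        by (intro LIMSEQ_le_const2[OF lim]) auto
      then have "norm (S (of_real x)) powr r \<le> (Y powr (1 / r)) powr r"
        using r by (intro powr_mono2) auto
      then show ?thesis using r Y0 by (simp add: powr_powr)
    qed
    also have "Y \<le> A * ((\<Sum>k\<in>M. f k * poisson 1 (x - of_int k)) + e)"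
    proof -
      have "(\<Sum>k\<in>M. f k * poisson 1 (x - of_int k)) + 24 * e \<le> 24 * ((\<Sum>k\<in>M. f k * poisson 1 (x - of_int k)) + e)"
        using pos by simp
      then have "Y \<le> 6 * A0 * (24 * ((\<Sum>k\<in>M. f k * poisson 1 (x - of_int k)) + e))"
        unfolding Y_def using A0 by (intro mult_left_mono) auto
      then show ?thesis by (simp add: A_def algebra_simps)
    qed
    finally show ?thesis .
  qed
  note main = this
  have "A > 0" using A0 by (simp add: A_def)
  then show ?thesis
  proof (intro exI[of _ A] conjI allI impI)
    fix S D f M e x
    assume "S holomorphic_on UNIV" "\<forall>w. norm (S w) \<le> D * exp (pi * \<bar>Im w\<bar>)"
      "\<forall>k. norm (S (of_int k)) powr r \<le> f k" "\<forall>k. norm (S (of_int k + 1/2)) powr r \<le> f k"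
      "finite M" "\<forall>k. k \<notin> M \<longrightarrow> f k \<le> e" "e \<ge> 0"
    then show "norm (S (of_real x)) powr r \<le> A * ((\<Sum>k\<in>M. f k * poisson 1 (x - of_int k)) + e)"
      by (intro main[where S = S and D = D and f = f and M = M and e = e and x = x]) auto
  qed
qed

subsection \<open>Cauchy transforms of sequences\<close>

definition cauchy_sum :: "int set \<Rightarrow> (int \<Rightarrow> complex) \<Rightarrow> complex \<Rightarrow> complex" where
  "cauchy_sum B b z = (\<Sum>i\<in>B. b i / (z - of_int i))"

lemma sin_pi_diff_int:
  "sin (of_real pi * (z - of_int i)) = (if even i then 1 else -1) * sin (of_real pi * (z::complex))"
proof -
  have eq: "complex_of_real pi * of_int i = of_real (pi * of_int i)" by simp
  have sc: "sin (of_real pi * of_int i :: complex) = 0"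
       "cos (of_real pi * of_int i :: complex) = (if even i then 1 else -1)"
    unfolding eq sin_of_real cos_of_real by simp_all
  show ?thesis unfolding right_diff_distrib sin_diff sc by simp
qed

text \<open>On Re z = n + 1/2 the cosine of twice the real part is -1, so |sin(\<pi> z)| =
  cosh(\<pi> t). This permits the return from \<open>paley_wiener\<close> to the Cauchy sum.\<close>

lemma norm_sin_pi_half_line:
  "norm (sin (of_real pi * (of_int n + 1/2 + \<i> * of_real t))) \<ge> exp (pi * \<bar>t\<bar>) / 2"
proof -
  define z where "z = complex_of_real pi * (of_int n + 1/2 + \<i> * of_real t)"
  have "Re z = pi * of_int n + pi / 2" "Im z = pi * t" by (simp_all add: z_def algebra_simps)
  then have "cos (2 * Re z) = cos (pi * of_int (2 * n) + pi)" by (simp add: algebra_simps)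
  also have "\<dots> = -1" unfolding cos_periodic_pi cos_npi_int by simp
  finally have c: "cos (2 * Re z) = -1" .
  have "exp (2 * Im z) + inverse (exp (2 * Im z)) \<ge> exp (2 * (pi * \<bar>t\<bar>))"
    using \<open>Im z = pi * t\<close> by (cases "t \<ge> 0") (auto simp: exp_minus[symmetric])
  then have "(norm (sin z))\<^sup>2 \<ge> exp (2 * (pi * \<bar>t\<bar>)) / 4" unfolding norm_sin_squared c by simp
  then have "(exp (pi * \<bar>t\<bar>) / 2)\<^sup>2 \<le> (norm (sin z))\<^sup>2" by (simp add: power_divide exp_double [symmetric])
  then show ?thesis unfolding z_def [symmetric] by (rule power2_le_imp_le) simp
qed

text \<open>The product of the Cauchy transform with \<open>sin (\<pi> z)\<close> is entire of exponential type \<open>\<pi>\<close>,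
  its values at \<open>\<int>\<close> and at \<open>\<int> + 1/2\<close> are given by the sequence and by its discrete Hilbert transform.\<close>

definition paley_wiener :: "int set \<Rightarrow> (int \<Rightarrow> complex) \<Rightarrow> complex \<Rightarrow> complex" where
  "paley_wiener B b z = (\<Sum>i\<in>B. b i * ((if even i then 1 else -1) * of_real pi * csinc (of_real pi * (z - of_int i))))"

lemma holomorphic_paley_wiener: "paley_wiener B b holomorphic_on UNIV"
  unfolding paley_wiener_def by (intro holomorphic_intros)

lemma norm_paley_wiener_le:
  "norm (paley_wiener B b z) \<le> (\<Sum>i\<in>B. norm (b i) * pi) * exp (pi * \<bar>Im z\<bar>)"
proof -
  have "norm (paley_wiener B b z) \<le> (\<Sum>i\<in>B. norm (b i) * pi * exp (pi * \<bar>Im z\<bar>))"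
    unfolding paley_wiener_def
  proof (rule sum_norm_le)
    fix i
    have "norm (csinc (of_real pi * (z - of_int i))) \<le> exp (pi * \<bar>Im z\<bar>)"
      using norm_csinc_le[of "of_real pi * (z - of_int i)"] by (simp add: abs_mult)
    then show "norm (b i * ((if even i then 1 else -1) * of_real pi * csinc (of_real pi * (z - of_int i)))) \<le> norm (b i) * pi * exp (pi * \<bar>Im z\<bar>)"
      by (simp add: norm_mult mult.assoc mult_left_mono)
  qed
  then show ?thesis by (simp add: sum_distrib_right)
qed

text \<open>This feeds the decay hypothesis of the maximum principle: multiplication by exp(i \<pi>
  z) removes the exponential in the upper half-plane, and the finite sum tends to 0 at
  infinity.\<close>

lemma norm_paley_wiener_decay:
  assumes "\<And>i. i \<in> B \<Longrightarrow> z \<noteq> of_int i"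
  shows "norm (paley_wiener B b z) \<le> (\<Sum>i\<in>B. norm (b i) / norm (z - of_int i)) * exp (pi * \<bar>Im z\<bar>)"
proof -
  have "norm (paley_wiener B b z) \<le> (\<Sum>i\<in>B. norm (b i) / norm (z - of_int i) * exp (pi * \<bar>Im z\<bar>))"
    unfolding paley_wiener_def
  proof (rule sum_norm_le)
    fix i assume "i \<in> B"
    then have nz: "of_real pi * (z - of_int i) \<noteq> 0" using assms by simp
    have "norm (csinc (of_real pi * (z - of_int i))) \<le> exp (pi * \<bar>Im z\<bar>) / (pi * norm (z - of_int i))"
      using norm_csinc_le_divide[OF nz] by (simp add: abs_mult norm_mult)
    then have "norm (b i) * (pi * norm (csinc (of_real pi * (z - of_int i)))) \<le> norm (b i) * (pi * (exp (pi * \<bar>Im z\<bar>) / (pi * norm (z - of_int i))))"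
      by (intro mult_left_mono) auto
    then show "norm (b i * ((if even i then 1 else -1) * of_real pi * csinc (of_real pi * (z - of_int i)))) \<le> norm (b i) / norm (z - of_int i) * exp (pi * \<bar>Im z\<bar>)"
      by (simp add: norm_mult)
  qed
  then show ?thesis by (simp add: sum_distrib_right)
qed

lemma paley_wiener_eq:
  assumes "\<And>i::int. z \<noteq> of_int i"
  shows "paley_wiener B b z = sin (of_real pi * z) * cauchy_sum B b z"
  unfolding paley_wiener_def cauchy_sum_def sum_distrib_left
proof (rule sum.cong)
  fix i
  have nz: "z - of_int i \<noteq> 0" using assms by simp
  have "(if even i then 1 else -1) * of_real pi * csinc (of_real pi * (z - of_int i)) = sin (of_real pi * z) / (z - of_int i)"
    using nz by (simp add: csinc_def sin_pi_diff_int)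
  then show "b i * ((if even i then 1 else -1) * of_real pi * csinc (of_real pi * (z - of_int i))) = sin (of_real pi * z) * (b i / (z - of_int i))"
    by (simp only:) simp
qed simp

lemma paley_wiener_int:
  assumes "finite B"
  shows "norm (paley_wiener B b (of_int k)) = (if k \<in> B then pi * norm (b k) else 0)"
proof -
  have "csinc (of_real pi * (of_int k - of_int i)) = (if i = k then 1 else 0)" for i
  proof (cases "i = k")
    case False
    then have "complex_of_real pi * (of_int k - of_int i) \<noteq> 0" by simp
    moreover have "sin (complex_of_real pi * (of_int k - of_int i)) = of_real (sin (pi * of_int (k - i)))"
      unfolding sin_of_real [symmetric] by simp
    moreover have "sin (pi * of_int (k - i)) = 0" by (rule sin_npi_int)
    ultimately show ?thesis using False by (simp only: csinc_def if_False of_real_0 div_0)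
  qed simp
  then have "paley_wiener B b (of_int k) = (\<Sum>i\<in>B. if i = k then b i * ((if even i then 1 else -1) * of_real pi) else 0)"
    unfolding paley_wiener_def by (intro sum.cong) auto
  also have "\<dots> = (if k \<in> B then b k * ((if even k then 1 else -1) * of_real pi) else 0)"
    using assms by simp
  finally show ?thesis by (simp add: norm_mult)
qed

lemma half_line_neq_int: "of_int n + 1/2 + \<i> * of_real t \<noteq> (of_int i :: complex)"
proof
  assume "of_int n + 1/2 + \<i> * of_real t = (of_int i :: complex)"
  then have "Re (of_int n + 1/2 + \<i> * of_real t) = Re (of_int i)" by (simp only:)
  then have "real_of_int (2 * n + 1) = real_of_int (2 * i)" by simp
  then show False by (simp only: of_int_eq_iff) presburger
qed

text \<open>The interpolation bound on the real line is carried upwards by the maximum principle,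
  and at a half-integer abscissa the sine is divided out again. Finiteness of B secures the decay at
  infinity, while f may be any majorant of the data, so that it can later come from the full
  sequence. In the constant 24, a factor 4 bounds \<pi>^r, a factor 2 comes from dividing out the
  sine, and a factor 3 from shifting n + 1/2 to n.\<close>

lemma cauchy_sum_upper_le:
  fixes r :: real
  assumes r: "0 < r" "r \<le> 1"
  shows "\<exists>A>0. \<forall>B b f M e n t. finite B \<longrightarrow> (\<forall>k\<in>B. norm (b k) powr r \<le> f k) \<longrightarrow>
      (\<forall>k. norm (cauchy_sum B b (of_int k + 1/2)) powr r \<le> f k) \<longrightarrow>
      finite M \<longrightarrow> (\<forall>k. k \<notin> M \<longrightarrow> f k \<le> e) \<longrightarrow> e \<ge> 0 \<longrightarrow> t \<ge> 0 \<longrightarrow>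
      norm (cauchy_sum B b (of_int n + 1/2 + \<i> * of_real t)) powr r \<le> A * (poisson_sum f M (1 + t) n + e)"
proof -
  obtain A1 where A1: "A1 > 0 \<and> (\<forall>S D f M e x. S holomorphic_on UNIV \<longrightarrow> (\<forall>w. norm (S w) \<le> D * exp (pi * \<bar>Im w\<bar>)) \<longrightarrow>
      (\<forall>k. norm (S (of_int k)) powr r \<le> f k) \<longrightarrow> (\<forall>k. norm (S (of_int k + 1/2)) powr r \<le> f k) \<longrightarrow>
      finite M \<longrightarrow> (\<forall>k. k \<notin> M \<longrightarrow> f k \<le> e) \<longrightarrow> e \<ge> 0 \<longrightarrow>
      norm (S (of_real x)) powr r \<le> A1 * ((\<Sum>k\<in>M. f k * poisson 1 (x - of_int k)) + e))"
    using exponential_type_powr_le_poisson[OF r] ..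
  then have A1_pos: "A1 > 0" by (rule conjunct1)
  define A where "A = 24 * A1"
  have "norm (cauchy_sum B b (of_int n + 1/2 + \<i> * of_real t)) powr r \<le> A * (poisson_sum f M (1 + t) n + e)"
    if B: "finite B" and f: "\<And>k. k \<in> B \<Longrightarrow> norm (b k) powr r \<le> f k"
      "\<And>k. norm (cauchy_sum B b (of_int k + 1/2)) powr r \<le> f k"
      and M: "finite M" "\<And>k. k \<notin> M \<Longrightarrow> f k \<le> e" and e: "e \<ge> 0" and t: "t \<ge> 0"
    for B b f M e n t
  proof -
    have f0: "f k \<ge> 0" for k using f(2)[of k] by (meson order_trans powr_ge_zero)
    define S where "S = paley_wiener B b"
    define D where "D = (\<Sum>i\<in>B. norm (b i) * pi)"
    have S: "S holomorphic_on UNIV" "\<And>w. norm (S w) \<le> D * exp (pi * \<bar>Im w\<bar>)"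
      unfolding S_def D_def by (rule holomorphic_paley_wiener, rule norm_paley_wiener_le)
    have S_int: "norm (S (of_int k)) powr r \<le> 4 * f k" for k
    proof (cases "k \<in> B")
      case True
      have "pi powr r \<le> pi powr 1" using r pi_ge_two by (intro powr_mono) auto
      then have pr: "pi powr r \<le> 4" using pi_less_4 by simp
      have "norm (S (of_int k)) powr r = pi powr r * norm (b k) powr r"
        using True B by (simp add: S_def paley_wiener_int powr_mult)
      also have "\<dots> \<le> 4 * f k" using f(1)[OF True] pr by (intro mult_mono) auto
      finally show ?thesis .
    next
      case False
      then show ?thesis using f0 r B by (simp add: S_def paley_wiener_int)
    qed
    have S_half: "norm (S (of_int k + 1/2)) powr r \<le> 4 * f k" for k
    proof -
      have eq: "S (of_int k + 1/2) = sin (of_real pi * (of_int k + 1/2)) * cauchy_sum B b (of_int k + 1/2)"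
        unfolding S_def using half_line_neq_int[of k 0] by (intro paley_wiener_eq) simp
      have "complex_of_real pi * (of_int k + 1/2) = of_real (pi * (of_int k + 1/2))" by simp
      then have "norm (sin (complex_of_real pi * (of_int k + 1/2))) \<le> 1"
        by (simp only: sin_of_real norm_of_real abs_sin_le_one)
      then have "norm (S (of_int k + 1/2)) \<le> 1 * norm (cauchy_sum B b (of_int k + 1/2))"
        unfolding eq norm_mult by (intro mult_right_mono) auto
      then have "norm (S (of_int k + 1/2)) powr r \<le> norm (cauchy_sum B b (of_int k + 1/2)) powr r"
        using r by (intro powr_mono2) auto
      then show ?thesis using f(2)[of k] f0[of k] by linarith
    qed
    \<comment> \<open>The exponential has modulus exp(-\<pi> Im z): it cancels the growth of S in
      the upper half-plane and leaves |S| unchanged on the real line.\<close>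
    define F where "F = (\<lambda>z. S z * exp (\<i> * of_real pi * z))"
    have normF: "norm (F z) = norm (S z) * exp (- pi * Im z)" for z
      by (simp add: F_def norm_mult)
    \<comment> \<open>The real part of i/(z + i - k) is the Poisson kernel of height 1 + Im z
      centred at k. The shift by i matches the height 1 of the boundary estimate and makes h
      holomorphic beyond the closed half-plane.\<close>
    define h where "h = (\<lambda>z. of_real (4 * A1) * ((\<Sum>k\<in>M. of_real (f k) * (\<i> / (z + \<i> - of_int k))) + of_real e))"
    have Re_h: "Re (h z) = 4 * A1 * ((\<Sum>k\<in>M. f k * poisson (1 + Im z) (Re z - of_int k)) + e)" for z
    proof -
      have "Re (\<i> / (z + \<i> - of_int k)) = poisson (1 + Im z) (Re z - of_int k)" for k
        by (simp add: poisson_def Re_divide add.commute cmod_power2 power2_eq_square)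
      moreover have "Re (of_real x * w) = x * Re w" for x w by simp
      ultimately show ?thesis unfolding h_def by (simp only: Re_sum plus_complex.sel Re_complex_of_real)
    qed
    have main: "norm (F z) powr r \<le> Re (h z)" if z: "Im z \<ge> 0" for z
    proof (rule norm_powr_le_Re_upper_half_plane[of F h r])
      show "F holomorphic_on UNIV" unfolding F_def using S(1) by (intro holomorphic_intros)
      show "h holomorphic_on {z. - 1 < Im z}" unfolding h_def
        by (intro holomorphic_intros) (auto simp: complex_eq_iff)
      show "0 \<le> Re (h z)" if "0 \<le> Im z" for z
        unfolding Re_h using A1_pos f0 e that by (intro mult_nonneg_nonneg add_nonneg_nonneg sum_nonneg) auto
      show "norm (F (of_real x)) powr r \<le> Re (h (of_real x))" for x
      proof -
        have "norm (S (of_real x)) powr r \<le> A1 * ((\<Sum>k\<in>M. (4 * f k) * poisson 1 (x - of_int k)) + 4 * e)"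
          using conjunct2[OF A1, rule_format, OF S S_int S_half M(1), of "4 * e" x] M(2) e by auto
        then show ?thesis unfolding Re_h normF by (simp add: sum_distrib_left algebra_simps)
      qed
      show "\<exists>R. \<forall>z. 0 \<le> Im z \<longrightarrow> R \<le> norm z \<longrightarrow> norm (F z) < d" if d: "d > 0" for d
      proof -
        have "filterlim (\<lambda>z::complex. norm (z - of_int i)) at_top at_infinity" for i :: int
        proof (rule filterlim_at_infinity_imp_norm_at_top)
          show "filterlim (\<lambda>z. z - of_int i) at_infinity (at_infinity :: complex filter)"
            using tendsto_add_filterlim_at_infinity'[OF filterlim_ident tendsto_const, of "- of_int i :: complex"] by simp
        qed
        then have "((\<lambda>z::complex. \<Sum>i\<in>B. norm (b i) / norm (z - of_int i)) \<longlongrightarrow> (\<Sum>i\<in>B. 0)) at_infinity"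
          by (intro tendsto_sum real_tendsto_divide_at_top[OF tendsto_const])
        then have "eventually (\<lambda>z::complex. (\<Sum>i\<in>B. norm (b i) / norm (z - of_int i)) < d) at_infinity"
          using d by (intro order_tendstoD(2)) auto
        moreover have "eventually (\<lambda>z::complex. \<forall>i\<in>B. z \<noteq> of_int i) at_infinity"
        proof (rule eventually_ball_finite[OF B], rule ballI)
          fix i
          show "\<forall>\<^sub>F z in at_infinity. z \<noteq> complex_of_int i"
            unfolding eventually_at_infinity by (intro exI[of _ "norm (complex_of_int i) + 1"]) auto
        qed
        ultimately have "eventually (\<lambda>z. 0 \<le> Im z \<longrightarrow> norm (F z) < d) at_infinity"
        proof eventually_elim
          case (elim z)
          show ?case
          proof
            assume z: "0 \<le> Im z"
            have "norm (F z) \<le> ((\<Sum>i\<in>B. norm (b i) / norm (z - of_int i)) * exp (pi * \<bar>Im z\<bar>)) * exp (- pi * Im z)"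
              unfolding normF S_def using elim by (intro mult_right_mono norm_paley_wiener_decay) auto
            also have "\<dots> = (\<Sum>i\<in>B. norm (b i) / norm (z - of_int i))"
              using z by (simp add: mult.assoc flip: exp_add)
            finally show "norm (F z) < d" using elim by simp
          qed
        qed
        then show ?thesis unfolding eventually_at_infinity by blast
      qed
    qed (use r z in auto)
    define z where "z = of_int n + 1/2 + \<i> * of_real t"
    have Imz: "Im z = t" and Rez: "Re z = of_int n + 1/2" by (simp_all add: z_def)
    have Sz: "S z = sin (of_real pi * z) * cauchy_sum B b z"
      unfolding S_def z_def by (rule paley_wiener_eq[OF half_line_neq_int])
    have "norm (cauchy_sum B b z) * (exp (pi * t) / 2) \<le> norm (cauchy_sum B b z) * norm (sin (of_real pi * z))"
      unfolding z_def using norm_sin_pi_half_line[of t n] t by (intro mult_left_mono) auto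
    also have "\<dots> = norm (S z)" by (simp add: Sz norm_mult mult.commute)
    finally have "norm (cauchy_sum B b z) * (exp (pi * t) / 2) \<le> norm (S z)" .
    then have "norm (cauchy_sum B b z) \<le> norm (S z) / (exp (pi * t) / 2)" by (subst pos_le_divide_eq) auto
    also have "\<dots> = 2 * (norm (S z) / exp (pi * t))" by simp
    also have "norm (S z) / exp (pi * t) = norm (F z)" by (simp add: normF Imz exp_minus divide_inverse)
    finally have "norm (cauchy_sum B b z) \<le> 2 * norm (F z)" .
    then have "norm (cauchy_sum B b z) powr r \<le> (2 * norm (F z)) powr r" using r by (intro powr_mono2) auto
    also have "\<dots> = 2 powr r * norm (F z) powr r" by (simp add: powr_mult)
    also have "\<dots> \<le> 2 powr 1 * Re (h z)"
      using main[of z] r t Imz by (intro mult_mono powr_mono) auto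
    also have "\<dots> = 8 * A1 * ((\<Sum>k\<in>M. f k * poisson (1 + t) (of_int n + 1/2 - of_int k)) + e)"
      by (simp add: Re_h Imz Rez)
    also have "\<dots> \<le> 8 * A1 * (3 * (poisson_sum f M (1 + t) n + e))"
    proof (intro mult_left_mono)
      have "(\<Sum>k\<in>M. f k * poisson (1 + t) (of_int n + 1/2 - of_int k)) \<le> (\<Sum>k\<in>M. f k * (3 * poisson (1 + t) (of_int (n - k))))"
        using f0 t by (intro sum_mono mult_left_mono poisson_shift_le) auto
      also have "\<dots> = 3 * poisson_sum f M (1 + t) n" by (simp add: poisson_sum_def sum_distrib_left mult_ac)
      finally show "(\<Sum>k\<in>M. f k * poisson (1 + t) (of_int n + 1/2 - of_int k)) + e \<le> 3 * (poisson_sum f M (1 + t) n + e)"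
        using e by simp
    qed (use A1_pos in auto)
    finally show ?thesis by (simp add: A_def z_def algebra_simps)
  qed
  note main = this
  have "A > 0" using A1_pos by (simp add: A_def)
  then show ?thesis
  proof (intro exI[of _ A] conjI allI impI)
    fix B b f M e n and t :: real
    assume "finite B" "\<forall>k\<in>B. norm (b k) powr r \<le> f k"
      "\<forall>k. norm (cauchy_sum B b (of_int k + 1/2)) powr r \<le> f k"
      "finite M" "\<forall>k. k \<notin> M \<longrightarrow> f k \<le> e" "e \<ge> 0" "t \<ge> 0"
    then show "norm (cauchy_sum B b (of_int n + 1/2 + \<i> * of_real t)) powr r \<le> A * (poisson_sum f M (1 + t) n + e)"
      by (intro main[where B = B and b = b and f = f and M = M and e = e and n = n and t = t]) auto
  qed
qed

lemma cnj_cauchy_sum: "cnj (cauchy_sum B b z) = cauchy_sum B (\<lambda>i. cnj (b i)) (cnj z)"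
  by (simp add: cauchy_sum_def)

text \<open>Negative t reduces to positive t by conjugating the coefficients. This conjugates the
  Cauchy sum across the real axis and preserves all hypotheses, as the points k + 1/2 are
  real.\<close>

lemma cauchy_sum_le:
  fixes r :: real
  assumes r: "0 < r" "r \<le> 1"
  shows "\<exists>A>0. \<forall>B b f M e n t. finite B \<longrightarrow> (\<forall>k\<in>B. norm (b k) powr r \<le> f k) \<longrightarrow>
      (\<forall>k. norm (cauchy_sum B b (of_int k + 1/2)) powr r \<le> f k) \<longrightarrow>
      finite M \<longrightarrow> (\<forall>k. k \<notin> M \<longrightarrow> f k \<le> e) \<longrightarrow> e \<ge> 0 \<longrightarrow>
      norm (cauchy_sum B b (of_int n + 1/2 + \<i> * of_real t)) powr r \<le> A * (poisson_sum f M (1 + \<bar>t\<bar>) n + e)"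
proof -
  obtain A where A: "A > 0 \<and> (\<forall>B b f M e n t. finite B \<longrightarrow> (\<forall>k\<in>B. norm (b k) powr r \<le> f k) \<longrightarrow>
      (\<forall>k. norm (cauchy_sum B b (of_int k + 1/2)) powr r \<le> f k) \<longrightarrow>
      finite M \<longrightarrow> (\<forall>k. k \<notin> M \<longrightarrow> f k \<le> e) \<longrightarrow> e \<ge> 0 \<longrightarrow> t \<ge> 0 \<longrightarrow>
      norm (cauchy_sum B b (of_int n + 1/2 + \<i> * of_real t)) powr r \<le> A * (poisson_sum f M (1 + t) n + e))"
    using cauchy_sum_upper_le[OF r] ..
  show ?thesis
  proof (intro exI[of _ A] conjI allI impI)
    show "A > 0" using A by (rule conjunct1)
    fix B b f M e n and t :: real
    assume *: "finite B" "\<forall>k\<in>B. norm (b k) powr r \<le> f k"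
      "\<forall>k. norm (cauchy_sum B b (of_int k + 1/2)) powr r \<le> f k"
      "finite M" "\<forall>k. k \<notin> M \<longrightarrow> f k \<le> e" "e \<ge> 0"
    show "norm (cauchy_sum B b (of_int n + 1/2 + \<i> * of_real t)) powr r \<le> A * (poisson_sum f M (1 + \<bar>t\<bar>) n + e)"
    proof (cases "t \<ge> 0")
      case True
      then show ?thesis using conjunct2[OF A, rule_format, of B b f M e t n] * by simp
    next
      case False
      have norm_cnj: "norm (cauchy_sum B (\<lambda>i. cnj (b i)) z) = norm (cauchy_sum B b (cnj z))" for z
        using cnj_cauchy_sum[of B b "cnj z"] by (metis complex_cnj_cnj complex_mod_cnj)
      have "norm (cauchy_sum B (\<lambda>i. cnj (b i)) (of_int n + 1/2 + \<i> * of_real (-t))) powr r \<le> A * (poisson_sum f M (1 + (-t)) n + e)"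
        using * False by (intro conjunct2[OF A, rule_format]) (auto simp: norm_cnj)
      then show ?thesis using False by (simp add: norm_cnj)
    qed
  qed
qed

section \<open>From finite Cauchy sums to summable sequences\<close>

definition cauchy_transform :: "(int \<Rightarrow> complex) \<Rightarrow> complex \<Rightarrow> complex" where
  "cauchy_transform b z = (\<Sum>\<^sub>\<infinity>i. b i / (z - of_int i))"

lemma infsum_tail_less:
  fixes g :: "'a \<Rightarrow> real"
  assumes g: "g summable_on UNIV" "\<And>i. g i \<ge> 0" and d: "d > 0" and A: "finite A"
  obtains B where "finite B" "A \<subseteq> B" "infsum g (- B) < d"
proof -
  have "(sum g \<longlongrightarrow> infsum g UNIV) (finite_subsets_at_top UNIV)"
    by (rule infsum_tendsto[OF g(1)])
  then have "eventually (\<lambda>B. sum g B > infsum g UNIV - d) (finite_subsets_at_top UNIV)"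
    using d by (intro order_tendstoD(1)) auto
  then obtain B0 where B0: "finite B0" "\<And>B. finite B \<Longrightarrow> B0 \<subseteq> B \<Longrightarrow> sum g B > infsum g UNIV - d"
    unfolding eventually_finite_subsets_at_top by auto
  define B where "B = A \<union> B0"
  have B: "finite B" using A B0 by (simp add: B_def)
  have "infsum g (B \<union> (- B)) = infsum g B + infsum g (- B)"
    by (intro infsum_Un_disjoint summable_on_subset_banach[OF g(1)]) auto
  then have "infsum g UNIV = sum g B + infsum g (- B)"
    using B by simp
  then have "infsum g (- B) < d" using B0(2)[of B] B by (simp add: B_def)
  moreover have "A \<subseteq> B" by (simp add: B_def)
  ultimately show ?thesis by (intro that[OF B])
qed

lemma norm_half_line_diff_ge:
  "(1 + \<bar>t\<bar>) / 4 \<le> norm (of_int n + 1/2 + \<i> * of_real t - (of_int i :: complex))"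
proof -
  define z where "z = of_int n + 1/2 + \<i> * of_real t - (of_int i :: complex)"
  have "Re z = real_of_int (2 * (n - i) + 1) / 2" "Im z = t" by (simp_all add: z_def field_simps)
  moreover have "\<bar>2 * (n - i) + 1\<bar> \<ge> 1" by presburger
  then have "\<bar>real_of_int (2 * (n - i) + 1)\<bar> \<ge> 1" by linarith
  ultimately have "\<bar>Re z\<bar> \<ge> 1/2" by simp
  then have "norm z \<ge> 1/2" "norm z \<ge> \<bar>t\<bar>"
    using abs_Re_le_cmod[of z] abs_Im_le_cmod[of z] \<open>Im z = t\<close> by auto
  moreover have "(1 + a) / 4 \<le> c" if "1/2 \<le> c" "a \<le> c" for a c :: real using that by simp
  ultimately have "norm z \<ge> (1 + \<bar>t\<bar>) / 4" by blast
  then show ?thesis by (simp add: z_def)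
qed

lemma norm_cauchy_term_le:
  "norm (b i / (of_int n + 1/2 + \<i> * of_real t - of_int i)) \<le> norm (b i) * (4 / (1 + \<bar>t\<bar>))"
proof -
  have "norm (b i / (of_int n + 1/2 + \<i> * of_real t - of_int i)) \<le> norm (b i) / ((1 + \<bar>t\<bar>) / 4)"
    unfolding norm_divide by (intro divide_left_mono norm_half_line_diff_ge) (auto intro!: mult_pos_pos simp: half_line_neq_int)
  then show ?thesis by simp
qed

lemma cauchy_transform_summable:
  assumes "(\<lambda>i. norm (b i)) summable_on UNIV"
  shows "(\<lambda>i. norm (b i / (of_int n + 1/2 + \<i> * of_real t - of_int i))) summable_on A"
proof (rule summable_on_comparison_test)
  show "(\<lambda>i. norm (b i) * (4 / (1 + \<bar>t\<bar>))) summable_on A"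
    by (intro summable_on_cmult_left summable_on_subset_banach[OF assms]) auto
qed (rule norm_cauchy_term_le, simp)

text \<open>The gain 1/(1+|t|) is essential for \<open>norm_T_op_le\<close>: against the dyadic
  weights, which need not be summable over k, a truncation error merely bounded in t would be
  useless.\<close>

lemma norm_cauchy_diff_le:
  assumes b: "(\<lambda>i. norm (b i)) summable_on UNIV" and B: "finite B"
  shows "norm (cauchy_transform b (of_int n + 1/2 + \<i> * of_real t) - cauchy_sum B b (of_int n + 1/2 + \<i> * of_real t))
     \<le> 4 * (\<Sum>\<^sub>\<infinity>i\<in>-B. norm (b i)) / (1 + \<bar>t\<bar>)"
proof -
  define z where "z = of_int n + 1/2 + \<i> * complex_of_real t"
  have sm: "(\<lambda>i. norm (b i / (z - of_int i))) summable_on A" for A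
    unfolding z_def by (rule cauchy_transform_summable[OF b])
  then have sm': "(\<lambda>i. b i / (z - of_int i)) summable_on A" for A
    by (rule abs_summable_summable)
  have "infsum (\<lambda>i. b i / (z - of_int i)) (B \<union> (- B)) = infsum (\<lambda>i. b i / (z - of_int i)) B + infsum (\<lambda>i. b i / (z - of_int i)) (- B)"
    by (intro infsum_Un_disjoint sm') auto
  then have "cauchy_transform b z - cauchy_sum B b z = infsum (\<lambda>i. b i / (z - of_int i)) (- B)"
    using B by (simp add: cauchy_transform_def cauchy_sum_def)
  also have "norm \<dots> \<le> (\<Sum>\<^sub>\<infinity>i\<in>-B. norm (b i / (z - of_int i)))"
    by (rule norm_infsum_bound[OF sm])
  also have "\<dots> \<le> (\<Sum>\<^sub>\<infinity>i\<in>-B. norm (b i) * (4 / (1 + \<bar>t\<bar>)))"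
    by (intro infsum_mono sm summable_on_cmult_left summable_on_subset_banach[OF b])
      (simp_all add: z_def norm_cauchy_term_le del: times_divide_eq_right)
  also have "\<dots> = (\<Sum>\<^sub>\<infinity>i\<in>-B. norm (b i)) * (4 / (1 + \<bar>t\<bar>))"
    by (intro infsum_cmult_left summable_on_subset_banach[OF b]) auto
  finally show ?thesis by (simp add: z_def mult.commute)
qed

lemma norm_cauchy_le:
  assumes b: "(\<lambda>i. norm (b i)) summable_on UNIV"
  shows "norm (cauchy_transform b (of_int n + 1/2 + \<i> * of_real t)) \<le> 4 * (\<Sum>\<^sub>\<infinity>i. norm (b i))"
proof -
  have "norm (cauchy_transform b (of_int n + 1/2 + \<i> * of_real t)) \<le> 4 * (\<Sum>\<^sub>\<infinity>i. norm (b i)) / (1 + \<bar>t\<bar>)"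
    using norm_cauchy_diff_le[OF b, of "{}" n t] by (simp add: cauchy_sum_def)
  also have "\<dots> \<le> 4 * (\<Sum>\<^sub>\<infinity>i. norm (b i)) / 1"
    by (intro divide_left_mono) (auto intro!: mult_nonneg_nonneg infsum_nonneg)
  finally show ?thesis by simp
qed

text \<open>A truncation B so large that the r-th power of the error is at most e1 on all
  half-integer lines has its data dominated by f + e1, where f belongs to the full sequence. Since f
  is square summable, it is at most e1 off a finite set M. The set M depends on e, which therefore
  remains in the conclusion.\<close>

lemma cauchy_transform_powr_le:
  fixes r :: real
  assumes r: "0 < r" "r \<le> 1"
  shows "\<exists>A>0. \<forall>b e. (\<lambda>i. norm (b i)) summable_on UNIV \<longrightarrow>
    (\<lambda>k. (norm (b k) powr r + norm (cauchy_transform b (of_int k + 1/2)) powr r)\<^sup>2) summable_on UNIV \<longrightarrow> e > 0 \<longrightarrow>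
    (\<exists>M. finite M \<and> (\<forall>n t. norm (cauchy_transform b (of_int n + 1/2 + \<i> * of_real t)) powr r
       \<le> A * poisson_sum (\<lambda>k. norm (b k) powr r + norm (cauchy_transform b (of_int k + 1/2)) powr r) M (1 + \<bar>t\<bar>) n + e))"
proof -
  obtain A where A: "A > 0 \<and> (\<forall>B b f M e n t. finite B \<longrightarrow> (\<forall>k\<in>B. norm (b k) powr r \<le> f k) \<longrightarrow>
      (\<forall>k. norm (cauchy_sum B b (of_int k + 1/2)) powr r \<le> f k) \<longrightarrow>
      finite M \<longrightarrow> (\<forall>k. k \<notin> M \<longrightarrow> f k \<le> e) \<longrightarrow> e \<ge> 0 \<longrightarrow>
      norm (cauchy_sum B b (of_int n + 1/2 + \<i> * of_real t)) powr r \<le> A * (poisson_sum f M (1 + \<bar>t\<bar>) n + e))"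
    using cauchy_sum_le[OF r] ..
  show ?thesis
  proof (intro exI[of _ A] conjI allI impI)
    show A0: "A > 0" using A by (rule conjunct1)
    fix b :: "int \<Rightarrow> complex" and e :: real
    assume b: "(\<lambda>i. norm (b i)) summable_on UNIV"
    define f where "f = (\<lambda>k. norm (b k) powr r + norm (cauchy_transform b (of_int k + 1/2)) powr r)"
    assume f2: "(\<lambda>k. (norm (b k) powr r + norm (cauchy_transform b (of_int k + 1/2)) powr r)\<^sup>2) summable_on UNIV" and e: "e > 0"
    \<comment> \<open>26 = 24 + 2: the constant e1 added to f on M meets Poisson mass at most 24,
      and off M the data are at most 2 e1. The final 1 accounts for returning from the truncation to
      the full transform.\<close>
    define e1 where "e1 = e / (26 * A + 1)"
    have e1: "e1 > 0" using e A0 by (simp add: e1_def)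
    have "(\<lambda>k. (f k)\<^sup>2) summable_on UNIV" using f2 by (simp add: f_def)
    then obtain M where M: "finite M" "infsum (\<lambda>k. (f k)\<^sup>2) (- M) < e1\<^sup>2"
      using infsum_tail_less[of "\<lambda>k. (f k)\<^sup>2" "e1\<^sup>2" "{}"] e1 by auto
    have fM: "f k \<le> e1" if "k \<notin> M" for k
    proof -
      have "sum (\<lambda>k. (f k)\<^sup>2) {k} \<le> infsum (\<lambda>k. (f k)\<^sup>2) (- M)"
        using that by (intro finite_sum_le_infsum summable_on_subset_banach[OF \<open>(\<lambda>k. (f k)\<^sup>2) summable_on UNIV\<close>]) auto
      then have "(f k)\<^sup>2 \<le> e1\<^sup>2" using M by simp
      then show ?thesis by (rule power2_le_imp_le) (use e1 in simp)
    qed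
    define \<tau>0 where "\<tau>0 = e1 powr (1 / r) / 4"
    have "\<tau>0 > 0" using e1 by (simp add: \<tau>0_def)
    then obtain B where B: "finite B" "(\<Sum>\<^sub>\<infinity>i\<in>-B. norm (b i)) < \<tau>0"
      using infsum_tail_less[OF b, of \<tau>0 "{}"] by auto
    have diff: "norm (cauchy_transform b (of_int n + 1/2 + \<i> * of_real t) - cauchy_sum B b (of_int n + 1/2 + \<i> * of_real t)) powr r \<le> e1" for n t
    proof -
      have "norm (cauchy_transform b (of_int n + 1/2 + \<i> * of_real t) - cauchy_sum B b (of_int n + 1/2 + \<i> * of_real t)) \<le> 4 * (\<Sum>\<^sub>\<infinity>i\<in>-B. norm (b i)) / (1 + \<bar>t\<bar>)"
        by (rule norm_cauchy_diff_le[OF b B(1)])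
      also have "\<dots> \<le> 4 * (\<Sum>\<^sub>\<infinity>i\<in>-B. norm (b i)) / 1"
        by (intro divide_left_mono) (auto intro!: mult_nonneg_nonneg infsum_nonneg)
      also have "\<dots> \<le> e1 powr (1 / r)" using B(2) by (simp add: \<tau>0_def)
      finally have "norm (cauchy_transform b (of_int n + 1/2 + \<i> * of_real t) - cauchy_sum B b (of_int n + 1/2 + \<i> * of_real t)) powr r \<le> (e1 powr (1 / r)) powr r"
        using r by (intro powr_mono2) auto
      then show ?thesis using r e1 by (simp add: powr_powr)
    qed
    define g where "g = (\<lambda>k. f k + e1)"
    have tri: "norm x powr r \<le> norm y powr r + norm (x - y) powr r" for x y :: complex
    proof -
      have "norm x powr r \<le> (norm y + norm (x - y)) powr r"
        using r norm_triangle_ineq[of y "x - y"] by (intro powr_mono2) auto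
      then show ?thesis using powr_add_le[of "norm y" "norm (x - y)" r] r by simp
    qed
    have "norm (cauchy_transform b (of_int n + 1/2 + \<i> * of_real t)) powr r \<le> A * poisson_sum f M (1 + \<bar>t\<bar>) n + e" for n t
    proof -
      have "norm (cauchy_sum B b (of_int n + 1/2 + \<i> * of_real t)) powr r \<le> A * (poisson_sum g M (1 + \<bar>t\<bar>) n + 2 * e1)"
      proof (rule conjunct2[OF A, rule_format])
        show "norm (cauchy_sum B b (of_int k + 1/2)) powr r \<le> g k" for k
        proof -
          have "norm (cauchy_sum B b (of_int k + 1/2)) powr r \<le> norm (cauchy_transform b (of_int k + 1/2)) powr r + e1"
            using tri[of "cauchy_sum B b (of_int k + 1/2)" "cauchy_transform b (of_int k + 1/2)"] diff[of k 0]
            by (simp add: norm_minus_commute)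
          then show ?thesis using powr_ge_zero[of "norm (b k)" r] unfolding g_def f_def by linarith
        qed
        show "norm (b k) powr r \<le> g k" for k using e1 powr_ge_zero[of "norm (cauchy_transform b (of_int k + 1/2))" r] unfolding g_def f_def by linarith
        show "g k \<le> 2 * e1" if "k \<notin> M" for k using fM[OF that] by (simp add: g_def)
      qed (use B M e1 in auto)
      also have "poisson_sum g M (1 + \<bar>t\<bar>) n = poisson_sum f M (1 + \<bar>t\<bar>) n + e1 * (\<Sum>k\<in>M. poisson (1 + \<bar>t\<bar>) (of_int n - of_int k))"
        by (simp add: poisson_sum_def g_def sum.distrib sum_distrib_left algebra_simps)
      also have "\<dots> \<le> poisson_sum f M (1 + \<bar>t\<bar>) n + e1 * 24"
        using e1 M by (intro add_left_mono mult_left_mono sum_poisson_real_le) auto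
      finally have "norm (cauchy_sum B b (of_int n + 1/2 + \<i> * of_real t)) powr r \<le> A * (poisson_sum f M (1 + \<bar>t\<bar>) n + 26 * e1)"
        using A0 by (simp add: add.commute)
      moreover have "norm (cauchy_transform b (of_int n + 1/2 + \<i> * of_real t)) powr r \<le> norm (cauchy_sum B b (of_int n + 1/2 + \<i> * of_real t)) powr r + e1"
        using tri[of "cauchy_transform b (of_int n + 1/2 + \<i> * of_real t)" "cauchy_sum B b (of_int n + 1/2 + \<i> * of_real t)"] diff[of n t] by simp
      ultimately have "norm (cauchy_transform b (of_int n + 1/2 + \<i> * of_real t)) powr r \<le> A * poisson_sum f M (1 + \<bar>t\<bar>) n + (26 * A + 1) * e1"
        by (simp add: algebra_simps)
      also have "(26 * A + 1) * e1 = e" using A0 by (simp add: e1_def)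
      finally show ?thesis .
    qed
    then show "\<exists>M. finite M \<and> (\<forall>n t. norm (cauchy_transform b (of_int n + 1/2 + \<i> * of_real t)) powr r
       \<le> A * poisson_sum (\<lambda>k. norm (b k) powr r + norm (cauchy_transform b (of_int k + 1/2)) powr r) M (1 + \<bar>t\<bar>) n + e)"
      using M(1) unfolding f_def by blast
  qed
qed

subsection \<open>Contour integrals against the branches of the kernel\<close>

text \<open>Heights of the form 2^k - 1 cut the line into the blocks 2^k \<le> 1 + |t| \<le>
  2^(k+1). Each block consists of two segments of length 2^k, one above and one below the axis,
  whence the factor 2.\<close>

lemma norm_contour_integral_vertical_le:
  assumes cont: "continuous_on {z. Re z = x} g"
    and Q: "\<And>k t. k < K \<Longrightarrow> 2 ^ k \<le> 1 + \<bar>t\<bar> \<Longrightarrow> 1 + \<bar>t\<bar> \<le> 2 ^ Suc k \<Longrightarrow> norm (g (Complex x t)) \<le> Q k"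
    and Q0: "\<And>k. Q k \<ge> 0"
  shows "norm (contour_integral (linepath (Complex x (-(2 ^ K - 1))) (Complex x (2 ^ K - 1))) g) \<le> 2 * (\<Sum>k<K. 2 ^ k * Q k)"
  using Q
proof (induction K)
  case 0
  show ?case
    by (simp only: power_0 diff_self minus_zero contour_integral_trivial norm_zero lessThan_0 sum.empty mult_zero_right order_refl)
next
  case (Suc K)
  have seg: "closed_segment (Complex x s) (Complex x t) = {z. Re z = x \<and> s \<le> Im z \<and> Im z \<le> t}" if "s \<le> t" for s t
    using that by (subst closed_segment_same_Re) (auto simp: closed_segment_eq_real_ivl)
  define R R' where "R = (2::real) ^ K - 1" and "R' = (2::real) ^ Suc K - 1"
  have R: "0 \<le> R" "R \<le> R'" "R' - R = 2 ^ K" by (auto simp: R_def R'_def)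
  have cont': "continuous_on (closed_segment (Complex x s) (Complex x t)) g" if "s \<le> t" for s t
    by (rule continuous_on_subset[OF cont]) (use that in \<open>auto simp: seg\<close>)
  let ?I = "\<lambda>s t. contour_integral (linepath (Complex x s) (Complex x t)) g"
  have "?I (-R') R' = ?I (-R') (-R) + ?I (-R) R'"
    using R by (intro contour_integral_split_linepath cont') (auto simp: seg)
  also have "?I (-R) R' = ?I (-R) R + ?I R R'"
    using R by (intro contour_integral_split_linepath cont') (auto simp: seg)
  finally have split: "?I (-R') R' = ?I (-R') (-R) + (?I (-R) R + ?I R R')" .
  have "norm (?I (-R) R) \<le> 2 * (\<Sum>k<K. 2 ^ k * Q k)"
    unfolding R_def using Suc.prems by (intro Suc.IH) auto
  moreover have outer: "norm (?I s t) \<le> Q K * 2 ^ K" if st: "(s = - R' \<and> t = - R) \<or> (s = R \<and> t = R')" for s t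
  proof (rule norm_contour_integral_linepath_le)
    show "continuous_on (closed_segment (Complex x s) (Complex x t)) g" using st R by (intro cont') auto
    show "norm (Complex x t - Complex x s) \<le> 2 ^ K" using st R(3) by (auto simp: cmod_def)
    fix w assume "w \<in> closed_segment (Complex x s) (Complex x t)"
    then have w: "Re w = x" "s \<le> Im w" "Im w \<le> t" using st R by (auto simp: seg)
    have "R \<le> \<bar>Im w\<bar>" "\<bar>Im w\<bar> \<le> R'" using w st R by auto
    then have "norm (g (Complex x (Im w))) \<le> Q K" by (intro Suc.prems) (auto simp: R_def R'_def)
    moreover have "Complex x (Im w) = w" using w(1) by (simp add: complex_eq_iff)
    ultimately show "norm (g w) \<le> Q K" by simp
  qed (rule Q0)
  moreover have "norm (?I (-R') R') \<le> norm (?I (-R') (-R)) + (norm (?I (-R) R) + norm (?I R R'))"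
    unfolding split by (meson add_left_mono norm_triangle_ineq order_trans)
  ultimately have "norm (?I (-R') R') \<le> Q K * 2 ^ K + (2 * (\<Sum>k<K. 2 ^ k * Q k) + Q K * 2 ^ K)"
    using outer[of "-R'" "-R"] outer[of R R'] by linarith
  then show ?case by (simp add: R'_def algebra_simps)
qed

text \<open>Cauchy's formula term by term on the convex domain V of the kernel: a pole outside V
  contributes nothing, and \<open>inside\<close> ensures that every pole in V is encircled.\<close>

lemma contour_integral_rectpath_cauchy_sum:
  assumes V: "convex V" "open V" and k: "k holomorphic_on V"
    and ab: "Re a < Re b" "Im a < Im b" "cbox a b \<subseteq> V" and B: "finite B"
    and inside: "\<And>i. i \<in> B \<Longrightarrow> of_int i \<in> V \<Longrightarrow> of_int i \<in> box a b"
  shows "contour_integral (rectpath a b) (\<lambda>z. cauchy_sum B c z * k z)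
    = 2 * pi * \<i> * (\<Sum>i\<in>{i\<in>B. of_int i \<in> V}. c i * k (of_int i))"
proof -
  have path: "path_image (rectpath a b) = cbox a b - box a b"
    using ab by (intro path_image_rectpath_cbox_minus_box) auto
  have "((\<lambda>z. c i / (z - of_int i) * k z) has_contour_integral
       (if of_int i \<in> V then 2 * pi * \<i> * (c i * k (of_int i)) else 0)) (rectpath a b)" if i: "i \<in> B" for i
  proof (cases "of_int i \<in> V")
    case True
    have "((\<lambda>w. (c i * k w) / (w - of_int i)) has_contour_integral (2*pi * \<i> * winding_number (rectpath a b) (of_int i) * (c i * k (of_int i)))) (rectpath a b)"
    proof (rule Cauchy_integral_formula_convex_simple[OF V(1)])
      show "(\<lambda>w. c i * k w) holomorphic_on V" using k by (intro holomorphic_intros)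
      show "of_int i \<in> interior V" using True V(2) by (simp add: interior_open)
      show "path_image (rectpath a b) \<subseteq> V - {of_int i}" using inside[OF i True] ab(3) path by auto
    qed auto
    then show ?thesis using True winding_number_rectpath[OF inside[OF i True]] by (simp add: mult_ac)
  next
    case False
    have "((\<lambda>z. c i / (z - of_int i) * k z) has_contour_integral 0) (rectpath a b)"
    proof (rule Cauchy_theorem_convex_simple[OF _ V(1)])
      show "(\<lambda>z. c i / (z - of_int i) * k z) holomorphic_on V"
        using k False by (intro holomorphic_intros) auto
      show "path_image (rectpath a b) \<subseteq> V" using ab(3) path by auto
    qed auto
    then show ?thesis using False by simp
  qed
  then have "((\<lambda>z. \<Sum>i\<in>B. c i / (z - of_int i) * k z) has_contour_integral
      (\<Sum>i\<in>B. if of_int i \<in> V then 2 * pi * \<i> * (c i * k (of_int i)) else 0)) (rectpath a b)"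
    by (intro has_contour_integral_sum[OF B])
  then have "contour_integral (rectpath a b) (\<lambda>z. cauchy_sum B c z * k z) =
      (\<Sum>i\<in>B. if of_int i \<in> V then 2 * pi * \<i> * (c i * k (of_int i)) else 0)"
    unfolding cauchy_sum_def sum_distrib_right by (rule contour_integral_unique)
  also have "\<dots> = (\<Sum>i\<in>{i\<in>B. of_int i \<in> V}. 2 * pi * \<i> * (c i * k (of_int i)))"
    by (rule sum.inter_filter[OF B, symmetric])
  finally show ?thesis by (simp add: sum_distrib_left)
qed

lemma continuous_on_cauchy_sum:
  assumes "\<And>i z. i \<in> B \<Longrightarrow> z \<in> A \<Longrightarrow> z \<noteq> of_int i"
  shows "continuous_on A (cauchy_sum B c)"
  unfolding cauchy_sum_def using assms by (intro continuous_intros) auto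

lemma norm_cauchy_sum_far_le:
  assumes "\<And>i. i \<in> B \<Longrightarrow> 2 * \<bar>of_int i\<bar> \<le> R" "R > 0" "norm z \<ge> R"
  shows "norm (cauchy_sum B c z) \<le> 2 * (\<Sum>i\<in>B. norm (c i)) / R"
proof -
  have "norm (cauchy_sum B c z) \<le> (\<Sum>i\<in>B. norm (c i) * (2 / R))"
    unfolding cauchy_sum_def
  proof (rule sum_norm_le)
    fix i assume i: "i \<in> B"
    have "norm z - norm (of_int i :: complex) \<le> norm (z - of_int i)" by (rule norm_triangle_ineq2)
    moreover have "a - b \<le> c \<Longrightarrow> 2 * b \<le> R \<Longrightarrow> R \<le> a \<Longrightarrow> R / 2 \<le> c" for a b c by simp
    ultimately have "norm (z - of_int i) \<ge> R / 2" using assms(1)[OF i] assms(3) by simp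
    then have "norm (c i) / norm (z - of_int i) \<le> norm (c i) / (R / 2)"
      using assms(2) by (intro divide_left_mono) (auto intro!: mult_pos_pos)
    then show "norm (c i / (z - of_int i)) \<le> norm (c i) * (2 / R)" by (simp add: norm_divide)
  qed
  then show ?thesis by (simp add: sum_distrib_left sum_divide_distrib mult.commute)
qed

text \<open>The sign \<sigma> puts both bases into the right half-plane, where principal powers are
  holomorphic: \<sigma> = 1 serves Re z > m for m \<ge> 0, and \<sigma> = -1 the strip |Re z| < m.
  The half-plane to the left of -m is reached by reflection.\<close>

definition branch :: "real \<Rightarrow> real \<Rightarrow> real \<Rightarrow> int \<Rightarrow> complex \<Rightarrow> complex" where
  "branch \<sigma> \<alpha> \<beta> m z = (of_real \<sigma> * (z - of_int m)) powr of_real (-\<alpha>) * (z + of_int m) powr of_real (-\<beta>)"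

definition branch_dom :: "real \<Rightarrow> int \<Rightarrow> complex set" where
  "branch_dom \<sigma> m = {z. \<sigma> * (Re z - of_int m) > 0 \<and> Re z + of_int m > 0}"

lemma holomorphic_branch: "branch \<sigma> \<alpha> \<beta> m holomorphic_on branch_dom \<sigma> m"
  unfolding branch_def branch_dom_def
  by (intro holomorphic_intros) (auto simp: complex_nonpos_Reals_iff)

lemma norm_branch:
  assumes "\<bar>\<sigma>\<bar> = 1"
  shows "norm (branch \<sigma> \<alpha> \<beta> m z) = norm (z - of_int m) powr (-\<alpha>) * norm (z + of_int m) powr (-\<beta>)"
  unfolding branch_def norm_mult by (simp add: norm_powr_real_powr' norm_mult assms)

lemma branch_of_int:
  assumes "\<bar>\<sigma>\<bar> = 1" "of_int i \<in> branch_dom \<sigma> m"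
  shows "branch \<sigma> \<alpha> \<beta> m (of_int i) = of_real (\<bar>real_of_int (i - m)\<bar> powr (-\<alpha>) * \<bar>real_of_int (i + m)\<bar> powr (-\<beta>))"
proof -
  have pos: "\<sigma> * real_of_int (i - m) > 0" "real_of_int (i + m) > 0" using assms(2) by (auto simp: branch_dom_def)
  have "complex_of_real \<sigma> * (of_int i - of_int m) = of_real (\<sigma> * real_of_int (i - m))"
     "(of_int i + of_int m :: complex) = of_real (real_of_int (i + m))" by simp_all
  moreover have "\<bar>real_of_int (i - m)\<bar> = \<sigma> * real_of_int (i - m)"
    using assms(1) pos(1) by (metis abs_mult abs_of_pos mult_1)
  moreover have "\<bar>real_of_int (i + m)\<bar> = real_of_int (i + m)" using pos(2) by simp
  ultimately show ?thesis
    using powr_of_real[OF less_imp_le[OF pos(1)], of "-\<alpha>"] powr_of_real[OF less_imp_le[OF pos(2)], of "-\<beta>"]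
    unfolding branch_def by (simp only: of_real_mult [symmetric])
qed

lemma branch_dom_convex_open: "convex (branch_dom \<sigma> m)" "open (branch_dom \<sigma> m)"
proof -
  have eq: "branch_dom \<sigma> m = {z. \<sigma> * Re z > \<sigma> * of_int m} \<inter> {z. Re z > - of_int m}"
    by (auto simp: branch_dom_def algebra_simps)
  show "open (branch_dom \<sigma> m)"
    unfolding eq by (intro open_Int open_halfspace_Re_gt open_Collect_less continuous_intros)
  have "{z. \<sigma> * Re z > \<sigma> * of_int m} = {z. inner (of_real \<sigma>) z > \<sigma> * of_int m}" by (simp add: inner_complex_def)
  then have "convex {z. \<sigma> * Re z > \<sigma> * of_int m}" by (simp only: convex_halfspace_gt)
  then show "convex (branch_dom \<sigma> m)"
    unfolding eq by (intro convex_Int convex_halfspace_Re_gt)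
qed

text \<open>Block length 2^k times the size of the kernel at that height: distance about 2^k to the
  nearby branch point, which carries the exponent \<alpha>, and about |n| + 2^k to the opposite one.
  Near the other branch point the two exponents change places.\<close>

definition dyadic_weight :: "real \<Rightarrow> real \<Rightarrow> int \<Rightarrow> nat \<Rightarrow> real" where
  "dyadic_weight \<alpha> \<beta> n k = (2 ^ k) powr (1 - \<alpha>) * (\<bar>of_int n\<bar> + 2 ^ k) powr (-\<beta>)"

lemma dyadic_weight_nonneg [simp]: "dyadic_weight \<alpha> \<beta> n k \<ge> 0"
  by (simp add: dyadic_weight_def)

lemma powr_minus_quarter_le:
  fixes a x y :: real
  assumes "0 \<le> a" "0 < y" "y / 4 \<le> x"
  shows "x powr (-a) \<le> 4 powr a * y powr (-a)"
proof -
  have "x powr (-a) \<le> (y / 4) powr (-a)" using assms by (intro powr_mono2') auto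
  also have "\<dots> = 4 powr a * y powr (-a)" using assms by (simp add: powr_divide powr_minus_divide)
  finally show ?thesis .
qed

text \<open>The final alternative says which branch point is the far one: a is the exponent of the
  near point, b that of the far one. Both distances are bounded below up to a factor 4, and \<alpha>
  + \<beta> \<le> 1 keeps the total loss at 4.\<close>

lemma norm_branch_line_le:
  assumes "\<bar>\<sigma>\<bar> = 1" "0 \<le> \<alpha>" "0 \<le> \<beta>" "\<alpha> + \<beta> \<le> 1" "2 ^ k \<le> 1 + \<bar>t\<bar>"
    and "\<bar>x - of_int m\<bar> \<ge> 1/2" "\<bar>x + of_int m\<bar> \<ge> 1/2"
    and "(\<bar>x + of_int m\<bar> \<ge> \<bar>of_int m\<bar> + 1/4 \<and> a = \<alpha> \<and> b = \<beta>) \<or> (\<bar>x - of_int m\<bar> \<ge> \<bar>of_int m\<bar> + 1/4 \<and> a = \<beta> \<and> b = \<alpha>)"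
  shows "2 ^ k * norm (branch \<sigma> \<alpha> \<beta> m (Complex x t)) \<le> 4 * dyadic_weight a b m k"
proof -
  define N where "N = (2::real) ^ k"
  have N: "N \<ge> 1" by (simp add: N_def)
  have near: "norm (Complex u t) \<ge> N / 4" if "\<bar>u\<bar> \<ge> 1/2" for u
  proof -
    have "norm (Complex u t) \<ge> 1/2" "norm (Complex u t) \<ge> \<bar>t\<bar>"
      using abs_Re_le_cmod[of "Complex u t"] abs_Im_le_cmod[of "Complex u t"] that by auto
    moreover have "c \<ge> N / 4" if "c \<ge> 1/2" "c \<ge> s" "N \<le> 1 + s" for c s using that by simp
    ultimately show ?thesis using assms(5) by (simp add: N_def)
  qed
  have far: "norm (Complex u t) \<ge> (\<bar>of_int m\<bar> + N) / 4" if "\<bar>u\<bar> \<ge> 1/2" "\<bar>u\<bar> \<ge> \<bar>of_int m\<bar> + 1/4" for u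
  proof -
    have "norm (Complex u t) \<ge> 1/2" "norm (Complex u t) \<ge> \<bar>of_int m\<bar> + 1/4" "norm (Complex u t) \<ge> \<bar>t\<bar>"
      using abs_Re_le_cmod[of "Complex u t"] abs_Im_le_cmod[of "Complex u t"] that by auto
    moreover have "c \<ge> (M + N) / 4" if "c \<ge> 1/2" "c \<ge> M + 1/4" "c \<ge> s" "N \<le> 1 + s" "M \<ge> 0" for c s M :: real using that by simp
    ultimately show ?thesis using assms(5) by (simp add: N_def)
  qed
  have parts: "Complex x t - of_int m = Complex (x - of_int m) t" "Complex x t + of_int m = Complex (x + of_int m) t"
    by (simp_all add: complex_eq_iff)
  have gen: "N * (u powr (-a) * v powr (-b)) \<le> 4 * dyadic_weight a b m k"
    if "u \<ge> N / 4" "v \<ge> (\<bar>of_int m\<bar> + N) / 4" "a \<ge> 0" "b \<ge> 0" "a + b \<le> 1" for u v a b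
  proof -
    have "u powr (-a) * v powr (-b) \<le> (4 powr a * N powr (-a)) * (4 powr b * (\<bar>of_int m\<bar> + N) powr (-b))"
      using that N by (intro mult_mono powr_minus_quarter_le) auto
    also have "\<dots> = 4 powr (a + b) * (N powr (-a) * (\<bar>of_int m\<bar> + N) powr (-b))"
      by (simp add: powr_add mult_ac)
    also have "\<dots> \<le> 4 powr 1 * (N powr (-a) * (\<bar>of_int m\<bar> + N) powr (-b))"
      using that by (intro mult_right_mono powr_mono) auto
    finally have "N * (u powr (-a) * v powr (-b)) \<le> N * (4 * (N powr (-a) * (\<bar>of_int m\<bar> + N) powr (-b)))"
      using N by (intro mult_left_mono) auto
    also have "\<dots> = 4 * ((N powr 1 * N powr (-a)) * (\<bar>of_int m\<bar> + N) powr (-b))" using N by simp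
    also have "N powr 1 * N powr (-a) = N powr (1 - a)" unfolding powr_add [symmetric] by simp
    finally show ?thesis by (simp add: dyadic_weight_def N_def)
  qed
  from assms(8) show ?thesis
  proof
    assume *: "\<bar>x + of_int m\<bar> \<ge> \<bar>of_int m\<bar> + 1/4 \<and> a = \<alpha> \<and> b = \<beta>"
    then show ?thesis
      unfolding norm_branch[OF assms(1)] parts using gen[OF near[OF assms(6)] far[OF assms(7)]] assms by (simp add: N_def)
  next
    assume *: "\<bar>x - of_int m\<bar> \<ge> \<bar>of_int m\<bar> + 1/4 \<and> a = \<beta> \<and> b = \<alpha>"
    then show ?thesis
      unfolding norm_branch[OF assms(1)] parts using gen[OF near[OF assms(7)] far[OF assms(6)]] assms by (simp add: N_def mult.commute)
  qed
qed

lemma norm_contour_integral_rectpath_sides_le: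
  assumes g: "continuous_on (path_image (rectpath a b)) g" and ab: "Re a \<le> Re b" "Im a \<le> Im b"
    and E: "E \<ge> 0" "\<And>w. Im w = Im a \<or> Im w = Im b \<Longrightarrow> Re a \<le> Re w \<Longrightarrow> Re w \<le> Re b \<Longrightarrow> norm (g w) \<le> E"
  shows "norm (contour_integral (rectpath a b) g) \<le>
     norm (contour_integral (linepath (Complex (Re a) (Im a)) (Complex (Re a) (Im b))) g) +
     norm (contour_integral (linepath (Complex (Re b) (Im a)) (Complex (Re b) (Im b))) g) + 2 * E * (Re b - Re a)"
proof -
  define c d where "c = Complex (Re b) (Im a)" and "d = Complex (Re a) (Im b)"
  have sub: "path_image (rectpath a b) = closed_segment a c \<union> closed_segment c b \<union> closed_segment b d \<union> closed_segment d a"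
    by (simp add: rectpath_def Let_def path_image_join c_def d_def Un_assoc)
  have cont: "continuous_on (closed_segment a c) g" "continuous_on (closed_segment b d) g" "continuous_on (closed_segment d a) g"
    by (auto intro!: continuous_on_subset[OF g] simp: sub)
  have bottom: "norm (contour_integral (linepath a c) g) \<le> E * (Re b - Re a)"
  proof (rule norm_contour_integral_linepath_le[OF cont(1) E(1)])
    fix w assume w: "w \<in> closed_segment a c"
    have "Im w = Im a \<and> Re a \<le> Re w \<and> Re w \<le> Re b"
      using w ab by (subst (asm) closed_segment_same_Im) (auto simp: c_def closed_segment_eq_real_ivl split: if_splits)
    then show "norm (g w) \<le> E" using E(2) by blast
  qed (use ab in \<open>auto simp: c_def cmod_def\<close>)
  have top: "norm (contour_integral (linepath b d) g) \<le> E * (Re b - Re a)"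
  proof (rule norm_contour_integral_linepath_le[OF cont(2) E(1)])
    fix w assume w: "w \<in> closed_segment b d"
    have "Im w = Im b \<and> Re a \<le> Re w \<and> Re w \<le> Re b"
      using w ab by (subst (asm) closed_segment_same_Im) (auto simp: d_def closed_segment_eq_real_ivl split: if_splits)
    then show "norm (g w) \<le> E" using E(2) by blast
  qed (use ab in \<open>auto simp: d_def cmod_def\<close>)
  have left: "contour_integral (linepath d a) g = - contour_integral (linepath a d) g"
    by (rule contour_integral_reverse_linepath[OF cont(3)])
  have "norm (x + y + z + w) \<le> norm x + norm y + norm z + norm w" for x y z w :: complex
    by (meson add_mono_thms_linordered_semiring(3) norm_triangle_le norm_triangle_ineq order_trans)
  from this[of "contour_integral (linepath a c) g" "contour_integral (linepath c b) g" "contour_integral (linepath b d) g" "contour_integral (linepath d a) g"]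
  have "norm (contour_integral (rectpath a b) g) \<le> norm (contour_integral (linepath a c) g) + norm (contour_integral (linepath c b) g)
     + norm (contour_integral (linepath b d) g) + norm (contour_integral (linepath a d) g)"
    unfolding contour_integral_rectpath[OF g ab] c_def[symmetric] d_def[symmetric] left norm_minus_cancel .
  then have "norm (contour_integral (rectpath a b) g) \<le> norm (contour_integral (linepath a d) g) + norm (contour_integral (linepath c b) g) + 2 * E * (Re b - Re a)"
    using bottom top by (simp add: algebra_simps)
  then show ?thesis by (simp add: c_def d_def)
qed

lemma norm_contour_integral_branch_line_le:
  assumes "\<bar>\<sigma>\<bar> = 1" "0 \<le> \<alpha>" "0 \<le> \<beta>" "\<alpha> + \<beta> \<le> 1" and x: "x = of_int n + 1/2"
    and "\<bar>x - of_int m\<bar> \<ge> 1/2" "\<bar>x + of_int m\<bar> \<ge> 1/2"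
    and "(\<bar>x + of_int m\<bar> \<ge> \<bar>of_int m\<bar> + 1/4 \<and> a = \<alpha> \<and> b = \<beta>) \<or> (\<bar>x - of_int m\<bar> \<ge> \<bar>of_int m\<bar> + 1/4 \<and> a = \<beta> \<and> b = \<alpha>)"
    and dom: "{z. Re z = x} \<subseteq> branch_dom \<sigma> m"
    and Q: "\<And>k t. 2 ^ k \<le> 1 + \<bar>t\<bar> \<Longrightarrow> 1 + \<bar>t\<bar> \<le> 2 ^ Suc k \<Longrightarrow> norm (cauchy_sum B c (of_int n + 1/2 + \<i> * of_real t)) \<le> Q k"
  shows "norm (contour_integral (linepath (Complex x (-(2 ^ K - 1))) (Complex x (2 ^ K - 1))) (\<lambda>z. cauchy_sum B c z * branch \<sigma> \<alpha> \<beta> m z))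
    \<le> 8 * (\<Sum>k<K. dyadic_weight a b m k * Q k)"
proof -
  have cx: "Complex x t = of_int n + 1/2 + \<i> * of_real t" for t by (simp add: complex_eq_iff x)
  \<comment> \<open>The height t = 2^k - 1 belongs to the k-th block, so the bound by Q k forces its
    nonnegativity.\<close>
  have Q0: "Q k \<ge> 0" for k
    by (rule order_trans[OF norm_ge_zero Q[of k "2 ^ k - 1"]]) auto
  have "norm (contour_integral (linepath (Complex x (-(2 ^ K - 1))) (Complex x (2 ^ K - 1))) (\<lambda>z. cauchy_sum B c z * branch \<sigma> \<alpha> \<beta> m z))
    \<le> 2 * (\<Sum>k<K. 2 ^ k * (Q k * (4 * dyadic_weight a b m k / 2 ^ k)))"
  proof (rule norm_contour_integral_vertical_le)
    show "continuous_on {z. Re z = x} (\<lambda>z. cauchy_sum B c z * branch \<sigma> \<alpha> \<beta> m z)"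
    proof (intro continuous_intros continuous_on_cauchy_sum)
      show "continuous_on {z. Re z = x} (branch \<sigma> \<alpha> \<beta> m)"
        by (rule continuous_on_subset[OF holomorphic_on_imp_continuous_on[OF holomorphic_branch] dom])
      fix i z assume "z \<in> {z. Re z = x}"
      then have "z = Complex x (Im z)" by (simp add: complex_eq_iff)
      then show "z \<noteq> of_int i" using half_line_neq_int[of n "Im z" i] cx by metis
    qed
    fix k and t :: real assume k: "k < K" and t: "2 ^ k \<le> 1 + \<bar>t\<bar>" "1 + \<bar>t\<bar> \<le> 2 ^ Suc k"
    have "2 ^ k * norm (branch \<sigma> \<alpha> \<beta> m (Complex x t)) \<le> 4 * dyadic_weight a b m k"
      by (rule norm_branch_line_le) (use assms t in auto)
    then have "norm (branch \<sigma> \<alpha> \<beta> m (Complex x t)) \<le> 4 * dyadic_weight a b m k / 2 ^ k"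
      by (simp add: pos_le_divide_eq mult.commute)
    then show "norm (cauchy_sum B c (Complex x t) * branch \<sigma> \<alpha> \<beta> m (Complex x t)) \<le> Q k * (4 * dyadic_weight a b m k / 2 ^ k)"
      unfolding norm_mult using Q[OF t] Q0 cx by (intro mult_mono) auto
  qed (use Q0 in auto)
  also have "\<dots> = 8 * (\<Sum>k<K. dyadic_weight a b m k * Q k)"
    by (simp add: sum_distrib_left mult_ac)
  finally show ?thesis .
qed

lemma norm_branch_far_le:
  assumes "\<bar>\<sigma>\<bar> = 1" "0 \<le> \<alpha>" "0 \<le> \<beta>" "R > 0" "norm (z - of_int m) \<ge> R" "norm (z + of_int m) \<ge> R"
  shows "norm (branch \<sigma> \<alpha> \<beta> m z) \<le> R powr (-(\<alpha> + \<beta>))"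
proof -
  have "norm (branch \<sigma> \<alpha> \<beta> m z) \<le> R powr (-\<alpha>) * R powr (-\<beta>)"
    unfolding norm_branch[OF assms(1)] using assms by (intro mult_mono powr_mono2') auto
  then show ?thesis by (simp flip: powr_add)
qed

section \<open>Cauchy's formula on the three intervals cut out by j and -j\<close>

definition branch_kernel :: "real \<Rightarrow> real \<Rightarrow> int \<Rightarrow> int \<Rightarrow> real" where
  "branch_kernel \<alpha> \<beta> j i = \<bar>real_of_int (i - j)\<bar> powr (-\<alpha>) * \<bar>real_of_int (i + j)\<bar> powr (-\<beta>)"

lemma far_product_le:
  assumes "\<bar>\<sigma>\<bar> = 1" "0 \<le> \<alpha>" "0 \<le> \<beta>" and R: "R > 0" "\<And>i. i \<in> B \<Longrightarrow> 2 * \<bar>of_int i\<bar> \<le> R"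
    and z: "norm z \<ge> R" "norm (z - of_int m) \<ge> R" "norm (z + of_int m) \<ge> R"
  shows "norm (cauchy_sum B c z * branch \<sigma> \<alpha> \<beta> m z) \<le> 2 * (\<Sum>i\<in>B. norm (c i)) / R * R powr (-(\<alpha> + \<beta>))"
  unfolding norm_mult
  using norm_cauchy_sum_far_le[OF R(2) R(1) z(1)] norm_branch_far_le[OF assms(1-3) R(1) z(2,3)] R(1)
  by (intro mult_mono) (auto intro!: divide_nonneg_pos mult_nonneg_nonneg sum_nonneg)

lemma two_pi_cancel:
  assumes "norm (2 * pi * \<i> * s) \<le> 8 * X + 8 * Y" "X \<ge> 0" "Y \<ge> 0"
  shows "norm s \<le> 2 * X + 2 * Y"
proof -
  have "6 * norm s \<le> 2 * pi * norm s" using pi_gt3 by (intro mult_right_mono) auto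
  also have "\<dots> \<le> 8 * X + 8 * Y" using assms(1) by (simp add: norm_mult)
  finally show ?thesis using assms by simp
qed

text \<open>The rectangle has its left side on Re z = m + 1/2 and encloses all i > m of B. On the
  other three sides the integrand is of order R^(-1-(\<alpha>+\<beta>)) and their total length is
  4R, so they only give an error that vanishes as K grows. With R = 2^K - 1 the left side is a union
  of dyadic blocks.\<close>

lemma norm_sum_kern_right_le:
  assumes ab: "0 \<le> \<alpha>" "0 \<le> \<beta>" "\<alpha> + \<beta> \<le> 1" and m: "m \<ge> 0" and B: "finite B"
    and R: "1 \<le> (2::real) ^ K - 1" "\<And>i. i \<in> B \<Longrightarrow> 2 * \<bar>of_int i\<bar> \<le> (2::real) ^ K - 1"
    and Q: "\<And>k t. 2 ^ k \<le> 1 + \<bar>t\<bar> \<Longrightarrow> 1 + \<bar>t\<bar> \<le> 2 ^ Suc k \<Longrightarrow> norm (cauchy_sum B c (of_int m + 1/2 + \<i> * of_real t)) \<le> Q k"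
  shows "norm (\<Sum>i\<in>{i\<in>B. i > m}. c i * of_real (branch_kernel \<alpha> \<beta> m i))
    \<le> 2 * (\<Sum>k<K. dyadic_weight \<alpha> \<beta> m k * Q k) + 2 * ((\<Sum>i\<in>B. norm (c i)) * (2 ^ K - 1) powr (-(\<alpha> + \<beta>)))"
proof -
  define R where "R = (2::real) ^ K - 1"
  have R1: "R \<ge> 1" and RB: "\<And>i. i \<in> B \<Longrightarrow> 2 * \<bar>of_int i\<bar> \<le> R" using R by (auto simp: R_def)
  define x where "x = real_of_int m + 1/2"
  define a b where "a = Complex x (-R)" and "b = Complex (x + R) R"
  define g where "g = (\<lambda>z. cauchy_sum B c z * branch 1 \<alpha> \<beta> m z)"
  define E where "E = 2 * (\<Sum>i\<in>B. norm (c i)) / R * R powr (-(\<alpha> + \<beta>))"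
  have E0: "E \<ge> 0" using R1 by (auto simp: E_def intro!: mult_nonneg_nonneg divide_nonneg_pos sum_nonneg)
  have dom: "z \<in> branch_dom 1 m \<longleftrightarrow> Re z > m" for z using m by (auto simp: branch_dom_def)
  have line: "{z. Re z = x} \<subseteq> branch_dom 1 m" by (auto simp: dom x_def)
  have Q0: "Q k \<ge> 0" for k by (rule order_trans[OF norm_ge_zero Q[of k "2 ^ k - 1"]]) auto
  have box: "of_int i \<in> box a b" if "i \<in> B" "i > m" for i
  proof -
    have "real_of_int i \<ge> real_of_int m + 1" using that by linarith
    moreover have "real_of_int i \<le> R / 2" using RB[OF that(1)] by simp
    ultimately show ?thesis using R1 m by (auto simp: a_def b_def x_def in_box_complex_iff)
  qed
  have path: "path_image (rectpath a b) = cbox a b - box a b"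
    using R1 by (intro path_image_rectpath_cbox_minus_box) (auto simp: a_def b_def)
  have "contour_integral (rectpath a b) g = 2 * pi * \<i> * (\<Sum>i\<in>{i\<in>B. of_int i \<in> branch_dom 1 m}. c i * branch 1 \<alpha> \<beta> m (of_int i))"
    unfolding g_def
  proof (rule contour_integral_rectpath_cauchy_sum[OF branch_dom_convex_open holomorphic_branch])
    show "cbox a b \<subseteq> branch_dom 1 m" using R1 by (auto simp: dom a_def b_def x_def in_cbox_complex_iff)
  qed (use R1 B box in \<open>auto simp: dom a_def b_def\<close>)
  also have "(\<Sum>i\<in>{i\<in>B. of_int i \<in> branch_dom 1 m}. c i * branch 1 \<alpha> \<beta> m (of_int i)) = (\<Sum>i\<in>{i\<in>B. i > m}. c i * of_real (branch_kernel \<alpha> \<beta> m i))"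
    by (intro sum.cong) (auto simp: dom branch_of_int branch_kernel_def)
  finally have eq: "contour_integral (rectpath a b) g = 2 * pi * \<i> * (\<Sum>i\<in>{i\<in>B. i > m}. c i * of_real (branch_kernel \<alpha> \<beta> m i))" .
  have cont: "continuous_on (path_image (rectpath a b)) g"
    unfolding g_def
  proof (intro continuous_intros continuous_on_cauchy_sum)
    show "continuous_on (path_image (rectpath a b)) (branch 1 \<alpha> \<beta> m)"
      by (rule continuous_on_subset[OF holomorphic_on_imp_continuous_on[OF holomorphic_branch]])
        (unfold path, use R1 in \<open>auto simp: dom a_def b_def x_def in_cbox_complex_iff\<close>)
    fix i z assume i: "i \<in> B" and z: "z \<in> path_image (rectpath a b)"
    show "z \<noteq> of_int i"
    proof
      assume eqz: "z = of_int i"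
      then have "real_of_int i \<ge> x" using z unfolding path by (auto simp: a_def b_def in_cbox_complex_iff)
      then have "i > m" unfolding x_def by linarith
      then show False using box[OF i] z eqz path by auto
    qed
  qed
  have far: "norm (g w) \<le> E" if w: "\<bar>Im w\<bar> = R \<or> Re w = x + R" for w
    unfolding g_def E_def
  proof (rule far_product_le)
    show "R \<le> norm w" "R \<le> norm (w - of_int m)" "R \<le> norm (w + of_int m)"
      using w R1 m abs_Im_le_cmod[of w] abs_Im_le_cmod[of "w - of_int m"] abs_Im_le_cmod[of "w + of_int m"]
        abs_Re_le_cmod[of w] abs_Re_le_cmod[of "w - of_int m"] abs_Re_le_cmod[of "w + of_int m"]
      by (auto simp: x_def)
  qed (use ab R1 RB in auto)
  have "norm (contour_integral (rectpath a b) g) \<le>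
     norm (contour_integral (linepath (Complex (Re a) (Im a)) (Complex (Re a) (Im b))) g) +
     norm (contour_integral (linepath (Complex (Re b) (Im a)) (Complex (Re b) (Im b))) g) + 2 * E * (Re b - Re a)"
    by (rule norm_contour_integral_rectpath_sides_le[OF cont _ _ E0]) (use R1 far in \<open>auto simp: a_def b_def\<close>)
  also have "norm (contour_integral (linepath (Complex (Re b) (Im a)) (Complex (Re b) (Im b))) g) \<le> E * (2 * R)"
  proof (rule norm_contour_integral_linepath_le[OF _ E0])
    have seg: "w \<in> path_image (rectpath a b) \<and> Re w = x + R" if "w \<in> closed_segment (Complex (Re b) (Im a)) (Complex (Re b) (Im b))" for w
      using that R1 unfolding path by (subst (asm) closed_segment_same_Re) (auto simp: a_def b_def closed_segment_eq_real_ivl in_cbox_complex_iff in_box_complex_iff)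
    show "continuous_on (closed_segment (Complex (Re b) (Im a)) (Complex (Re b) (Im b))) g"
      using seg by (intro continuous_on_subset[OF cont] subsetI) blast
    show "norm (g w) \<le> E" if "w \<in> closed_segment (Complex (Re b) (Im a)) (Complex (Re b) (Im b))" for w
      using seg[OF that] by (intro far) auto
  qed (use R1 in \<open>auto simp: a_def b_def cmod_def real_sqrt_mult\<close>)
  also have "norm (contour_integral (linepath (Complex (Re a) (Im a)) (Complex (Re a) (Im b))) g) \<le> 8 * (\<Sum>k<K. dyadic_weight \<alpha> \<beta> m k * Q k)"
    using norm_contour_integral_branch_line_le[of 1 \<alpha> \<beta> x m m \<alpha> \<beta> B c Q K, OF _ _ _ _ _ _ _ _ line] ab m Q
    unfolding g_def a_def b_def R_def by (auto simp: x_def dom)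
  finally have "norm (contour_integral (rectpath a b) g) \<le> 8 * (\<Sum>k<K. dyadic_weight \<alpha> \<beta> m k * Q k) + (E * (2 * R) + 2 * E * (Re b - Re a))"
    by simp
  also have "E * (2 * R) + 2 * E * (Re b - Re a) = 8 * ((\<Sum>i\<in>B. norm (c i)) * R powr (-(\<alpha> + \<beta>)))"
    using R1 by (simp add: E_def a_def b_def)
  finally have "norm (2 * pi * \<i> * (\<Sum>i\<in>{i\<in>B. i > m}. c i * of_real (branch_kernel \<alpha> \<beta> m i))) \<le>
     8 * (\<Sum>k<K. dyadic_weight \<alpha> \<beta> m k * Q k) + 8 * ((\<Sum>i\<in>B. norm (c i)) * R powr (-(\<alpha> + \<beta>)))"
    unfolding eq .
  then show ?thesis
    unfolding R_def [symmetric]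
    by (rule two_pi_cancel) (use Q0 in \<open>auto intro!: mult_nonneg_nonneg sum_nonneg\<close>)
qed

text \<open>Both vertical sides, at m - 1/2 and -m + 1/2, contribute here. The right one is near m
  and carries the exponents in the order \<alpha>, \<beta>; the left one is near -m and carries them
  exchanged.\<close>

lemma norm_sum_kern_middle_le:
  assumes ab: "0 \<le> \<alpha>" "0 \<le> \<beta>" "\<alpha> + \<beta> \<le> 1" and m: "m \<ge> 1" and B: "finite B"
    and R: "2 * of_int m \<le> (2::real) ^ K - 1" "\<And>i. i \<in> B \<Longrightarrow> 2 * \<bar>of_int i\<bar> \<le> (2::real) ^ K - 1"
    and Q: "\<And>k t. 2 ^ k \<le> 1 + \<bar>t\<bar> \<Longrightarrow> 1 + \<bar>t\<bar> \<le> 2 ^ Suc k \<Longrightarrow> norm (cauchy_sum B c (of_int (m - 1) + 1/2 + \<i> * of_real t)) \<le> Q k"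
    and Q': "\<And>k t. 2 ^ k \<le> 1 + \<bar>t\<bar> \<Longrightarrow> 1 + \<bar>t\<bar> \<le> 2 ^ Suc k \<Longrightarrow> norm (cauchy_sum B c (of_int (- m) + 1/2 + \<i> * of_real t)) \<le> Q' k"
  shows "norm (\<Sum>i\<in>{i\<in>B. \<bar>i\<bar> < m}. c i * of_real (branch_kernel \<alpha> \<beta> m i))
    \<le> 2 * (\<Sum>k<K. dyadic_weight \<alpha> \<beta> m k * Q k + dyadic_weight \<beta> \<alpha> m k * Q' k) + 2 * ((\<Sum>i\<in>B. norm (c i)) * (2 ^ K - 1) powr (-(\<alpha> + \<beta>)))"
proof -
  define R where "R = (2::real) ^ K - 1"
  have Rm: "R \<ge> 2 * of_int m" and R1: "R \<ge> 1" and RB: "\<And>i. i \<in> B \<Longrightarrow> 2 * \<bar>of_int i\<bar> \<le> R" using R m by (auto simp: R_def)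
  define x where "x = real_of_int m - 1/2"
  define a b where "a = Complex (-x) (-R)" and "b = Complex x R"
  define g where "g = (\<lambda>z. cauchy_sum B c z * branch (-1) \<alpha> \<beta> m z)"
  define E where "E = 2 * (\<Sum>i\<in>B. norm (c i)) / R * R powr (-(\<alpha> + \<beta>))"
  have E0: "E \<ge> 0" using R1 by (auto simp: E_def intro!: mult_nonneg_nonneg divide_nonneg_pos sum_nonneg)
  have x: "x \<ge> 1/2" using m by (simp add: x_def)
  have dom: "z \<in> branch_dom (-1) m \<longleftrightarrow> - m < Re z \<and> Re z < m" for z by (auto simp: branch_dom_def)
  have lines: "{z. Re z = x} \<subseteq> branch_dom (-1) m" "{z. Re z = -x} \<subseteq> branch_dom (-1) m"
    using m by (auto simp: dom x_def)
  have Q0: "Q k \<ge> 0" for k by (rule order_trans[OF norm_ge_zero Q[of k "2 ^ k - 1"]]) auto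
  have Q0': "Q' k \<ge> 0" for k by (rule order_trans[OF norm_ge_zero Q'[of k "2 ^ k - 1"]]) auto
  have box: "of_int i \<in> box a b" if "\<bar>i\<bar> < m" for i
  proof -
    have "\<bar>real_of_int i\<bar> \<le> real_of_int m - 1" using that by linarith
    then show ?thesis using R1 by (auto simp: a_def b_def x_def in_box_complex_iff)
  qed
  have path: "path_image (rectpath a b) = cbox a b - box a b"
    using R1 x by (intro path_image_rectpath_cbox_minus_box) (auto simp: a_def b_def)
  have "contour_integral (rectpath a b) g = 2 * pi * \<i> * (\<Sum>i\<in>{i\<in>B. of_int i \<in> branch_dom (-1) m}. c i * branch (-1) \<alpha> \<beta> m (of_int i))"
    unfolding g_def
  proof (rule contour_integral_rectpath_cauchy_sum[OF branch_dom_convex_open holomorphic_branch])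
    show "cbox a b \<subseteq> branch_dom (-1) m" by (auto simp: dom a_def b_def x_def in_cbox_complex_iff)
  qed (use R1 B x box in \<open>auto simp: dom a_def b_def abs_less_iff\<close>)
  also have "(\<Sum>i\<in>{i\<in>B. of_int i \<in> branch_dom (-1) m}. c i * branch (-1) \<alpha> \<beta> m (of_int i)) = (\<Sum>i\<in>{i\<in>B. \<bar>i\<bar> < m}. c i * of_real (branch_kernel \<alpha> \<beta> m i))"
    by (intro sum.cong) (auto simp: dom branch_of_int branch_kernel_def abs_less_iff)
  finally have eq: "contour_integral (rectpath a b) g = 2 * pi * \<i> * (\<Sum>i\<in>{i\<in>B. \<bar>i\<bar> < m}. c i * of_real (branch_kernel \<alpha> \<beta> m i))" .
  have cont: "continuous_on (path_image (rectpath a b)) g"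
    unfolding g_def
  proof (intro continuous_intros continuous_on_cauchy_sum)
    show "continuous_on (path_image (rectpath a b)) (branch (-1) \<alpha> \<beta> m)"
      by (rule continuous_on_subset[OF holomorphic_on_imp_continuous_on[OF holomorphic_branch]])
        (unfold path, auto simp: dom a_def b_def x_def in_cbox_complex_iff)
    fix i z assume i: "i \<in> B" and z: "z \<in> path_image (rectpath a b)"
    show "z \<noteq> of_int i"
    proof
      assume eqz: "z = of_int i"
      then have "\<bar>real_of_int i\<bar> \<le> x" using z unfolding path by (auto simp: a_def b_def in_cbox_complex_iff)
      then have "\<bar>i\<bar> < m" unfolding x_def by linarith
      then show False using box z eqz path by auto
    qed
  qed
  have far: "norm (g w) \<le> E" if w: "\<bar>Im w\<bar> = R" for w
    unfolding g_def E_def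
  proof (rule far_product_le)
    show "R \<le> norm w" "R \<le> norm (w - of_int m)" "R \<le> norm (w + of_int m)"
      using w abs_Im_le_cmod[of w] abs_Im_le_cmod[of "w - of_int m"] abs_Im_le_cmod[of "w + of_int m"]
      by auto
  qed (use ab R1 RB in auto)
  have "norm (contour_integral (rectpath a b) g) \<le>
     norm (contour_integral (linepath (Complex (Re a) (Im a)) (Complex (Re a) (Im b))) g) +
     norm (contour_integral (linepath (Complex (Re b) (Im a)) (Complex (Re b) (Im b))) g) + 2 * E * (Re b - Re a)"
    by (rule norm_contour_integral_rectpath_sides_le[OF cont _ _ E0]) (use R1 x far in \<open>auto simp: a_def b_def\<close>)
  also have "norm (contour_integral (linepath (Complex (Re b) (Im a)) (Complex (Re b) (Im b))) g) \<le> 8 * (\<Sum>k<K. dyadic_weight \<alpha> \<beta> m k * Q k)"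
    using norm_contour_integral_branch_line_le[of "-1" \<alpha> \<beta> x "m - 1" m \<alpha> \<beta> B c Q K, OF _ _ _ _ _ _ _ _ lines(1)] ab m Q
    unfolding g_def a_def b_def R_def by (auto simp: x_def dom)
  also have "norm (contour_integral (linepath (Complex (Re a) (Im a)) (Complex (Re a) (Im b))) g) \<le> 8 * (\<Sum>k<K. dyadic_weight \<beta> \<alpha> m k * Q' k)"
    using norm_contour_integral_branch_line_le[of "-1" \<alpha> \<beta> "-x" "-m" m \<beta> \<alpha> B c Q' K, OF _ _ _ _ _ _ _ _ lines(2)] ab m Q'
    unfolding g_def a_def b_def R_def by (auto simp: x_def dom)
  finally have "norm (contour_integral (rectpath a b) g) \<le> 8 * (\<Sum>k<K. dyadic_weight \<alpha> \<beta> m k * Q k + dyadic_weight \<beta> \<alpha> m k * Q' k) + 2 * E * (2 * x)"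
    by (simp add: sum.distrib a_def b_def)
  also have "2 * E * (2 * x) \<le> 2 * E * (2 * R)" using Rm R1 E0 m by (intro mult_left_mono) (auto simp: x_def)
  also have "2 * E * (2 * R) = 8 * ((\<Sum>i\<in>B. norm (c i)) * R powr (-(\<alpha> + \<beta>)))"
    using R1 by (simp add: E_def)
  finally have "norm (2 * pi * \<i> * (\<Sum>i\<in>{i\<in>B. \<bar>i\<bar> < m}. c i * of_real (branch_kernel \<alpha> \<beta> m i))) \<le>
     8 * (\<Sum>k<K. dyadic_weight \<alpha> \<beta> m k * Q k + dyadic_weight \<beta> \<alpha> m k * Q' k) + 8 * ((\<Sum>i\<in>B. norm (c i)) * R powr (-(\<alpha> + \<beta>)))"
    unfolding eq by simp
  then show ?thesis
    unfolding R_def [symmetric]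
    by (rule two_pi_cancel) (use Q0 Q0' in \<open>auto intro!: mult_nonneg_nonneg sum_nonneg add_nonneg_nonneg\<close>)
qed

subsection \<open>The operator as a sum of vertical line integrals\<close>

lemma cauchy_sum_reflect: "cauchy_sum (uminus ` B) (\<lambda>i. c (- i)) z = - cauchy_sum B c (- z)"
proof -
  have "cauchy_sum (uminus ` B) (\<lambda>i. c (- i)) z = (\<Sum>i\<in>B. c i / (z + of_int i))"
    unfolding cauchy_sum_def by (subst sum.reindex) (auto simp: inj_on_def)
  also have "\<dots> = (\<Sum>i\<in>B. - (c i / (- z - of_int i)))"
  proof (rule sum.cong)
    fix i
    have "- z - of_int i = - (z + of_int i)" by simp
    then show "c i / (z + of_int i) = - (c i / (- z - of_int i))" by (simp only: divide_minus_right minus_minus)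
  qed simp
  finally show ?thesis by (simp add: cauchy_sum_def sum_negf)
qed

text \<open>The reflection i \<mapsto> -i reduces this to the right-hand piece: it exchanges
  \<alpha> and \<beta> and takes the line at m + 1/2 to the one at (-m - 1) + 1/2.\<close>

lemma norm_sum_kern_left_le:
  assumes ab: "0 \<le> \<alpha>" "0 \<le> \<beta>" "\<alpha> + \<beta> \<le> 1" and m: "m \<ge> 0" and B: "finite B"
    and R: "1 \<le> (2::real) ^ K - 1" "\<And>i. i \<in> B \<Longrightarrow> 2 * \<bar>of_int i\<bar> \<le> (2::real) ^ K - 1"
    and Q: "\<And>k t. 2 ^ k \<le> 1 + \<bar>t\<bar> \<Longrightarrow> 1 + \<bar>t\<bar> \<le> 2 ^ Suc k \<Longrightarrow> norm (cauchy_sum B c (of_int (- m - 1) + 1/2 + \<i> * of_real t)) \<le> Q k"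
  shows "norm (\<Sum>i\<in>{i\<in>B. i < - m}. c i * of_real (branch_kernel \<alpha> \<beta> m i))
    \<le> 2 * (\<Sum>k<K. dyadic_weight \<beta> \<alpha> m k * Q k) + 2 * ((\<Sum>i\<in>B. norm (c i)) * (2 ^ K - 1) powr (-(\<alpha> + \<beta>)))"
proof -
  let ?B = "uminus ` B" and ?c = "\<lambda>i. c (- i)"
  have "norm (\<Sum>i\<in>{i\<in>?B. i > m}. ?c i * of_real (branch_kernel \<beta> \<alpha> m i))
    \<le> 2 * (\<Sum>k<K. dyadic_weight \<beta> \<alpha> m k * Q k) + 2 * ((\<Sum>i\<in>?B. norm (?c i)) * (2 ^ K - 1) powr (-(\<beta> + \<alpha>)))"
  proof (rule norm_sum_kern_right_le)
    fix k and t :: real assume t: "2 ^ k \<le> 1 + \<bar>t\<bar>" "1 + \<bar>t\<bar> \<le> 2 ^ Suc k"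
    have "- (of_int m + 1/2 + \<i> * of_real t) = of_int (- m - 1) + 1/2 + \<i> * of_real (- t)" by simp
    then have "norm (cauchy_sum ?B ?c (of_int m + 1/2 + \<i> * of_real t)) = norm (cauchy_sum B c (of_int (- m - 1) + 1/2 + \<i> * of_real (- t)))"
      by (simp only: cauchy_sum_reflect norm_minus_cancel)
    also have "\<dots> \<le> Q k" using Q[of k "- t"] t by (simp only: abs_minus_cancel)
    finally show "norm (cauchy_sum ?B ?c (of_int m + 1/2 + \<i> * of_real t)) \<le> Q k" .
  qed (use ab m B R in auto)
  moreover have "(\<Sum>i\<in>{i\<in>?B. i > m}. ?c i * of_real (branch_kernel \<beta> \<alpha> m i)) = (\<Sum>i\<in>{i\<in>B. i < - m}. c i * of_real (branch_kernel \<alpha> \<beta> m i))"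
  proof (rule sum.reindex_bij_witness[of _ uminus uminus])
    fix i
    have abs_eq: "\<bar>real_of_int (- i - m)\<bar> = \<bar>real_of_int (i + m)\<bar>" "\<bar>real_of_int (- i + m)\<bar> = \<bar>real_of_int (i - m)\<bar>" by auto
    have "branch_kernel \<alpha> \<beta> m (- i) = branch_kernel \<beta> \<alpha> m i"
      unfolding branch_kernel_def abs_eq by (rule mult.commute)
    then show "c (- i) * of_real (branch_kernel \<alpha> \<beta> m (- i)) = ?c i * of_real (branch_kernel \<beta> \<alpha> m i)" by (simp only:)
  qed auto
  moreover have "(\<Sum>i\<in>?B. norm (?c i)) = (\<Sum>i\<in>B. norm (c i))"
    by (subst sum.reindex) (auto simp: inj_on_def)
  moreover have "\<beta> + \<alpha> = \<alpha> + \<beta>" by (rule add.commute)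
  ultimately show ?thesis by (simp only:)
qed

text \<open>Only four of the eight products on the right arise. The full product is taken because
  the four line indices are permuted by m \<mapsto> -m, which makes the case of negative j a mere
  exchange of \<alpha> and \<beta>.\<close>

lemma norm_sum_kern_nonneg_le:
  assumes ab: "0 \<le> \<alpha>" "0 \<le> \<beta>" "\<alpha> + \<beta> \<le> 1" and m: "m \<ge> 0" and B: "finite B"
    and R: "1 \<le> (2::real) ^ K - 1" "2 * of_int m \<le> (2::real) ^ K - 1" "\<And>i. i \<in> B \<Longrightarrow> 2 * \<bar>of_int i\<bar> \<le> (2::real) ^ K - 1"
    and Q: "\<And>n k t. 2 ^ k \<le> 1 + \<bar>t\<bar> \<Longrightarrow> 1 + \<bar>t\<bar> \<le> 2 ^ Suc k \<Longrightarrow> norm (cauchy_sum B c (of_int n + 1/2 + \<i> * of_real t)) \<le> Q n k"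
  shows "norm (\<Sum>i\<in>{i\<in>B. i \<noteq> m \<and> i \<noteq> - m}. c i * of_real (branch_kernel \<alpha> \<beta> m i))
    \<le> 2 * (\<Sum>k<K. (dyadic_weight \<alpha> \<beta> m k + dyadic_weight \<beta> \<alpha> m k) * (Q m k + Q (m - 1) k + Q (- m) k + Q (- m - 1) k))
      + 6 * ((\<Sum>i\<in>B. norm (c i)) * (2 ^ K - 1) powr (-(\<alpha> + \<beta>)))"
proof -
  have Q0: "Q n k \<ge> 0" for n k by (rule order_trans[OF norm_ge_zero Q[of k "2 ^ k - 1"]]) auto
  let ?t = "\<lambda>i. c i * of_real (branch_kernel \<alpha> \<beta> m i)"
  define E where "E = (\<Sum>i\<in>B. norm (c i)) * (2 ^ K - 1) powr (-(\<alpha> + \<beta>))"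
  have E0: "E \<ge> 0" by (auto simp: E_def intro!: mult_nonneg_nonneg sum_nonneg)
  let ?w = "dyadic_weight \<alpha> \<beta> m" and ?w' = "dyadic_weight \<beta> \<alpha> m"
  have right: "norm (\<Sum>i\<in>{i\<in>B. i > m}. ?t i) \<le> 2 * (\<Sum>k<K. ?w k * Q m k) + 2 * E"
    unfolding E_def by (rule norm_sum_kern_right_le[OF ab m B R(1,3) Q])
  have left: "norm (\<Sum>i\<in>{i\<in>B. i < - m}. ?t i) \<le> 2 * (\<Sum>k<K. ?w' k * Q (- m - 1) k) + 2 * E"
    unfolding E_def by (rule norm_sum_kern_left_le[OF ab m B R(1,3) Q])
  have middle: "norm (\<Sum>i\<in>{i\<in>B. \<bar>i\<bar> < m}. ?t i) \<le> 2 * (\<Sum>k<K. ?w k * Q (m - 1) k + ?w' k * Q (- m) k) + 2 * E"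
  proof (cases "m = 0")
    case True
    then have "{i\<in>B. \<bar>i\<bar> < m} = {}" by auto
    then show ?thesis using Q0 E0 by (simp only: sum.empty norm_zero) (auto intro!: add_nonneg_nonneg mult_nonneg_nonneg sum_nonneg)
  next
    case False
    then have "m \<ge> 1" using m by simp
    then show ?thesis unfolding E_def by (rule norm_sum_kern_middle_le[OF ab _ B R(2,3) Q Q])
  qed
  have tri: "norm (x + (y + z)) \<le> norm x + (norm y + norm z)" for x y z :: complex
    by (rule order_trans[OF norm_triangle_ineq add_left_mono[OF norm_triangle_ineq]])
  have "{i\<in>B. i \<noteq> m \<and> i \<noteq> - m} = {i\<in>B. i > m} \<union> ({i\<in>B. i < - m} \<union> {i\<in>B. \<bar>i\<bar> < m})"
    using m by auto
  moreover have "sum ?t ({i\<in>B. i > m} \<union> ({i\<in>B. i < - m} \<union> {i\<in>B. \<bar>i\<bar> < m})) =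
      sum ?t {i\<in>B. i > m} + sum ?t ({i\<in>B. i < - m} \<union> {i\<in>B. \<bar>i\<bar> < m})"
    using B m by (intro sum.union_disjoint) auto
  moreover have "sum ?t ({i\<in>B. i < - m} \<union> {i\<in>B. \<bar>i\<bar> < m}) = sum ?t {i\<in>B. i < - m} + sum ?t {i\<in>B. \<bar>i\<bar> < m}"
    using B m by (intro sum.union_disjoint) auto
  ultimately have "(\<Sum>i\<in>{i\<in>B. i \<noteq> m \<and> i \<noteq> - m}. ?t i) = (\<Sum>i\<in>{i\<in>B. i > m}. ?t i) + ((\<Sum>i\<in>{i\<in>B. i < - m}. ?t i) + (\<Sum>i\<in>{i\<in>B. \<bar>i\<bar> < m}. ?t i))"
    by (simp only:)
  then have "norm (\<Sum>i\<in>{i\<in>B. i \<noteq> m \<and> i \<noteq> - m}. ?t i) \<le> norm (\<Sum>i\<in>{i\<in>B. i > m}. ?t i) + (norm (\<Sum>i\<in>{i\<in>B. i < - m}. ?t i) + norm (\<Sum>i\<in>{i\<in>B. \<bar>i\<bar> < m}. ?t i))"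
    by (simp only: tri)
  also have "\<dots> \<le> (2 * (\<Sum>k<K. ?w k * Q m k) + 2 * E) + ((2 * (\<Sum>k<K. ?w' k * Q (- m - 1) k) + 2 * E) + (2 * (\<Sum>k<K. ?w k * Q (m - 1) k + ?w' k * Q (- m) k) + 2 * E))"
    by (intro add_mono left right middle)
  also have "\<dots> = 2 * (\<Sum>k<K. ?w k * Q m k + ?w' k * Q (- m - 1) k + (?w k * Q (m - 1) k + ?w' k * Q (- m) k)) + 6 * E"
    by (simp add: sum.distrib)
  also have "\<dots> \<le> 2 * (\<Sum>k<K. (?w k + ?w' k) * (Q m k + Q (m - 1) k + Q (- m) k + Q (- m - 1) k)) + 6 * E"
  proof -
    have "w * q1 + w' * q4 + (w * q2 + w' * q3) \<le> (w + w') * (q1 + q2 + q3 + q4)"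
      if "w \<ge> 0" "w' \<ge> 0" "q1 \<ge> 0" "q2 \<ge> 0" "q3 \<ge> 0" "q4 \<ge> 0" for w w' q1 q2 q3 q4 :: real
      using that by (simp add: algebra_simps add_nonneg_nonneg)
    then show ?thesis using Q0 by (intro add_right_mono mult_left_mono sum_mono) auto
  qed
  finally show ?thesis by (simp add: E_def)
qed

lemma norm_sum_kern_le:
  assumes ab: "0 \<le> \<alpha>" "0 \<le> \<beta>" "\<alpha> + \<beta> \<le> 1" and B: "finite B"
    and R: "1 \<le> (2::real) ^ K - 1" "2 * \<bar>of_int j\<bar> \<le> (2::real) ^ K - 1" "\<And>i. i \<in> B \<Longrightarrow> 2 * \<bar>of_int i\<bar> \<le> (2::real) ^ K - 1"
    and Q: "\<And>n k t. 2 ^ k \<le> 1 + \<bar>t\<bar> \<Longrightarrow> 1 + \<bar>t\<bar> \<le> 2 ^ Suc k \<Longrightarrow> norm (cauchy_sum B c (of_int n + 1/2 + \<i> * of_real t)) \<le> Q n k"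
  shows "norm (\<Sum>i\<in>{i\<in>B. i \<noteq> j \<and> i \<noteq> - j}. c i * of_real (branch_kernel \<alpha> \<beta> j i))
    \<le> 2 * (\<Sum>k<K. (dyadic_weight \<alpha> \<beta> j k + dyadic_weight \<beta> \<alpha> j k) * (Q j k + Q (j - 1) k + Q (- j) k + Q (- j - 1) k))
      + 6 * ((\<Sum>i\<in>B. norm (c i)) * (2 ^ K - 1) powr (-(\<alpha> + \<beta>)))"
proof (cases "j \<ge> 0")
  case True
  then show ?thesis using R by (intro norm_sum_kern_nonneg_le[OF ab True B] Q) auto
next
  case False
  have "norm (\<Sum>i\<in>{i\<in>B. i \<noteq> - j \<and> i \<noteq> - (- j)}. c i * of_real (branch_kernel \<beta> \<alpha> (- j) i))
    \<le> 2 * (\<Sum>k<K. (dyadic_weight \<beta> \<alpha> (- j) k + dyadic_weight \<alpha> \<beta> (- j) k) * (Q (- j) k + Q (- j - 1) k + Q (- (- j)) k + Q (- (- j) - 1) k))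
      + 6 * ((\<Sum>i\<in>B. norm (c i)) * (2 ^ K - 1) powr (-(\<beta> + \<alpha>)))"
    using False R ab by (intro norm_sum_kern_nonneg_le B Q) auto
  moreover have "{i\<in>B. i \<noteq> - j \<and> i \<noteq> - (- j)} = {i\<in>B. i \<noteq> j \<and> i \<noteq> - j}" by auto
  moreover have "branch_kernel \<beta> \<alpha> (- j) i = branch_kernel \<alpha> \<beta> j i" for i by (simp add: branch_kernel_def mult.commute)
  moreover have "dyadic_weight a b (- j) k = dyadic_weight a b j k" for a b k by (simp add: dyadic_weight_def)
  ultimately show ?thesis by (simp add: add_ac)
qed

lemma branch_kernel_le_1: "0 \<le> \<alpha> \<Longrightarrow> 0 \<le> \<beta> \<Longrightarrow> i \<noteq> j \<Longrightarrow> i \<noteq> - j \<Longrightarrow> branch_kernel \<alpha> \<beta> j i \<le> 1"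
proof -
  assume *: "0 \<le> \<alpha>" "0 \<le> \<beta>" "i \<noteq> j" "i \<noteq> - j"
  then have "\<bar>i - j\<bar> \<ge> 1" "\<bar>i + j\<bar> \<ge> 1" by linarith+
  then have "\<bar>real_of_int (i - j)\<bar> \<ge> 1" "\<bar>real_of_int (i + j)\<bar> \<ge> 1" by linarith+
  then have "\<bar>real_of_int (i - j)\<bar> powr (-\<alpha>) \<le> 1 powr (-\<alpha>)" "\<bar>real_of_int (i + j)\<bar> powr (-\<beta>) \<le> 1 powr (-\<beta>)"
    using * by (intro powr_mono2'; simp)+
  then have "branch_kernel \<alpha> \<beta> j i \<le> 1 * 1" unfolding branch_kernel_def by (intro mult_mono) auto
  then show ?thesis by simp
qed

lemma branch_kernel_nonneg [simp]: "branch_kernel \<alpha> \<beta> j i \<ge> 0"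
  by (simp add: branch_kernel_def)

lemma dyadic_weight_le:
  assumes "0 \<le> \<beta>"
  shows "dyadic_weight \<alpha> \<beta> j k / 2 ^ k \<le> (2 powr (-(\<alpha> + \<beta>))) ^ k"
proof -
  have "dyadic_weight \<alpha> \<beta> j k / 2 ^ k = ((2 ^ k) powr (1 - \<alpha>) / (2 ^ k) powr 1) * (\<bar>of_int j\<bar> + 2 ^ k) powr (-\<beta>)"
    by (simp add: dyadic_weight_def)
  also have "(2 ^ k) powr (1 - \<alpha>) / (2 ^ k) powr (1::real) = (2 ^ k) powr (-\<alpha>)"
    unfolding powr_diff [symmetric] by simp
  also have "(2 ^ k) powr (-\<alpha>) * (\<bar>of_int j\<bar> + 2 ^ k) powr (-\<beta>) \<le> (2 ^ k) powr (-\<alpha>) * (2 ^ k) powr (-\<beta>)"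
    using assms by (intro mult_left_mono powr_mono2') auto
  also have "\<dots> = (2 ^ k) powr (-(\<alpha> + \<beta>))" unfolding powr_add [symmetric] by simp
  also have "\<dots> = (2 powr real k) powr (-(\<alpha> + \<beta>))" by (simp add: powr_realpow)
  also have "\<dots> = (2 powr (-(\<alpha> + \<beta>))) powr real k" unfolding powr_powr by (simp only: mult.commute)
  also have "\<dots> = (2 powr (-(\<alpha> + \<beta>))) ^ k" by (intro powr_realpow) simp
  finally show ?thesis .
qed

text \<open>For a finite truncation, letting K grow removes the far sides of the rectangles. The
  tail, of mass \<tau>, enters twice: directly, where the kernel is at most 1, and through the
  Cauchy transform, where its contribution 4\<tau>/2^k is summable against the dyadic weights. Both
  parts vanish with \<tau>.\<close>

lemma norm_T_op_le:
  assumes ab: "0 < \<alpha>" "0 < \<beta>" "\<alpha> + \<beta> \<le> 1" and b: "(\<lambda>i. norm (b i)) summable_on UNIV"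
    and Q: "\<And>n k t. 2 ^ k \<le> 1 + \<bar>t\<bar> \<Longrightarrow> 1 + \<bar>t\<bar> \<le> 2 ^ Suc k \<Longrightarrow> norm (cauchy_transform b (of_int n + 1/2 + \<i> * of_real t)) \<le> Q n k"
    and Y: "\<And>K. 2 * (\<Sum>k<K. (dyadic_weight \<alpha> \<beta> j k + dyadic_weight \<beta> \<alpha> j k) * (Q j k + Q (j - 1) k + Q (- j) k + Q (- j - 1) k)) \<le> Y"
  shows "norm (T_op \<alpha> \<beta> b j) \<le> Y"
proof (rule field_le_epsilon)
  fix e :: real assume e: "e > 0"
  define x where "x = 2 powr (-(\<alpha> + \<beta>))"
  have x: "0 < x" "x < 1" using ab by (simp_all add: x_def powr_less_one)
  \<comment> \<open>The 1 is for the tail of the operator itself. In 64, four lines contribute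
    4\<tau> each, the two weights divided by 2^k are at most x^k each, and the last factor 2 is the
    prefactor in \<open>Y\<close>.\<close>
  define G where "G = 1 + 64 / (1 - x)"
  have G: "G > 0" using x by (simp add: G_def add_pos_nonneg)
  obtain B where B: "finite B" "(\<Sum>\<^sub>\<infinity>i\<in>-B. norm (b i)) < e / G"
    using infsum_tail_less[OF b, of "e / G" "{}"] e G by auto
  define \<tau> where "\<tau> = (\<Sum>\<^sub>\<infinity>i\<in>-B. norm (b i))"
  have \<tau>0: "\<tau> \<ge> 0" by (auto simp: \<tau>_def intro: infsum_nonneg)
  define A where "A = {i. i \<noteq> j \<and> i \<noteq> - j}"
  define f where "f = (\<lambda>i. b i * of_real (branch_kernel \<alpha> \<beta> j i))"
  have T: "T_op \<alpha> \<beta> b j = infsum f A"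
    unfolding T_op_def A_def f_def branch_kernel_def
    by (intro infsum_cong) (simp add: powr_minus field_simps)
  have fb: "norm (f i) \<le> norm (b i)" if "i \<in> A" for i
  proof -
    have "norm (b i) * branch_kernel \<alpha> \<beta> j i \<le> norm (b i) * 1"
      using that ab by (intro mult_left_mono branch_kernel_le_1) (auto simp: A_def)
    then show ?thesis by (simp add: f_def norm_mult)
  qed
  have sm: "(\<lambda>i. norm (f i)) summable_on A'" if "A' \<subseteq> A" for A'
    by (rule summable_on_comparison_test[OF summable_on_subset_banach[OF b, of A']]) (use fb that in auto)
  then have sm': "f summable_on A'" if "A' \<subseteq> A" for A' using that by (blast intro: abs_summable_summable)
  have "infsum f ((A \<inter> B) \<union> (A - B)) = infsum f (A \<inter> B) + infsum f (A - B)"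
    by (intro infsum_Un_disjoint sm') auto
  moreover have "(A \<inter> B) \<union> (A - B) = A" by auto
  ultimately have split: "infsum f A = sum f (A \<inter> B) + infsum f (A - B)" using B by simp
  have "norm (infsum f (A - B)) \<le> infsum (\<lambda>i. norm (f i)) (A - B)"
    by (rule norm_infsum_bound[OF sm]) auto
  also have "\<dots> \<le> infsum (\<lambda>i. norm (b i)) (- B)"
    by (intro infsum_mono_neutral sm summable_on_subset_banach[OF b]) (auto intro: fb)
  finally have tail: "norm (infsum f (A - B)) \<le> \<tau>" by (simp add: \<tau>_def)
  have Q0: "Q n k \<ge> 0" for n k by (rule order_trans[OF norm_ge_zero Q[of k "2 ^ k - 1"]]) auto
  define E where "E = (\<lambda>K::nat. 6 * ((\<Sum>i\<in>B. norm (b i)) * (2 ^ K - 1) powr (-(\<alpha> + \<beta>))))"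
  have fin: "norm (sum f (A \<inter> B)) \<le> Y + 64 / (1 - x) * \<tau> + E K"
    if K: "1 \<le> (2::real) ^ K - 1" "2 * \<bar>of_int j\<bar> \<le> (2::real) ^ K - 1" "\<forall>i\<in>B. 2 * \<bar>of_int i\<bar> \<le> (2::real) ^ K - 1" for K
  proof -
    define Q' where "Q' = (\<lambda>n k. Q n k + 4 * \<tau> / 2 ^ k)"
    let ?w = "\<lambda>k. dyadic_weight \<alpha> \<beta> j k + dyadic_weight \<beta> \<alpha> j k"
    have "norm (\<Sum>i\<in>{i\<in>B. i \<noteq> j \<and> i \<noteq> - j}. b i * of_real (branch_kernel \<alpha> \<beta> j i))
      \<le> 2 * (\<Sum>k<K. ?w k * (Q' j k + Q' (j - 1) k + Q' (- j) k + Q' (- j - 1) k)) + E K"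
      unfolding E_def
    proof (rule norm_sum_kern_le)
      fix n k and t :: real assume t: "2 ^ k \<le> 1 + \<bar>t\<bar>" "1 + \<bar>t\<bar> \<le> 2 ^ Suc k"
      let ?z = "of_int n + 1/2 + \<i> * complex_of_real t"
      have "norm (cauchy_transform b ?z - cauchy_sum B b ?z) \<le> 4 * \<tau> / (1 + \<bar>t\<bar>)"
        unfolding \<tau>_def by (rule norm_cauchy_diff_le[OF b B(1)])
      also have "\<dots> \<le> 4 * \<tau> / 2 ^ k" using t \<tau>0 by (intro divide_left_mono) auto
      finally have "norm (cauchy_transform b ?z - cauchy_sum B b ?z) \<le> 4 * \<tau> / 2 ^ k" .
      moreover have "norm (cauchy_sum B b ?z) \<le> norm (cauchy_transform b ?z) + norm (cauchy_transform b ?z - cauchy_sum B b ?z)"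
        using norm_triangle_ineq4[of "cauchy_transform b ?z" "cauchy_transform b ?z - cauchy_sum B b ?z"] by simp
      ultimately show "norm (cauchy_sum B b ?z) \<le> Q' n k" using Q[OF t, of n] by (simp add: Q'_def)
    qed (use ab B K in auto)
    also have "(\<Sum>k<K. ?w k * (Q' j k + Q' (j - 1) k + Q' (- j) k + Q' (- j - 1) k)) =
       (\<Sum>k<K. ?w k * (Q j k + Q (j - 1) k + Q (- j) k + Q (- j - 1) k)) + (\<Sum>k<K. 16 * \<tau> * (?w k / 2 ^ k))"
      unfolding sum.distrib [symmetric] by (intro sum.cong) (simp_all add: Q'_def algebra_simps)
    also have "(\<Sum>k<K. 16 * \<tau> * (?w k / 2 ^ k)) \<le> (\<Sum>k<K. 16 * \<tau> * (2 * x ^ k))"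
    proof (intro sum_mono mult_left_mono)
      fix k
      have "dyadic_weight \<alpha> \<beta> j k / 2 ^ k \<le> x ^ k" "dyadic_weight \<beta> \<alpha> j k / 2 ^ k \<le> x ^ k"
        using dyadic_weight_le[of \<beta> \<alpha> j k] dyadic_weight_le[of \<alpha> \<beta> j k] ab by (simp_all add: x_def add.commute)
      then show "?w k / 2 ^ k \<le> 2 * x ^ k" by (simp add: add_divide_distrib)
    qed (use \<tau>0 in auto)
    also have "(\<Sum>k<K. 16 * \<tau> * (2 * x ^ k)) = 32 * \<tau> * (\<Sum>k<K. x ^ k)"
      by (simp add: sum_distrib_left mult.assoc)
    also have "\<dots> \<le> 32 * \<tau> * (1 / (1 - x))"
      using x \<tau>0 by (intro mult_left_mono) (auto simp: sum_gp_strict divide_right_mono)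
    finally have "norm (\<Sum>i\<in>{i\<in>B. i \<noteq> j \<and> i \<noteq> - j}. b i * of_real (branch_kernel \<alpha> \<beta> j i))
      \<le> 2 * (\<Sum>k<K. ?w k * (Q j k + Q (j - 1) k + Q (- j) k + Q (- j - 1) k)) + 64 / (1 - x) * \<tau> + E K"
      by (simp add: algebra_simps)
    moreover have "{i\<in>B. i \<noteq> j \<and> i \<noteq> - j} = A \<inter> B" by (auto simp: A_def)
    ultimately show ?thesis using Y[of K] by (simp add: f_def)
  qed
  have "E \<longlonglongrightarrow> 6 * ((\<Sum>i\<in>B. norm (b i)) * 0)"
    unfolding E_def
  proof (intro tendsto_intros tendsto_neg_powr)
    show "filterlim (\<lambda>K::nat. (2::real) ^ K - 1) at_top sequentially" by real_asymp
  qed (use ab in auto)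
  then have lim: "(\<lambda>K. Y + 64 / (1 - x) * \<tau> + E K) \<longlonglongrightarrow> Y + 64 / (1 - x) * \<tau> + 0"
    by (intro tendsto_intros) auto
  have at_top: "filterlim (\<lambda>K::nat. (2::real) ^ K - 1) at_top sequentially" by real_asymp
  then have ev: "eventually (\<lambda>K. c \<le> (2::real) ^ K - 1) sequentially" for c
    unfolding filterlim_at_top by blast
  have "eventually (\<lambda>K. 1 \<le> (2::real) ^ K - 1 \<and> 2 * \<bar>of_int j\<bar> \<le> (2::real) ^ K - 1 \<and> (\<forall>i\<in>B. 2 * \<bar>of_int i\<bar> \<le> (2::real) ^ K - 1)) sequentially"
    by (intro eventually_conj eventually_ball_finite[OF B(1)] ballI ev)
  then have "eventually (\<lambda>K. norm (sum f (A \<inter> B)) \<le> Y + 64 / (1 - x) * \<tau> + E K) sequentially"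
    by (rule eventually_mono) (use fin in auto)
  then have "norm (sum f (A \<inter> B)) \<le> Y + 64 / (1 - x) * \<tau> + 0"
    by (intro tendsto_lowerbound[OF lim]) auto
  then have "norm (T_op \<alpha> \<beta> b j) \<le> Y + G * \<tau>"
    using tail norm_triangle_ineq[of "sum f (A \<inter> B)" "infsum f (A - B)"]
    unfolding T split by (simp add: G_def algebra_simps)
  also have "G * \<tau> \<le> e" using B(2) G by (simp add: \<tau>_def field_simps)
  finally show "norm (T_op \<alpha> \<beta> b j) \<le> Y + e" by simp
qed

subsection \<open>The norm inequality\<close>

text \<open>A substitute for subadditivity at exponents such as 2/p, 1/p and q, which may exceed
  1.\<close>

lemma powr_add_le_double:
  fixes x y :: real
  assumes "x \<ge> 0" "y \<ge> 0" "s \<ge> 0"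
  shows "(x + y) powr s \<le> 2 powr s * (x powr s + y powr s)"
proof -
  have "(x + y) powr s \<le> (2 * max x y) powr s" using assms by (intro powr_mono2) auto
  also have "\<dots> = 2 powr s * (max x y) powr s" by (simp add: powr_mult)
  also have "(max x y) powr s \<le> x powr s + y powr s" by (simp add: max_def)
  finally show ?thesis by (simp add: mult_left_mono)
qed

text \<open>For summable b this is the least bound that can serve as \<open>Q\<close> in
  \<open>norm_T_op_le\<close>. Being free of M and e, it survives the limit in which e tends to
  0.\<close>

definition cauchy_sup :: "(int \<Rightarrow> complex) \<Rightarrow> int \<Rightarrow> nat \<Rightarrow> real" where
  "cauchy_sup b n k = (SUP t\<in>{t. 2 ^ k \<le> 1 + \<bar>t\<bar> \<and> 1 + \<bar>t\<bar> \<le> 2 ^ Suc k}. norm (cauchy_transform b (of_int n + 1/2 + \<i> * of_real t)))"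

lemma norm_cauchy_le_cauchy_sup:
  assumes "(\<lambda>i. norm (b i)) summable_on UNIV" "2 ^ k \<le> 1 + \<bar>t\<bar>" "1 + \<bar>t\<bar> \<le> 2 ^ Suc k"
  shows "norm (cauchy_transform b (of_int n + 1/2 + \<i> * of_real t)) \<le> cauchy_sup b n k"
  unfolding cauchy_sup_def
  by (rule cSUP_upper) (use assms norm_cauchy_le[OF assms(1)] in \<open>auto intro!: bdd_aboveI\<close>)

lemma cauchy_sup_nonneg:
  assumes "(\<lambda>i. norm (b i)) summable_on UNIV"
  shows "cauchy_sup b n k \<ge> 0"
  by (rule order_trans[OF norm_ge_zero norm_cauchy_le_cauchy_sup[OF assms, of k "2 ^ k - 1"]]) auto

lemma cauchy_sup_le:
  assumes "\<And>t. 2 ^ k \<le> 1 + \<bar>t\<bar> \<Longrightarrow> 1 + \<bar>t\<bar> \<le> 2 ^ Suc k \<Longrightarrow> norm (cauchy_transform b (of_int n + 1/2 + \<i> * of_real t)) \<le> c"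
  shows "cauchy_sup b n k \<le> c"
  unfolding cauchy_sup_def
proof (rule cSUP_least)
  have "2 ^ k - 1 \<in> {t::real. 2 ^ k \<le> 1 + \<bar>t\<bar> \<and> 1 + \<bar>t\<bar> \<le> 2 ^ Suc k}" by auto
  then show "{t::real. 2 ^ k \<le> 1 + \<bar>t\<bar> \<and> 1 + \<bar>t\<bar> \<le> 2 ^ Suc k} \<noteq> {}" by blast
qed (use assms in auto)

lemma poisson_le_of_double:
  assumes "0 < N" "N \<le> N'" "N' \<le> 2 * N"
  shows "poisson N' u \<le> 2 * poisson N u"
proof -
  have "N' / (N'\<^sup>2 + u\<^sup>2) \<le> (2 * N) / (N\<^sup>2 + u\<^sup>2)"
    using assms by (intro frac_le add_right_mono power_mono) (auto intro: add_pos_nonneg)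
  then show ?thesis by (simp add: poisson_def)
qed

definition boundary_data :: "real \<Rightarrow> (int \<Rightarrow> complex) \<Rightarrow> int \<Rightarrow> real" where
  "boundary_data r b k = norm (b k) powr r + norm (cauchy_transform b (of_int k + 1/2)) powr r"

text \<open>The pointwise estimate has an error e and a set M that varies with e, but its main term
  is bounded by the square sum of the full data, uniformly in M. As J and K are finite, the error
  has bounded total weight and disappears in the limit.\<close>

lemma sum_powr_dyadic_cauchy_sup_le:
  fixes \<alpha> \<beta> \<gamma> p q :: real
  assumes ab: "0 \<le> \<gamma>" "0 < \<alpha>" "0 < \<beta>" "\<alpha> + \<beta> = 1 - \<gamma>" and pq: "0 < p" "p \<le> 1" "0 < q" "1 / q = 1 / p - \<gamma>"
  shows "\<exists>C>0. \<forall>b J K. (\<lambda>i. norm (b i)) summable_on UNIV \<longrightarrow> (\<lambda>k. (boundary_data (p / 2) b k)\<^sup>2) summable_on UNIV \<longrightarrow> finite J \<longrightarrow>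
    (\<Sum>n\<in>J. (\<Sum>k<K. dyadic_weight \<alpha> \<beta> n k * cauchy_sup b n k) powr q) \<le> C * (\<Sum>\<^sub>\<infinity>k. (boundary_data (p / 2) b k)\<^sup>2) powr (q / p)"
proof -
  define r where "r = p / 2"
  define s where "s = 2 / p"
  have r: "0 < r" "r \<le> 1" and s: "s > 0" "r * s = 1" using pq by (auto simp: r_def s_def)
  obtain A where A: "A > 0 \<and> (\<forall>b e. (\<lambda>i. norm (b i)) summable_on UNIV \<longrightarrow>
    (\<lambda>k. (norm (b k) powr r + norm (cauchy_transform b (of_int k + 1/2)) powr r)\<^sup>2) summable_on UNIV \<longrightarrow> e > 0 \<longrightarrow>
    (\<exists>M. finite M \<and> (\<forall>n t. norm (cauchy_transform b (of_int n + 1/2 + \<i> * of_real t)) powr r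
       \<le> A * poisson_sum (\<lambda>k. norm (b k) powr r + norm (cauchy_transform b (of_int k + 1/2)) powr r) M (1 + \<bar>t\<bar>) n + e)))"
    using cauchy_transform_powr_le[OF r] ..
  then have A0: "A > 0" by (rule conjunct1)
  obtain C0 where C0: "C0 > 0" "\<And>f M J K. (\<And>m. f m \<ge> 0) \<Longrightarrow> finite M \<Longrightarrow> finite J \<Longrightarrow>
      (\<Sum>j\<in>J. (\<Sum>k<K. (2 ^ k) powr (1 - \<alpha>) * (\<bar>of_int j\<bar> + 2 ^ k) powr (-\<beta>) * poisson_sum f M (2 ^ k) j powr (2 / p)) powr q)
      \<le> C0 * (\<Sum>m\<in>M. (f m)\<^sup>2) powr (q / p)"
    by (rule sum_powr_dyadic_poisson_fractional_le[OF ab(1,3,4) pq(1,3,4)]) blast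
  define c where "c = 2 powr s * (2 * A) powr s"
  have c0: "c > 0" using A0 by (simp add: c_def)
  define C where "C = 2 powr q * c powr q * C0"
  have "(\<Sum>n\<in>J. (\<Sum>k<K. dyadic_weight \<alpha> \<beta> n k * cauchy_sup b n k) powr q) \<le> C * (\<Sum>\<^sub>\<infinity>k. (boundary_data r b k)\<^sup>2) powr (q / p)"
    if b: "(\<lambda>i. norm (b i)) summable_on UNIV" and f2: "(\<lambda>k. (boundary_data r b k)\<^sup>2) summable_on UNIV" and J: "finite J" for b J K
  proof -
    define f where "f = boundary_data r b"
    define X where "X = (\<Sum>\<^sub>\<infinity>k. (f k)\<^sup>2)"
    have f0: "f k \<ge> 0" for k by (simp add: f_def boundary_data_def)
    have f2': "(\<lambda>k. (norm (b k) powr r + norm (cauchy_transform b (of_int k + 1/2)) powr r)\<^sup>2) summable_on UNIV"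
      using f2 by (simp add: boundary_data_def)
    have fM: "(\<Sum>m\<in>M. (f m)\<^sup>2) \<le> X" if "finite M" for M
      unfolding X_def using f2 that by (intro finite_sum_le_infsum) (auto simp: f_def)
    \<comment> \<open>This majorises the weight of the error on every n in J; the added 1 keeps it
      positive even when J or K is empty.\<close>
    define W where "W = 1 + (\<Sum>n\<in>J. \<Sum>k<K. dyadic_weight \<alpha> \<beta> n k)"
    have W: "W \<ge> 1" by (simp add: W_def sum_nonneg)
    have bound: "(\<Sum>n\<in>J. (\<Sum>k<K. dyadic_weight \<alpha> \<beta> n k * cauchy_sup b n k) powr q) \<le> C * X powr (q / p) + 2 powr q * real (card J) * d powr q"
      if d: "d > 0" for d
    proof -
      \<comment> \<open>As r s = 1, this gives 2^s e^s W = d, so the error in each inner sum is at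
        most d.\<close>
      define e where "e = (d / (2 powr s * W)) powr r"
      have e: "e > 0" using d W by (simp add: e_def)
      have es: "e powr s = d / (2 powr s * W)" using d W s by (simp add: e_def powr_powr)
      obtain M where M: "finite M" "\<And>n t. norm (cauchy_transform b (of_int n + 1/2 + \<i> * of_real t)) powr r \<le> A * poisson_sum f M (1 + \<bar>t\<bar>) n + e"
        using conjunct2[OF A, rule_format, OF b f2' e] unfolding f_def boundary_data_def by blast
      define U where "U = (\<lambda>n k. poisson_sum f M (2 ^ k) n)"
      have U: "U n k \<ge> 0" for n k unfolding U_def using f0 by (intro poisson_sum_nonneg) auto
      have sup: "cauchy_sup b n k \<le> c * U n k powr s + 2 powr s * e powr s" for n k
      proof (rule cauchy_sup_le)
        fix t :: real assume t: "2 ^ k \<le> 1 + \<bar>t\<bar>" "1 + \<bar>t\<bar> \<le> 2 ^ Suc k"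
        have "poisson_sum f M (1 + \<bar>t\<bar>) n \<le> (\<Sum>m\<in>M. f m * (2 * poisson (2 ^ k) (of_int (n - m))))"
          unfolding poisson_sum_def using t f0 by (intro sum_mono mult_left_mono poisson_le_of_double) auto
        also have "\<dots> = 2 * U n k" by (simp add: U_def poisson_sum_def sum_distrib_left mult_ac)
        finally have "A * poisson_sum f M (1 + \<bar>t\<bar>) n \<le> A * (2 * U n k)" using A0 by (intro mult_left_mono) auto
        then have "norm (cauchy_transform b (of_int n + 1/2 + \<i> * of_real t)) powr r \<le> 2 * A * U n k + e"
          using M(2)[of n t] by simp
        then have "(norm (cauchy_transform b (of_int n + 1/2 + \<i> * of_real t)) powr r) powr s \<le> (2 * A * U n k + e) powr s"
          using s by (intro powr_mono2) auto
        also have "\<dots> \<le> 2 powr s * ((2 * A * U n k) powr s + e powr s)"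
          using A0 U e s by (intro powr_add_le_double) auto
        also have "\<dots> = c * U n k powr s + 2 powr s * e powr s"
          using A0 U by (simp add: c_def powr_mult algebra_simps)
        finally show "norm (cauchy_transform b (of_int n + 1/2 + \<i> * of_real t)) \<le> c * U n k powr s + 2 powr s * e powr s"
          using s by (simp add: powr_powr)
      qed
      define D where "D = (\<lambda>n. \<Sum>k<K. dyadic_weight \<alpha> \<beta> n k * U n k powr s)"
      have D0: "D n \<ge> 0" for n unfolding D_def by (intro sum_nonneg mult_nonneg_nonneg) auto
      have main: "(\<Sum>k<K. dyadic_weight \<alpha> \<beta> n k * cauchy_sup b n k) powr q \<le> 2 powr q * (c powr q * D n powr q + d powr q)" if n: "n \<in> J" for n
      proof -
        have "(\<Sum>k<K. dyadic_weight \<alpha> \<beta> n k * cauchy_sup b n k) \<le> (\<Sum>k<K. dyadic_weight \<alpha> \<beta> n k * (c * U n k powr s + 2 powr s * e powr s))"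
          by (intro sum_mono mult_left_mono sup) auto
        also have "\<dots> = c * D n + (2 powr s * e powr s) * (\<Sum>k<K. dyadic_weight \<alpha> \<beta> n k)"
          by (simp add: D_def sum_distrib_left sum.distrib algebra_simps)
        also have "(\<Sum>k<K. dyadic_weight \<alpha> \<beta> n k) \<le> W"
        proof -
          have "(\<Sum>k<K. dyadic_weight \<alpha> \<beta> n k) \<le> (\<Sum>n\<in>J. \<Sum>k<K. dyadic_weight \<alpha> \<beta> n k)"
            using n J by (intro member_le_sum[of n J "\<lambda>n. \<Sum>k<K. dyadic_weight \<alpha> \<beta> n k"] sum_nonneg) auto
          then show ?thesis by (simp add: W_def)
        qed
        also have "(2 powr s * e powr s) * W = d" using W by (simp add: es)
        finally have "(\<Sum>k<K. dyadic_weight \<alpha> \<beta> n k * cauchy_sup b n k) \<le> c * D n + d"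
          by (simp add: mult_left_mono)
        then have "(\<Sum>k<K. dyadic_weight \<alpha> \<beta> n k * cauchy_sup b n k) powr q \<le> (c * D n + d) powr q"
          using pq b by (intro powr_mono2 sum_nonneg mult_nonneg_nonneg cauchy_sup_nonneg) auto
        also have "\<dots> \<le> 2 powr q * ((c * D n) powr q + d powr q)"
          using c0 D0 d pq by (intro powr_add_le_double) auto
        finally show ?thesis using c0 D0 by (simp add: powr_mult)
      qed
      have "(\<Sum>n\<in>J. (\<Sum>k<K. dyadic_weight \<alpha> \<beta> n k * cauchy_sup b n k) powr q) \<le> (\<Sum>n\<in>J. 2 powr q * (c powr q * D n powr q + d powr q))"
        by (intro sum_mono main)
      also have "\<dots> = 2 powr q * c powr q * (\<Sum>n\<in>J. D n powr q) + 2 powr q * real (card J) * d powr q"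
        by (simp add: sum_distrib_left sum.distrib algebra_simps)
      also have "(\<Sum>n\<in>J. D n powr q) \<le> C0 * (\<Sum>m\<in>M. (f m)\<^sup>2) powr (q / p)"
        using C0(2)[OF f0 M(1) J, where K = K] by (simp add: D_def U_def dyadic_weight_def s_def)
      also have "\<dots> \<le> C0 * X powr (q / p)"
        using C0(1) fM[OF M(1)] pq by (intro mult_left_mono powr_mono2 sum_nonneg) auto
      finally show ?thesis by (simp add: C_def mult_left_mono mult.assoc)
    qed
    have "((\<lambda>d. C * X powr (q / p) + 2 powr q * real (card J) * d powr q) \<longlongrightarrow> C * X powr (q / p) + 2 powr q * real (card J) * 0 powr q) (at_right 0)"
      using pq by (intro tendsto_intros) (auto intro!: eventually_mono[OF eventually_at_right_less])
    moreover have "eventually (\<lambda>d. (\<Sum>n\<in>J. (\<Sum>k<K. dyadic_weight \<alpha> \<beta> n k * cauchy_sup b n k) powr q) \<le> C * X powr (q / p) + 2 powr q * real (card J) * d powr q) (at_right 0)"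
      using eventually_at_right_less[of 0] by (rule eventually_mono) (rule bound)
    ultimately have "(\<Sum>n\<in>J. (\<Sum>k<K. dyadic_weight \<alpha> \<beta> n k * cauchy_sup b n k) powr q) \<le> C * X powr (q / p) + 2 powr q * real (card J) * 0 powr q"
      by (rule tendsto_lowerbound) auto
    then show ?thesis using pq by (simp add: X_def f_def)
  qed
  moreover have "C > 0" using c0 C0(1) by (simp add: C_def)
  ultimately show ?thesis unfolding r_def by blast
qed

section \<open>Boundary data of Hardy space sequences and the limit of many blocks\<close>

lemma lp_space_imp_summable:
  assumes "b \<in> lp_space p" "0 < p" "p \<le> 1"
  shows "(\<lambda>i. norm (b i)) summable_on UNIV"
proof -
  have sm: "(\<lambda>i. norm (b i) powr p) summable_on UNIV" using assms(1) by (simp add: lp_space_def)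
  define S where "S = (\<Sum>\<^sub>\<infinity>i. norm (b i) powr p)"
  have le: "norm (b i) powr p \<le> S" for i
    using finite_sum_le_infsum[OF sm, of "{i}"] by (simp add: S_def)
  have S0: "S \<ge> 0" using le[of 0] by (meson order_trans powr_ge_zero)
  show ?thesis
  proof (rule summable_on_comparison_test)
    \<comment> \<open>The inclusion of l^p in l^1 for p \<le> 1: split |b| = |b|^(1-p) |b|^p and
      bound the first factor by its supremum.\<close>
    show "(\<lambda>i. (S powr (1 / p)) powr (1 - p) * norm (b i) powr p) summable_on UNIV"
      by (rule summable_on_cmult_right[OF sm])
    fix i
    have "(norm (b i) powr p) powr (1 / p) \<le> S powr (1 / p)"
      using le assms by (intro powr_mono2) auto
    then have "norm (b i) \<le> S powr (1 / p)" using assms by (simp add: powr_powr)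
    then have "norm (b i) powr (1 - p) \<le> (S powr (1 / p)) powr (1 - p)"
      using assms by (intro powr_mono2) auto
    then have "norm (b i) powr (1 - p) * norm (b i) powr p \<le> (S powr (1 / p)) powr (1 - p) * norm (b i) powr p"
      by (intro mult_right_mono) auto
    then show "norm (b i) \<le> (S powr (1 / p)) powr (1 - p) * norm (b i) powr p"
      by (simp flip: powr_add)
  qed auto
qed

text \<open>The denominator of the transform contains j + i instead of j - i, so the point k + 1/2
  corresponds to the reflected index -k - 1, and the resulting sign disappears in the norm.\<close>

lemma norm_cauchy_half_eq_hilbert:
  "norm (cauchy_transform b (of_int k + 1/2)) = pi * norm (discrete_hilbert b (- k - 1))"
proof -
  have "discrete_hilbert b (- k - 1) = complex_of_real (1 / pi) * (\<Sum>\<^sub>\<infinity>i. - (b i / (of_int k + 1/2 - of_int i)))"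
  proof -
    have "b i / (of_int (- k - 1) + of_int i + 1 / 2) = - (b i / (of_int k + 1/2 - of_int i))" for i
    proof -
      have "of_int (- k - 1) + of_int i + 1 / 2 = - (of_int k + 1/2 - of_int i :: complex)" by simp
      then show ?thesis by (simp only: divide_minus_right)
    qed
    then show ?thesis unfolding discrete_hilbert_def by (simp only:)
  qed
  also have "\<dots> = - (complex_of_real (1 / pi) * cauchy_transform b (of_int k + 1/2))"
    by (simp add: infsum_uminus cauchy_transform_def)
  finally show ?thesis by (simp add: norm_mult norm_divide)
qed

text \<open>Squaring the exponent p/2 restores p-th powers. In 8 = 2 * 4 the 2 comes from squaring a
  sum and the 4 bounds \<pi>^p; the reflection k \<mapsto> -k - 1 is a bijection and leaves the sum
  unchanged.\<close>

lemma boundary_data_summable: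
  assumes p: "0 < p" "p \<le> 1" and b: "b \<in> hardy_space p"
  shows "(\<lambda>k. (boundary_data (p / 2) b k)\<^sup>2) summable_on UNIV"
    and "(\<Sum>\<^sub>\<infinity>k. (boundary_data (p / 2) b k)\<^sup>2) \<le>
      8 * ((\<Sum>\<^sub>\<infinity>i. norm (b i) powr p) + (\<Sum>\<^sub>\<infinity>i. norm (discrete_hilbert b i) powr p))"
proof -
  have sb: "(\<lambda>i. norm (b i) powr p) summable_on UNIV" and sH: "(\<lambda>i. norm (discrete_hilbert b i) powr p) summable_on UNIV"
    using b by (auto simp: hardy_space_def lp_space_def)
  have bij: "bij (\<lambda>k::int. - k - 1)" by (rule involuntory_imp_bij) simp
  have sH': "(\<lambda>k. norm (discrete_hilbert b (- k - 1)) powr p) summable_on UNIV"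
    using summable_on_reindex_bij_betw[OF bij, of "\<lambda>i. norm (discrete_hilbert b i) powr p"] sH by simp
  have eqH: "(\<Sum>\<^sub>\<infinity>k. norm (discrete_hilbert b (- k - 1)) powr p) = (\<Sum>\<^sub>\<infinity>i. norm (discrete_hilbert b i) powr p)"
    using infsum_reindex_bij_betw[OF bij, of "\<lambda>i. norm (discrete_hilbert b i) powr p"] by simp
  let ?g = "\<lambda>k. 8 * (norm (b k) powr p + norm (discrete_hilbert b (- k - 1)) powr p)"
  have sg: "?g summable_on UNIV" by (intro summable_on_cmult_right summable_on_add sb sH')
  have le: "(boundary_data (p / 2) b k)\<^sup>2 \<le> ?g k" for k
  proof -
    have pi_p: "pi powr p \<le> 4"
    proof -
      have "pi powr p \<le> pi powr 1" using p pi_ge_two by (intro powr_mono) auto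
      then show ?thesis using pi_less_4 by simp
    qed
    have sq: "(x powr (p / 2))\<^sup>2 = x powr p" for x :: real
      by (simp add: power2_eq_square flip: powr_add)
    have "(u + v)\<^sup>2 \<le> 2 * (u\<^sup>2 + v\<^sup>2)" for u v :: real
      using zero_le_power2[of "u - v"] by (simp add: power2_eq_square algebra_simps)
    then have "(boundary_data (p / 2) b k)\<^sup>2 \<le> 2 * (norm (b k) powr p + (pi * norm (discrete_hilbert b (- k - 1))) powr p)"
      unfolding boundary_data_def norm_cauchy_half_eq_hilbert sq [symmetric] .
    also have "(pi * norm (discrete_hilbert b (- k - 1))) powr p = pi powr p * norm (discrete_hilbert b (- k - 1)) powr p"
      by (simp add: powr_mult)
    also have "2 * (norm (b k) powr p + pi powr p * norm (discrete_hilbert b (- k - 1)) powr p) \<le>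
        2 * (4 * norm (b k) powr p + 4 * norm (discrete_hilbert b (- k - 1)) powr p)"
      using pi_p by (intro mult_left_mono add_mono mult_right_mono) auto
    finally show ?thesis by simp
  qed
  show sm: "(\<lambda>k. (boundary_data (p / 2) b k)\<^sup>2) summable_on UNIV"
    by (rule summable_on_comparison_test[OF sg]) (use le in auto)
  have "(\<Sum>\<^sub>\<infinity>k. (boundary_data (p / 2) b k)\<^sup>2) \<le> infsum ?g UNIV"
    by (rule infsum_mono[OF sm sg le])
  also have "\<dots> = 8 * ((\<Sum>\<^sub>\<infinity>i. norm (b i) powr p) + (\<Sum>\<^sub>\<infinity>i. norm (discrete_hilbert b i) powr p))"
    unfolding eqH [symmetric] infsum_add[OF sb sH', symmetric]
    by (intro infsum_cmult_right summable_on_add sb sH')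
  finally show "(\<Sum>\<^sub>\<infinity>k. (boundary_data (p / 2) b k)\<^sup>2) \<le>
      8 * ((\<Sum>\<^sub>\<infinity>i. norm (b i) powr p) + (\<Sum>\<^sub>\<infinity>i. norm (discrete_hilbert b i) powr p))" .
qed

text \<open>In the bound for \<open>T_op\<close> at j the four lines carry the weight of j, whereas
  the l^q estimate needs the weight of the line index n. As |n| \<le> |j| + 1 and 2^k \<ge> 1, the
  exchange costs a factor 2.\<close>

lemma dyadic_weight_le_double:
  assumes "0 \<le> \<beta>" "\<beta> \<le> 1" "\<bar>n\<bar> \<le> \<bar>j\<bar> + 1"
  shows "dyadic_weight \<alpha> \<beta> j k \<le> 2 * dyadic_weight \<alpha> \<beta> n k"
proof -
  have nj: "\<bar>real_of_int n\<bar> \<le> \<bar>real_of_int j\<bar> + 1" using assms(3) by linarith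
  have half: "(x + z) / 2 \<le> y + z" if "x \<le> y + 1" "1 \<le> z" "0 \<le> y" for x y z :: real using that by simp
  have le: "(\<bar>of_int n\<bar> + 2 ^ k) / 2 \<le> \<bar>of_int j\<bar> + (2::real) ^ k" by (rule half[OF nj]) auto
  have pos: "\<bar>real_of_int n\<bar> + 2 ^ k > 0" by (simp add: add_nonneg_pos)
  have "(\<bar>of_int j\<bar> + 2 ^ k) powr (-\<beta>) \<le> ((\<bar>of_int n\<bar> + 2 ^ k) / 2) powr (-\<beta>)"
    using le pos assms by (intro powr_mono2') auto
  also have "\<dots> = 2 powr \<beta> * (\<bar>of_int n\<bar> + 2 ^ k) powr (-\<beta>)"
    using pos by (simp add: powr_divide powr_minus_divide)
  also have "\<dots> \<le> 2 powr 1 * (\<bar>of_int n\<bar> + 2 ^ k) powr (-\<beta>)"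
    using assms by (intro mult_right_mono powr_mono) auto
  finally have "(2 ^ k) powr (1 - \<alpha>) * (\<bar>of_int j\<bar> + 2 ^ k) powr (-\<beta>) \<le> (2 ^ k) powr (1 - \<alpha>) * (2 * (\<bar>of_int n\<bar> + 2 ^ k) powr (-\<beta>))"
    by (intro mult_left_mono) auto
  then show ?thesis by (simp add: dyadic_weight_def mult_ac)
qed

definition dyadic_sum :: "real \<Rightarrow> real \<Rightarrow> (int \<Rightarrow> complex) \<Rightarrow> int \<Rightarrow> nat \<Rightarrow> real" where
  "dyadic_sum \<alpha> \<beta> b n K = (\<Sum>k<K. dyadic_weight \<alpha> \<beta> n k * cauchy_sup b n k)"

text \<open>\<open>norm_T_op_le\<close> needs a bound independent of K. The partial sums increase
  with K and are bounded, by the estimate on singletons, so they converge to their suprema and the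
  estimate passes to the limit in each finite sum over J.\<close>

lemma sum_powr_dyadic_sup_le:
  assumes q: "q > 0" and b: "(\<lambda>i. norm (b i)) summable_on UNIV"
    and le: "\<And>J K. finite J \<Longrightarrow> (\<Sum>n\<in>J. (dyadic_sum \<alpha> \<beta> b n K) powr q) \<le> Y"
  shows "bdd_above (range (dyadic_sum \<alpha> \<beta> b n))"
    and "finite J \<Longrightarrow> (\<Sum>n\<in>J. (SUP K. dyadic_sum \<alpha> \<beta> b n K) powr q) \<le> Y"
proof -
  have nonneg: "dyadic_sum \<alpha> \<beta> b n K \<ge> 0" for n K
    unfolding dyadic_sum_def by (intro sum_nonneg mult_nonneg_nonneg cauchy_sup_nonneg[OF b]) auto
  have inc: "incseq (dyadic_sum \<alpha> \<beta> b n)" for n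
    unfolding dyadic_sum_def by (intro incseq_SucI) (simp add: cauchy_sup_nonneg[OF b])
  show bdd: "bdd_above (range (dyadic_sum \<alpha> \<beta> b n))" for n
  proof (rule bdd_aboveI2)
    fix K
    have "(dyadic_sum \<alpha> \<beta> b n K powr q) powr (1 / q) \<le> Y powr (1 / q)"
      using le[of "{n}" K] q by (intro powr_mono2) auto
    then show "dyadic_sum \<alpha> \<beta> b n K \<le> Y powr (1 / q)" using q nonneg by (simp add: powr_powr)
  qed
  have "(\<lambda>K. \<Sum>n\<in>J. (dyadic_sum \<alpha> \<beta> b n K) powr q) \<longlonglongrightarrow> (\<Sum>n\<in>J. (SUP K. dyadic_sum \<alpha> \<beta> b n K) powr q)"
    using q nonneg by (intro tendsto_sum tendsto_powr' LIMSEQ_incseq_SUP[OF bdd inc] tendsto_const) auto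
  then show "(\<Sum>n\<in>J. (SUP K. dyadic_sum \<alpha> \<beta> b n K) powr q) \<le> Y" if "finite J"
    by (rule LIMSEQ_le_const2) (use le[OF that] in auto)
qed

theorem theorem9:
  fixes \<alpha> \<beta> \<gamma> p q :: real
  assumes "0 \<le> \<gamma>" and "\<gamma> < 1"
    and "0 < \<alpha>" and "0 < \<beta>" and "\<alpha> + \<beta> = 1 - \<gamma>"
    and "0 < p" and "p \<le> 1" and "1 / q = 1 / p - \<gamma>"
  shows "\<exists>C>0. \<forall>b\<in>hardy_space p.
           T_op \<alpha> \<beta> b \<in> lp_space q \<and> lp_norm q (T_op \<alpha> \<beta> b) \<le> C * hardy_norm p b"
proof -
  \<comment> \<open>Positivity of q comes from 1/p \<ge> 1 > \<gamma>; since 1/0 = 0 in HOL, this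
    also excludes q = 0.\<close>
  have "1 / p \<ge> 1" using assms by simp
  then have "1 / q > 0" using assms by linarith
  then have q: "q > 0" by simp
  have ab: "\<alpha> + \<beta> \<le> 1" "\<alpha> \<le> 1" "\<beta> \<le> 1" using assms by auto
  have ba: "\<beta> + \<alpha> = 1 - \<gamma>" using assms by simp
  obtain C1 where C1: "C1 > 0 \<and> (\<forall>b J K. (\<lambda>i. norm (b i)) summable_on UNIV \<longrightarrow> (\<lambda>k. (boundary_data (p / 2) b k)\<^sup>2) summable_on UNIV \<longrightarrow> finite J \<longrightarrow>
    (\<Sum>n\<in>J. (\<Sum>k<K. dyadic_weight \<alpha> \<beta> n k * cauchy_sup b n k) powr q) \<le> C1 * (\<Sum>\<^sub>\<infinity>k. (boundary_data (p / 2) b k)\<^sup>2) powr (q / p))"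
    using sum_powr_dyadic_cauchy_sup_le[OF assms(1,3-7) q assms(8)] ..
  obtain C2 where C2: "C2 > 0 \<and> (\<forall>b J K. (\<lambda>i. norm (b i)) summable_on UNIV \<longrightarrow> (\<lambda>k. (boundary_data (p / 2) b k)\<^sup>2) summable_on UNIV \<longrightarrow> finite J \<longrightarrow>
    (\<Sum>n\<in>J. (\<Sum>k<K. dyadic_weight \<beta> \<alpha> n k * cauchy_sup b n k) powr q) \<le> C2 * (\<Sum>\<^sub>\<infinity>k. (boundary_data (p / 2) b k)\<^sup>2) powr (q / p))"
    using sum_powr_dyadic_cauchy_sup_le[OF assms(1,4,3) ba assms(6,7) q assms(8)] ..
  \<comment> \<open>From the inside outwards: 2^q (C1 + C2) bounds the sums of F^q, 4 counts the
    shifted copies of F, one 4^q is 2^q * 2^q from splitting the four-term sum, and the outer 4^q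
    comes from the factor 4 in \<open>T_le\<close>.\<close>
  define C3 where "C3 = 4 powr q * (4 powr q * (4 * (2 powr q * (C1 + C2))))"
  have C3: "C3 > 0" using C1 C2 by (simp add: C3_def)
  define C where "C = C3 powr (1 / q) * (8 powr (1 / p) * 2 powr (1 / p))"
  have "T_op \<alpha> \<beta> b \<in> lp_space q \<and> lp_norm q (T_op \<alpha> \<beta> b) \<le> C * hardy_norm p b" if b: "b \<in> hardy_space p" for b
  proof -
    have b1: "(\<lambda>i. norm (b i)) summable_on UNIV"
      using b assms by (intro lp_space_imp_summable[of b p]) (auto simp: hardy_space_def)
    note f2 = boundary_data_summable[OF assms(6,7) b]
    define X where "X = (\<Sum>\<^sub>\<infinity>k. (boundary_data (p / 2) b k)\<^sup>2)"
    define Sb where "Sb = (\<Sum>\<^sub>\<infinity>i. norm (b i) powr p)"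
    define SH where "SH = (\<Sum>\<^sub>\<infinity>i. norm (discrete_hilbert b i) powr p)"
    have S0: "Sb \<ge> 0" "SH \<ge> 0" by (simp_all add: Sb_def SH_def infsum_nonneg)
    have X0: "X \<ge> 0" by (simp add: X_def infsum_nonneg)
    have X_le: "X \<le> 8 * (Sb + SH)" using f2(2) by (simp add: X_def Sb_def SH_def)
    have le1: "(\<Sum>n\<in>J. (dyadic_sum \<alpha> \<beta> b n K) powr q) \<le> C1 * X powr (q / p)" if "finite J" for J K
      unfolding dyadic_sum_def X_def by (rule conjunct2[OF C1, rule_format, OF b1 f2(1) that])
    have le2: "(\<Sum>n\<in>J. (dyadic_sum \<beta> \<alpha> b n K) powr q) \<le> C2 * X powr (q / p)" if "finite J" for J K
      unfolding dyadic_sum_def X_def by (rule conjunct2[OF C2, rule_format, OF b1 f2(1) that])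
    have sup1: "bdd_above (range (dyadic_sum \<alpha> \<beta> b n))"
      "finite J \<Longrightarrow> (\<Sum>n\<in>J. (SUP K. dyadic_sum \<alpha> \<beta> b n K) powr q) \<le> C1 * X powr (q / p)" for n J
      by (rule sum_powr_dyadic_sup_le[OF q b1 le1]; assumption)+
    have sup2: "bdd_above (range (dyadic_sum \<beta> \<alpha> b n))"
      "finite J \<Longrightarrow> (\<Sum>n\<in>J. (SUP K. dyadic_sum \<beta> \<alpha> b n K) powr q) \<le> C2 * X powr (q / p)" for n J
      by (rule sum_powr_dyadic_sup_le[OF q b1 le2]; assumption)+
    \<comment> \<open>One majorant for both orders of the exponents, because the bound for
      \<open>T_op\<close> uses both weights on each of its four lines.\<close>
    define F where "F = (\<lambda>n. (SUP K. dyadic_sum \<alpha> \<beta> b n K) + (SUP K. dyadic_sum \<beta> \<alpha> b n K))"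
    have F_ge: "dyadic_sum \<alpha> \<beta> b n K + dyadic_sum \<beta> \<alpha> b n K \<le> F n" for n K
      unfolding F_def by (intro add_mono cSUP_upper sup1(1) sup2(1)) auto
    have SUP0: "(SUP K. dyadic_sum \<alpha> \<beta> b n K) \<ge> 0" "(SUP K. dyadic_sum \<beta> \<alpha> b n K) \<ge> 0" for n
      using cSUP_upper[OF UNIV_I sup1(1)[of n], of 0] cSUP_upper[OF UNIV_I sup2(1)[of n], of 0] by (simp_all add: dyadic_sum_def)
    then have F0: "F n \<ge> 0" for n by (simp add: F_def)
    have F_sum: "(\<Sum>n\<in>J. F n powr q) \<le> 2 powr q * (C1 + C2) * X powr (q / p)" if J: "finite J" for J
    proof -
      have "(\<Sum>n\<in>J. F n powr q) \<le> (\<Sum>n\<in>J. 2 powr q * ((SUP K. dyadic_sum \<alpha> \<beta> b n K) powr q + (SUP K. dyadic_sum \<beta> \<alpha> b n K) powr q))"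
        unfolding F_def using SUP0 q by (intro sum_mono powr_add_le_double) auto
      also have "\<dots> = 2 powr q * ((\<Sum>n\<in>J. (SUP K. dyadic_sum \<alpha> \<beta> b n K) powr q) + (\<Sum>n\<in>J. (SUP K. dyadic_sum \<beta> \<alpha> b n K) powr q))"
        by (simp add: sum_distrib_left sum.distrib distrib_left)
      also have "\<dots> \<le> 2 powr q * (C1 * X powr (q / p) + C2 * X powr (q / p))"
        using sup1(2)[OF J] sup2(2)[OF J] by (intro mult_left_mono add_mono) auto
      finally show ?thesis by (simp add: algebra_simps)
    qed
    have T_le: "norm (T_op \<alpha> \<beta> b j) \<le> 4 * ((F j + F (j - 1)) + (F (- j) + F (- j - 1)))" for j
    proof (rule norm_T_op_le[OF assms(3,4) ab(1) b1])
      fix K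
      let ?w = "\<lambda>n k. dyadic_weight \<alpha> \<beta> n k + dyadic_weight \<beta> \<alpha> n k"
      have one: "(\<Sum>k<K. ?w j k * cauchy_sup b n k) \<le> 2 * F n" if n: "\<bar>n\<bar> \<le> \<bar>j\<bar> + 1" for n
      proof -
        have "(\<Sum>k<K. ?w j k * cauchy_sup b n k) \<le> (\<Sum>k<K. (2 * ?w n k) * cauchy_sup b n k)"
        proof (intro sum_mono mult_right_mono cauchy_sup_nonneg[OF b1])
          fix k
          show "?w j k \<le> 2 * ?w n k"
            using dyadic_weight_le_double[OF _ ab(3) n, of \<alpha> k] dyadic_weight_le_double[OF _ ab(2) n, of \<beta> k] assms(3,4) by simp
        qed
        also have "\<dots> = 2 * (dyadic_sum \<alpha> \<beta> b n K + dyadic_sum \<beta> \<alpha> b n K)"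
          by (simp add: dyadic_sum_def sum_distrib_left sum.distrib algebra_simps)
        also have "\<dots> \<le> 2 * F n" using F_ge by (intro mult_left_mono) auto
        finally show ?thesis .
      qed
      have "2 * (\<Sum>k<K. ?w j k * (cauchy_sup b j k + cauchy_sup b (j - 1) k + cauchy_sup b (- j) k + cauchy_sup b (- j - 1) k))
        = 2 * (((\<Sum>k<K. ?w j k * cauchy_sup b j k) + (\<Sum>k<K. ?w j k * cauchy_sup b (j - 1) k))
          + ((\<Sum>k<K. ?w j k * cauchy_sup b (- j) k) + (\<Sum>k<K. ?w j k * cauchy_sup b (- j - 1) k)))"
        by (simp add: distrib_left sum.distrib)
      also have "\<dots> \<le> 2 * ((2 * F j + 2 * F (j - 1)) + (2 * F (- j) + 2 * F (- j - 1)))"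
        by (intro mult_left_mono add_mono one) auto
      finally show "2 * (\<Sum>k<K. ?w j k * (cauchy_sup b j k + cauchy_sup b (j - 1) k + cauchy_sup b (- j) k + cauchy_sup b (- j - 1) k))
        \<le> 4 * ((F j + F (j - 1)) + (F (- j) + F (- j - 1)))" by simp
    qed (rule norm_cauchy_le_cauchy_sup[OF b1])
    have T_sum: "(\<Sum>j\<in>J. norm (T_op \<alpha> \<beta> b j) powr q) \<le> C3 * X powr (q / p)" if J: "finite J" for J
    proof -
      let ?Y = "2 powr q * (C1 + C2) * X powr (q / p)"
      \<comment> \<open>The four line indices are injective functions of j, so each copy is again a
        sum of F^q over a finite set, under the same bound.\<close>
      have shift: "(\<Sum>j\<in>J. F (g j) powr q) \<le> ?Y" if "inj_on g J" for g
      proof -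
        have "(\<Sum>j\<in>J. F (g j) powr q) = (\<Sum>n\<in>g ` J. F n powr q)" using that by (simp add: sum.reindex)
        also have "\<dots> \<le> ?Y" using J by (intro F_sum) auto
        finally show ?thesis .
      qed
      have "norm (T_op \<alpha> \<beta> b j) powr q \<le> 4 powr q * (4 powr q * (((F j powr q + F (j - 1) powr q) + (F (- j) powr q + F (- j - 1) powr q))))" for j
      proof -
        have "norm (T_op \<alpha> \<beta> b j) powr q \<le> (4 * ((F j + F (j - 1)) + (F (- j) + F (- j - 1)))) powr q"
          using T_le q by (intro powr_mono2) auto
        also have "\<dots> = 4 powr q * ((F j + F (j - 1)) + (F (- j) + F (- j - 1))) powr q"
          by (rule powr_mult)
        also have "((F j + F (j - 1)) + (F (- j) + F (- j - 1))) powr q \<le> 2 powr q * ((F j + F (j - 1)) powr q + (F (- j) + F (- j - 1)) powr q)"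
          using F0 q by (intro powr_add_le_double add_nonneg_nonneg) auto
        also have "\<dots> \<le> 2 powr q * (2 powr q * (F j powr q + F (j - 1) powr q) + 2 powr q * (F (- j) powr q + F (- j - 1) powr q))"
          using F0 q by (intro mult_left_mono add_mono powr_add_le_double) auto
        also have "\<dots> = (2 powr q * 2 powr q) * ((F j powr q + F (j - 1) powr q) + (F (- j) powr q + F (- j - 1) powr q))"
          by (simp add: algebra_simps)
        also have "2 powr q * 2 powr q = (4::real) powr q" by (simp flip: powr_mult)
        finally show ?thesis by (simp add: mult_left_mono)
      qed
      then have "(\<Sum>j\<in>J. norm (T_op \<alpha> \<beta> b j) powr q) \<le> (\<Sum>j\<in>J. 4 powr q * (4 powr q * (((F j powr q + F (j - 1) powr q) + (F (- j) powr q + F (- j - 1) powr q)))))"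
        by (intro sum_mono)
      also have "\<dots> = 4 powr q * (4 powr q * (((\<Sum>j\<in>J. F j powr q) + (\<Sum>j\<in>J. F (j - 1) powr q)) + ((\<Sum>j\<in>J. F (- j) powr q) + (\<Sum>j\<in>J. F (- j - 1) powr q))))"
        by (simp only: sum_distrib_left [symmetric] sum.distrib)
      also have "\<dots> \<le> 4 powr q * (4 powr q * ((?Y + ?Y) + (?Y + ?Y)))"
        using shift[of "\<lambda>j. j"] shift[of "\<lambda>j. j - 1"] shift[of uminus] shift[of "\<lambda>j. - j - 1"]
        by (intro mult_left_mono add_mono) (auto simp: inj_on_def)
      also have "\<dots> = C3 * X powr (q / p)" by (simp add: C3_def)
      finally show ?thesis .
    qed
    have sm: "(\<lambda>j. norm (T_op \<alpha> \<beta> b j) powr q) summable_on UNIV"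
    proof (rule nonneg_bdd_above_summable_on)
      show "bdd_above (sum (\<lambda>j. norm (T_op \<alpha> \<beta> b j) powr q) ` {F. F \<subseteq> UNIV \<and> finite F})"
        by (rule bdd_aboveI2) (use T_sum in auto)
    qed auto
    have "(\<Sum>\<^sub>\<infinity>j. norm (T_op \<alpha> \<beta> b j) powr q) \<le> C3 * X powr (q / p)"
      by (rule infsum_le_finite_sums[OF sm T_sum])
    then have "lp_norm q (T_op \<alpha> \<beta> b) \<le> (C3 * X powr (q / p)) powr (1 / q)"
      unfolding lp_norm_def using q by (intro powr_mono2 infsum_nonneg) auto
    also have "\<dots> = C3 powr (1 / q) * X powr (1 / p)"
      using C3 X0 q by (simp add: powr_mult powr_powr)
    also have "\<dots> \<le> C3 powr (1 / q) * (8 * (Sb + SH)) powr (1 / p)"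
      using X_le X0 assms(6) by (intro mult_left_mono powr_mono2) auto
    also have "\<dots> = C3 powr (1 / q) * (8 powr (1 / p) * (Sb + SH) powr (1 / p))"
      by (simp only: powr_mult)
    \<comment> \<open>Since 1/p \<ge> 1, the sum of the two p-th power sums is separated into the
      two summands of the Hardy norm at the cost of 2^(1/p).\<close>
    also have "\<dots> \<le> C3 powr (1 / q) * (8 powr (1 / p) * (2 powr (1 / p) * (Sb powr (1 / p) + SH powr (1 / p))))"
      using S0 assms(6) by (intro mult_left_mono powr_add_le_double) auto
    also have "\<dots> = C * hardy_norm p b"
      by (simp add: C_def hardy_norm_def lp_norm_def Sb_def SH_def)
    finally show ?thesis using sm by (simp add: lp_space_def)
  qed
  moreover have "C > 0" using C3 by (simp add: C_def)
  ultimately show ?thesis by blast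
qed

end
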